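(* The family $\{J^{\lambda}_\beta\}_{\beta\in Q_+}$ satisfies $J^{\lambda}_0=1$ and, for every $\beta\in Q_+$, $$J^{\lambda}_\beta=\sum_{\gamma\in Q_+,\ \beta-\gamma\in Q_+}\frac{1}{(q)_{\beta-\gamma}}\,q^{(\gamma,\gamma)/2-(\lambda+\rho,\gamma)}\,J^{\lambda}_\gamma ,$$ and the quantities $J^\lambda_\beta$ are uniquely characterized by $J^\lambda_0=1$ together with this recursion. In particular, $J^{\lambda}_\beta$ is independent of the choice of the orientation $\epsilon$ entering its definition.
   Context: Let $\mathfrak g$ be a complex simple Lie algebra of rank $l$, with simple roots $\alpha_1,\dots,\alpha_l$, fundamental weights $\omega_1,\dots,\omega_l$, $P=\oplus_i\mathbb Z\omega_i$, $Q=\oplus_i\mathbb Z\alpha_i$, $P_+=\oplus_i\mathbb Z_{\ge0}\omega_i$, $Q_+=\oplus_i\mathbb Z_{\ge0}\alpha_i$. Fix a nondegenerate invariant bilinear form $(\cdot,\cdot)$ with $(P,Q)\subset\mathbb Z$, normalized so that $d_i=(\alpha_i,\alpha_i)/2$ are relatively prime positive integers; $\rho=\sum_i\omega_i$. Let $\mathcal N$ be a positive integer with $(P,P)\subset\frac1{\mathcal N}\mathbb Z$, $\mathbb K=\mathbb C(v^{1/\mathcal N})$, $v_i=v^{d_i}$, $q=v^2$, $q_i=q^{d_i}$, and $(a;p)_n=\prod_{k=0}^{n-1}(1-ap^k)$; for $\beta=\sum_i m_i\alpha_i$ put $(q)_\beta=\prod_i(q_i;q_i)_{m_i}$. $U_v(\mathfrak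 g)$ is the $\mathbb K$-algebra with generators $E_i,F_i$ ($1\le i\le l$), $K_\mu$ ($\mu\in P$) and relations $K_\mu K_{\mu'}=K_{\mu+\mu'}$, $K_0=1$, $K_\mu E_iK_\mu^{-1}=v^{(\mu,\alpha_i)}E_i$, $K_\mu F_iK_\mu^{-1}=v^{-(\mu,\alpha_i)}F_i$, $[E_i,F_j]=\delta_{ij}\frac{K_i-K_i^{-1}}{v_i-v_i^{-1}}$ ($K_i=K_{\alpha_i}$), plus the quantum Serre relations. $U_{v^{-1}}(\mathfrak g)$ is the same algebra with $v$ replaced by $v^{-1}$, with generators $\bar E_i,\bar F_i,\bar K_\mu$. Let $\sigma:U_v(\mathfrak g)\to U_{v^{-1}}(\mathfrak g)$ be the $\mathbb K$-linear algebra anti-isomorphism $E_i\mapsto\bar F_i$, $F_i\mapsto\bar E_i$, $K_\mu\mapsto\bar K_\mu^{-1}$. For $\lambda\in P$, $\mathcal V^\lambda$ is the Verma module over $U_v(\mathfrak g)$ generated by ${\bf 1}^\lambda$ with $E_i{\bf 1}^\lambda=0$, $K_\mu{\bf 1}^\lambda=v^{(\mu,\lambda)}{\bf 1}^\lambda$, and $\bar{\mathcal V}^\lambda$ the Verma module over $U_{v^{-1}}(\mathfrak g)$ generated by $\bar{\bf 1}^\lambda$ with $\bar E_i\bar{\bf 1}^\lambda=0$, $\bar K_\mu\bar{\bf 1}^\lambda=v^{-(\mu,\lambda)}\bar{\bf 1}^\lambda$. Weight components: $(\mathcal V^\lambda)_\beta=\{w:K_\mu w=v^{(\mu,\lambda-\beta)}w\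 \forall\mu\}$, $(\bar{\mathcal V}^\lambda)_\beta=\{w:\bar K_\mu w=v^{-(\mu,\lambda-\beta)}w\ \forall \mu\}$, $\beta\in Q_+$. There is a unique nondegenerate $\mathbb K$-bilinear pairing $(\cdot,\cdot):\mathcal V^\lambda\times\bar{\mathcal V}^\lambda\to\mathbb K$ with $({\bf 1}^\lambda,\bar{\bf 1}^\lambda)=1$ and $(xw,w')=(w,\sigma(x)w')$. Completions: $\widehat{\mathcal V}^\lambda=\prod_{\beta\in Q_+}(\mathcal V^\lambda)_\beta$, similarly $\widehat{\bar{\mathcal V}}^\lambda$. Whittaker data: an orientation of the Dynkin diagram, i.e. a skew-symmetric matrix $\epsilon=(\epsilon_{ij})$ with $\epsilon_{ij}=1$ if there is an arrow from $i$ to $j$ and $\epsilon_{ij}=0$ if $i,j$ are not adjacent; elements $\nu_i\in P$ with $(\nu_i,\alpha_j)-(\nu_j,\alpha_i)=\epsilon_{ij}(\alpha_i,\alpha_j)$ for all $i,j$; nonzero scalars $c_i\in\mathbb K$. The Whittaker vector $\theta^\lambda=\theta^\lambda(\epsilon,\nu,c)=\sum_\beta\theta^\lambda_\beta\in\widehat{\mathcal V}^\lambda$ ($\theta^\lambda_\beta\in(\mathcal V^\lambda)_\beta$) is the unique element with $\theta^\lambda_0={\bf 1}^\lambda$ and $E_iK_{\nu_i}\theta^\lambda=\frac{c_i}{1-v_i^2}\theta^\lambda$ for all $i$; the dual Whittaker vector $\bar\theta^\lambda=\bar\theta^\lambda(\epsilon,\nu,c)\in\widehat{\bar{\mathcal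 V}}^\lambda$ is the unique element with $\bar\theta^\lambda_0=\bar{\bf 1}^\lambda$ and $\bar E_i\bar K_{\nu_i}\bar\theta^\lambda=\frac{c_i^{-1}}{1-v_i^{-2}}\bar\theta^\lambda$ (existence and uniqueness are known). Define $J^\lambda_\beta=v^{-(\beta,\beta)/2+(\lambda,\beta)}(\theta^\lambda_\beta,\bar\theta^\lambda_\beta)$ for $\beta\in Q_+$ and $J^\lambda_\beta=0$ for $\beta\notin Q_+$; it is known to be independent of $\nu$ and $c$.
   Formalization: The formal theorem assumes that the nondegenerate pairing between the two Verma modules exists for the given λ; the context asserts this for every λ in P, but it fails for example for sl_2 and λ = 0, where neither the pairing nor the Whittaker vector exists. *)

theory Defs
  imports Complex_Main "HOL-Computational_Algebra.Polynomial" "HOL-Computational_Algebra.Fraction_Field" "HOL-Library.Function_Algebras"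
begin

section \<open>Ground field and powers of v\<close>

text \<open>K = C(t) with t = v^(1/N).  Elements of h* (weights) are rational vectors
 in the basis of simple roots: mu = sum_i mu(i) alpha_i, with mu(i) = 0 for i >= l.
 The matrix B i j = (alpha_i, alpha_j) encodes the normalized invariant form.\<close>

type_synonym K = "complex poly fract"
type_synonym wt = "nat \<Rightarrow> rat"

definition tvar :: K where "tvar = Fract [:0, 1:] 1"

text \<open>vpow tt N r = tt^(N r); with tt = t this is v^r, with tt = t^(-1) it is (v^(-1))^r.\<close>
definition vpow :: "K \<Rightarrow> nat \<Rightarrow> rat \<Rightarrow> K" where
  "vpow tt N r = tt powi \<lfloor>of_nat N * r\<rfloor>"

section \<open>Root data\<close>

definition alpha :: "nat \<Rightarrow> wt" where "alpha j = (\<lambda>i. if i = j then 1 else 0)"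

definition dd :: "(nat \<Rightarrow> nat \<Rightarrow> int) \<Rightarrow> nat \<Rightarrow> int" where "dd B i = B i i div 2"

definition form :: "nat \<Rightarrow> (nat \<Rightarrow> nat \<Rightarrow> int) \<Rightarrow> wt \<Rightarrow> wt \<Rightarrow> rat" where
  "form l B x y = (\<Sum>i<l. \<Sum>j<l. x i * y j * of_int (B i j))"

definition adjacent :: "(nat \<Rightarrow> nat \<Rightarrow> int) \<Rightarrow> nat \<Rightarrow> nat \<Rightarrow> bool" where
  "adjacent B i j \<longleftrightarrow> i \<noteq> j \<and> B i j \<noteq> 0"

text \<open>B is the matrix ((alpha_i,alpha_j)) of a complex simple Lie algebra of rank l
 (finite type = positive definite, indecomposable = connected Dynkin diagram),
 normalized so that d_i = (alpha_i,alpha_i)/2 are relatively prime positive integers.\<close>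
definition simple_root_datum :: "nat \<Rightarrow> (nat \<Rightarrow> nat \<Rightarrow> int) \<Rightarrow> bool" where
  "simple_root_datum l B \<longleftrightarrow>
     l \<ge> 1
   \<and> (\<forall>i<l. \<forall>j<l. B i j = B j i)
   \<and> (\<forall>i<l. B i i > 0 \<and> even (B i i))
   \<and> (\<forall>i<l. \<forall>j<l. i \<noteq> j \<longrightarrow> B i j \<le> 0 \<and> (2 * B i j) mod (B i i) = 0)
   \<and> (\<forall>x::nat \<Rightarrow> real. (\<exists>i<l. x i \<noteq> 0) \<longrightarrow>
          (\<Sum>i<l. \<Sum>j<l. x i * x j * of_int (B i j)) > 0)
   \<and> (\<forall>i<l. \<forall>j<l. (i, j) \<in> ({(a, b). a < l \<and> b < l \<and> adjacent B a b})\<^sup>*)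
   \<and> Gcd {dd B i | i. i < l} = 1"

definition cartan :: "(nat \<Rightarrow> nat \<Rightarrow> int) \<Rightarrow> nat \<Rightarrow> nat \<Rightarrow> int" where
  "cartan B i j = 2 * B i j div B i i"

text \<open>weight lattice P, root lattice Q_+\<close>
definition inP :: "nat \<Rightarrow> (nat \<Rightarrow> nat \<Rightarrow> int) \<Rightarrow> wt \<Rightarrow> bool" where
  "inP l B mu \<longleftrightarrow> (\<forall>i\<ge>l. mu i = 0) \<and>
     (\<forall>j<l. \<exists>k::int. form l B mu (alpha j) = of_int (k * dd B j))"

definition inQplus :: "nat \<Rightarrow> wt \<Rightarrow> bool" where
  "inQplus l mu \<longleftrightarrow> (\<forall>i\<ge>l. mu i = 0) \<and> (\<forall>i<l. \<exists>n::nat. mu i = of_nat n)"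

definition fundw :: "nat \<Rightarrow> (nat \<Rightarrow> nat \<Rightarrow> int) \<Rightarrow> nat \<Rightarrow> wt" where
  "fundw l B i = (THE mu. (\<forall>k\<ge>l. mu k = 0) \<and>
      (\<forall>j<l. form l B mu (alpha j) = (if i = j then of_int (dd B i) else 0)))"

definition rho :: "nat \<Rightarrow> (nat \<Rightarrow> nat \<Rightarrow> int) \<Rightarrow> wt" where
  "rho l B = (\<Sum>i<l. fundw l B i)"

text \<open>N with (P,P) in (1/N) Z\<close>
definition admissible_N :: "nat \<Rightarrow> (nat \<Rightarrow> nat \<Rightarrow> int) \<Rightarrow> nat \<Rightarrow> bool" where
  "admissible_N l B N \<longleftrightarrow> N > 0 \<and>
     (\<forall>mu nu. inP l B mu \<longrightarrow> inP l B nu \<longrightarrow> (\<exists>k::int. of_nat N * form l B mu nu = of_int k))"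

section \<open>Free algebra on the generators E_i, F_i, K_mu\<close>

datatype letter = LE nat | LF nat | LK wt

fun valid_letter :: "nat \<Rightarrow> (nat \<Rightarrow> nat \<Rightarrow> int) \<Rightarrow> letter \<Rightarrow> bool" where
  "valid_letter l B (LE i) = (i < l)"
| "valid_letter l B (LF i) = (i < l)"
| "valid_letter l B (LK mu) = inP l B mu"

type_synonym fa = "letter list \<Rightarrow> K"

definition mono :: "letter list \<Rightarrow> fa" where
  "mono w = (\<lambda>u. if u = w then 1 else 0)"

definition fone :: fa where "fone = mono []"

definition fmul :: "fa \<Rightarrow> fa \<Rightarrow> fa" where
  "fmul f g = (\<lambda>w. \<Sum>k\<le>length w. f (take k w) * g (drop k w))"

definition fsc :: "K \<Rightarrow> fa \<Rightarrow> fa" where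
  "fsc c f = (\<lambda>w. c * f w)"

inductive_set fspan :: "fa set \<Rightarrow> fa set" for S where
  fspan_zero: "0 \<in> fspan S"
| fspan_base: "x \<in> S \<Longrightarrow> x \<in> fspan S"
| fspan_add: "x \<in> fspan S \<Longrightarrow> y \<in> fspan S \<Longrightarrow> x + y \<in> fspan S"
| fspan_scale: "x \<in> fspan S \<Longrightarrow> fsc c x \<in> fspan S"

text \<open>the free algebra on the admissible generators\<close>
definition Aset :: "nat \<Rightarrow> (nat \<Rightarrow> nat \<Rightarrow> int) \<Rightarrow> fa set" where
  "Aset l B = fspan {mono w | w. \<forall>a\<in>set w. valid_letter l B a}"

section \<open>Quantum numbers\<close>

definition qint :: "K \<Rightarrow> nat \<Rightarrow> K" where
  "qint x n = (x ^ n - inverse x ^ n) / (x - inverse x)"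

definition qfact :: "K \<Rightarrow> nat \<Rightarrow> K" where
  "qfact x n = (\<Prod>k=1..n. qint x k)"

definition qbinom :: "K \<Rightarrow> nat \<Rightarrow> nat \<Rightarrow> K" where
  "qbinom x n k = qfact x n / (qfact x k * qfact x (n - k))"

section \<open>Defining relations of U_v(g); tt = t gives U_v(g), tt = t^(-1) gives U_(v^(-1))(g)\<close>

definition serre :: "nat \<Rightarrow> (nat \<Rightarrow> nat \<Rightarrow> int) \<Rightarrow> nat \<Rightarrow> K \<Rightarrow> (nat \<Rightarrow> letter) \<Rightarrow> nat \<Rightarrow> nat \<Rightarrow> fa" where
  "serre l B N tt X i j =
     (let n = nat (1 - cartan B i j); vi = vpow tt N (of_int (dd B i)) in
      (\<Sum>r\<le>n. fsc ((-1) ^ r * qbinom vi n r)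
         (mono (replicate (n - r) (X i) @ [X j] @ replicate r (X i)))))"

definition rels :: "nat \<Rightarrow> (nat \<Rightarrow> nat \<Rightarrow> int) \<Rightarrow> nat \<Rightarrow> K \<Rightarrow> fa set" where
  "rels l B N tt =
     {mono [LK mu, LK mu'] - mono [LK (mu + mu')] | mu mu'. inP l B mu \<and> inP l B mu'}
   \<union> {mono [LK 0] - fone}
   \<union> {mono [LK mu, LE i] - fsc (vpow tt N (form l B mu (alpha i))) (mono [LE i, LK mu])
        | mu i. inP l B mu \<and> i < l}
   \<union> {mono [LK mu, LF i] - fsc (vpow tt N (- form l B mu (alpha i))) (mono [LF i, LK mu])
        | mu i. inP l B mu \<and> i < l}
   \<union> {mono [LE i, LF j] - mono [LF j, LE i]
        - (if i = j then fsc (inverse (vpow tt N (of_int (dd B i)) - inverse (vpow tt N (of_int (dd B i)))))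
                             (mono [LK (alpha i)] - mono [LK (- alpha i)]) else 0)
        | i j. i < l \<and> j < l}
   \<union> {serre l B N tt LE i j | i j. i < l \<and> j < l \<and> i \<noteq> j}
   \<union> {serre l B N tt LF i j | i j. i < l \<and> j < l \<and> i \<noteq> j}"

section \<open>Verma modules\<close>

text \<open>The Verma module of highest weight lam over U_tt is the free algebra modulo
 Iv = (two-sided ideal of relations) + (left ideal generated by E_i and K_mu - tt^(N(mu,lam))).
 Elements of the Verma module are represented by elements of Aset, modulo Iv.\<close>
definition Iv :: "nat \<Rightarrow> (nat \<Rightarrow> nat \<Rightarrow> int) \<Rightarrow> nat \<Rightarrow> K \<Rightarrow> wt \<Rightarrow> fa set" where
  "Iv l B N tt lam = fspan (
      {fmul (fmul (mono u) r) (mono w) | u r w. (\<forall>a\<in>set u. valid_letter l B a)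
            \<and> (\<forall>a\<in>set w. valid_letter l B a) \<and> r \<in> rels l B N tt}
    \<union> {fmul (mono u) (mono [LE i]) | u i. (\<forall>a\<in>set u. valid_letter l B a) \<and> i < l}
    \<union> {fmul (mono u) (mono [LK mu] - fsc (vpow tt N (form l B mu lam)) fone)
         | u mu. (\<forall>a\<in>set u. valid_letter l B a) \<and> inP l B mu})"

text \<open>weight component (V^lam)_beta\<close>
definition in_comp :: "nat \<Rightarrow> (nat \<Rightarrow> nat \<Rightarrow> int) \<Rightarrow> nat \<Rightarrow> K \<Rightarrow> wt \<Rightarrow> wt \<Rightarrow> fa \<Rightarrow> bool" where
  "in_comp l B N tt lam beta w \<longleftrightarrow> w \<in> Aset l B \<and>
     (\<forall>mu. inP l B mu \<longrightarrow>
        fmul (mono [LK mu]) w - fsc (vpow tt N (form l B mu (lam - beta))) w \<in> Iv l B N tt lam)"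

text \<open>A Whittaker vector in the completion, given by its components theta_beta (beta in Q_+).
 With tt = t, coefficient c_i/(1-v_i^2); with tt = t^(-1) and c replaced by c^(-1), this is
 the dual Whittaker condition.\<close>
definition is_whittaker :: "nat \<Rightarrow> (nat \<Rightarrow> nat \<Rightarrow> int) \<Rightarrow> nat \<Rightarrow> K \<Rightarrow> wt \<Rightarrow> (nat \<Rightarrow> wt)
     \<Rightarrow> (nat \<Rightarrow> K) \<Rightarrow> (wt \<Rightarrow> fa) \<Rightarrow> bool" where
  "is_whittaker l B N tt lam nu c theta \<longleftrightarrow>
     (\<forall>beta. inQplus l beta \<longrightarrow> in_comp l B N tt lam beta (theta beta))
   \<and> theta 0 - fone \<in> Iv l B N tt lam
   \<and> (\<forall>i<l. \<forall>beta. inQplus l beta \<longrightarrow>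
        fmul (mono [LE i, LK (nu i)]) (theta (beta + alpha i))
        - fsc (c i / (1 - vpow tt N (of_int (dd B i)) ^ 2)) (theta beta) \<in> Iv l B N tt lam)"

section \<open>The pairing between V^lam and bar V^lam\<close>

fun swl :: "letter \<Rightarrow> letter" where
  "swl (LE i) = LF i" | "swl (LF i) = LE i" | "swl (LK mu) = LK (- mu)"

text \<open>sigma: linear anti-homomorphism E_i -> bar F_i, F_i -> bar E_i, K_mu -> bar K_(-mu)\<close>
definition sigma :: "fa \<Rightarrow> fa" where
  "sigma x = (\<lambda>u. x (rev (map swl u)))"

definition is_pairing :: "nat \<Rightarrow> (nat \<Rightarrow> nat \<Rightarrow> int) \<Rightarrow> nat \<Rightarrow> wt \<Rightarrow> (fa \<Rightarrow> fa \<Rightarrow> K) \<Rightarrow> bool" where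
  "is_pairing l B N lam P \<longleftrightarrow>
     (\<forall>x\<in>Aset l B. \<forall>y\<in>Aset l B. \<forall>z\<in>Aset l B.
         P (x + y) z = P x z + P y z \<and> P z (x + y) = P z x + P z y)
   \<and> (\<forall>a x y. x \<in> Aset l B \<longrightarrow> y \<in> Aset l B \<longrightarrow>
         P (fsc a x) y = a * P x y \<and> P x (fsc a y) = a * P x y)
   \<and> (\<forall>x\<in>Iv l B N tvar lam. \<forall>y\<in>Aset l B. P x y = 0)
   \<and> (\<forall>x\<in>Aset l B. \<forall>y\<in>Iv l B N (inverse tvar) lam. P x y = 0)
   \<and> P fone fone = 1
   \<and> (\<forall>x\<in>Aset l B. \<forall>w\<in>Aset l B. \<forall>w'\<in>Aset l B. P (fmul x w) w' = P w (fmul (sigma x) w'))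
   \<and> (\<forall>w\<in>Aset l B. (\<forall>w'\<in>Aset l B. P w w' = 0) \<longrightarrow> w \<in> Iv l B N tvar lam)
   \<and> (\<forall>w'\<in>Aset l B. (\<forall>w\<in>Aset l B. P w w' = 0) \<longrightarrow> w' \<in> Iv l B N (inverse tvar) lam)"

definition pairval :: "nat \<Rightarrow> (nat \<Rightarrow> nat \<Rightarrow> int) \<Rightarrow> nat \<Rightarrow> wt \<Rightarrow> fa \<Rightarrow> fa \<Rightarrow> K" where
  "pairval l B N lam = (SOME P. is_pairing l B N lam P)"

section \<open>Whittaker data and J\<close>

definition whittaker_data :: "nat \<Rightarrow> (nat \<Rightarrow> nat \<Rightarrow> int) \<Rightarrow> (nat \<Rightarrow> nat \<Rightarrow> int)
     \<Rightarrow> (nat \<Rightarrow> wt) \<Rightarrow> (nat \<Rightarrow> K) \<Rightarrow> bool" where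
  "whittaker_data l B eps nu c \<longleftrightarrow>
     (\<forall>i<l. \<forall>j<l. eps i j = - eps j i)
   \<and> (\<forall>i<l. \<forall>j<l. adjacent B i j \<longrightarrow> eps i j = 1 \<or> eps i j = -1)
   \<and> (\<forall>i<l. \<forall>j<l. \<not> adjacent B i j \<longrightarrow> eps i j = 0)
   \<and> (\<forall>i<l. inP l B (nu i))
   \<and> (\<forall>i<l. \<forall>j<l. form l B (nu i) (alpha j) - form l B (nu j) (alpha i)
                    = of_int (eps i j * B i j))
   \<and> (\<forall>i<l. c i \<noteq> 0)"

definition Jfun :: "nat \<Rightarrow> (nat \<Rightarrow> nat \<Rightarrow> int) \<Rightarrow> nat \<Rightarrow> wt \<Rightarrow> (nat \<Rightarrow> wt) \<Rightarrow> (nat \<Rightarrow> K) \<Rightarrow> wt \<Rightarrow> K" where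
  "Jfun l B N lam nu c beta =
     (if inQplus l beta then
        (let theta = (SOME th. is_whittaker l B N tvar lam nu c th);
             thetab = (SOME th. is_whittaker l B N (inverse tvar) lam nu (\<lambda>i. inverse (c i)) th)
         in vpow tvar N (- form l B beta beta / 2 + form l B lam beta)
            * pairval l B N lam (theta beta) (thetab beta))
      else 0)"

text \<open>(q)_beta = prod_i (q_i;q_i)_{m_i}, q_i = v^(2 d_i)\<close>
definition qpoch :: "nat \<Rightarrow> (nat \<Rightarrow> nat \<Rightarrow> int) \<Rightarrow> nat \<Rightarrow> wt \<Rightarrow> K" where
  "qpoch l B N beta = (\<Prod>i<l. \<Prod>k<nat \<lfloor>beta i\<rfloor>. 1 - vpow tvar N (of_int (2 * dd B i)) ^ (k + 1))"

text \<open>right-hand side of the recursion (q^r = v^(2r))\<close>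
definition Jrec :: "nat \<Rightarrow> (nat \<Rightarrow> nat \<Rightarrow> int) \<Rightarrow> nat \<Rightarrow> wt \<Rightarrow> (wt \<Rightarrow> K) \<Rightarrow> wt \<Rightarrow> K" where
  "Jrec l B N lam J beta =
     (\<Sum>gamma\<in>{gamma. inQplus l gamma \<and> inQplus l (beta - gamma)}.
        inverse (qpoch l B N (beta - gamma))
        * vpow tvar N (2 * (form l B gamma gamma / 2 - form l B (lam + rho l B) gamma))
        * J gamma)"

end

(* The pairing is nondegenerate and lam is integral, so (lam, alpha_i) < 0 for all i: otherwise
   a power of some F_i would give a singular vector, which the pairing kills although it is nonzero in
   the Verma module.

   The orientation has no cycles, so the simple roots can be ordered along the arrows. Applying to a
   Whittaker vector, in this order, a twisted q-exponential in each F_j changes only the Whittaker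
   condition for E_j; after all steps every condition has changed exactly as if the component of weight
   lam - beta had been multiplied by v^(2(lam+rho,beta)-(beta,beta)). As singular vectors vanish, this
   scalar action is what the composite does: it plays the role of the Casimir element. Since
   the exponent is nonzero for beta <> 0, the same identity read as a recursion constructs the Whittaker
   vector. Pairing it with the dual Whittaker vector moves each F_j over to E_j, which acts by scalars,
   and gives the recursion for J; there the orientation, nu and c have dropped out. *)
theory Submission
  imports Defs
begin

section \<open>Highest weight modules and the Casimir equation\<close>

text \<open>\<open>Jfun\<close> selects the two Whittaker vectors by choice, so their existence has
  to be proved. This is where the sign of (lam, alpha_i) is used: being a negative multiple of d_i,
  it makes (lam+rho, beta) nonpositive, and the exponent cannot vanish. The sign in turn needs the
  powers of F_i to be nonzero in the Verma module; no basis theorem is invoked for this, but a model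
  on words in the F_i, in which the Serre elements never reach words with one repeated letter. The
  order of the steps is forced. F_j commutes with E_i, so step j preserves condition i as soon as
  the powers of v agree. This is one equation between (nu_j, alpha_i) and (nu_i, alpha_j), and it
  reads differently before and after step i has changed condition i. The arrow between i and j
  decides which of the two versions holds. Two devices keep the algebra elementary. On components of
  fixed weight every K_mu is a power of t, so all twists become integer exponents affine in the
  index. And the quotient by \<open>Iv\<close> is replaced by its image in functionals on words,
  faithful by nondegeneracy; exchanging t with its inverse gives the dual module.\<close>

definition lin :: "nat \<Rightarrow> int \<Rightarrow> (nat \<Rightarrow> int) \<Rightarrow> (nat \<Rightarrow> nat) \<Rightarrow> int" where
  "lin l p M b = p + (\<Sum>r<l. int (b r) * M r)"

lemma sum_fun_upd_low:
  fixes b :: "nat \<Rightarrow> nat"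
  assumes "j < l" "n \<le> b j"
  shows "(\<Sum>r<l. int ((b(j := b j - n)) r) * M r) = (\<Sum>r<l. int (b r) * M r) - int n * M j"
proof -
  have "(\<Sum>r<l. int ((b(j := b j - n)) r) * M r) = (\<Sum>r<l. int (b r) * M r - (if r = j then int n * M j else 0))"
    by (rule sum.cong) (use assms(2) in \<open>auto simp: of_nat_diff algebra_simps\<close>)
  also have "\<dots> = (\<Sum>r<l. int (b r) * M r) - int n * M j"
    unfolding sum_subtractf using assms(1) by (subst sum.delta) auto
  finally show ?thesis .
qed

lemma lin_low:
  assumes "j < l" "n \<le> b j"
  shows "lin l p M (b(j := b j - n)) = lin l p M b - int n * M j"
  using sum_fun_upd_low[where j = j and l = l and n = n and b = b and M = M] assms by (simp add: lin_def)

lemma lin_Suc: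
  assumes "j < l"
  shows "lin l p M (b(j := b j + n)) = lin l p M b + int n * M j"
  using lin_low[OF assms, of n "b(j := b j + n)" p M] by simp

text \<open>All exponents are integers: in the application they are the values of the invariant form
  multiplied by N, and t is the N-th root of v or its inverse. The index b stands for the element
  of Q_+ with coefficients b i, and W b for the weight space of weight lam - b.\<close>
locale hw_module = vector_space scale
  for scale :: "'k::field \<Rightarrow> 'v::ab_group_add \<Rightarrow> 'v" (infixr "*s" 75) +
  fixes l :: nat and t :: 'k and Bm :: "nat \<Rightarrow> nat \<Rightarrow> int" and dm :: "nat \<Rightarrow> int" and lm :: "nat \<Rightarrow> int"
    and E F :: "nat \<Rightarrow> 'v \<Rightarrow> 'v" and W :: "(nat \<Rightarrow> nat) \<Rightarrow> 'v set" and hwv :: 'v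
  assumes t_nonzero: "t \<noteq> 0"
    and t_root: "t powi n = 1 \<Longrightarrow> n = 0"
    and B_sym: "i < l \<Longrightarrow> j < l \<Longrightarrow> Bm i j = Bm j i"
    and B_diag: "i < l \<Longrightarrow> Bm i i = 2 * dm i"
    and d_pos: "i < l \<Longrightarrow> dm i > 0"
    and E_add: "E i (x + y) = E i x + E i y" and E_scale: "E i (c *s x) = c *s E i x"
    and F_add: "F i (x + y) = F i x + F i y" and F_scale: "F i (c *s x) = c *s F i x"
    and W_subspace: "subspace (W b)"
    and E_W0: "i < l \<Longrightarrow> x \<in> W b \<Longrightarrow> b i = 0 \<Longrightarrow> E i x = 0"
    and F_W: "i < l \<Longrightarrow> x \<in> W b \<Longrightarrow> F i x \<in> W (b(i := b i + 1))"
    and EF_neq: "i < l \<Longrightarrow> j < l \<Longrightarrow> i \<noteq> j \<Longrightarrow> x \<in> W b \<Longrightarrow> E i (F j x) = F j (E i x)"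
    and EF_eq: "i < l \<Longrightarrow> x \<in> W b \<Longrightarrow> E i (F i x) = F i (E i x) +
       ((t powi (lm i - lin l 0 (Bm i) b) - t powi (- (lm i - lin l 0 (Bm i) b))) /
        (t powi dm i - t powi (- dm i))) *s x"
    and hwv_W: "(\<And>r. r < l \<Longrightarrow> b r = 0) \<Longrightarrow> hwv \<in> W b"
    and singular_zero: "x \<in> W b \<Longrightarrow> i < l \<Longrightarrow> b i > 0 \<Longrightarrow> (\<And>j. j < l \<Longrightarrow> E j x = 0) \<Longrightarrow> x = 0"
begin

section \<open>Quantum brackets and the commutators of E_i with powers of F_j\<close>

definition bra :: "nat \<Rightarrow> int \<Rightarrow> 'k" where
  "bra i y = (t powi y - t powi (- y)) / (t powi dm i - t powi (- dm i))"

lemma powadd: "t powi x * t powi y = t powi (x + y)"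
  using t_nonzero by (simp add: power_int_add)

lemma powi_eq_inverse: "t powi n = t powi (- n) \<Longrightarrow> n = 0"
proof -
  assume a: "t powi n = t powi (- n)"
  have "t powi (n + n) = 1"
    unfolding power_int_add[OF disjI1[OF t_nonzero]] using a t_nonzero
    by (metis power_int_minus power_int_not_zero right_inverse)
  then show "n = 0" using t_root by fastforce
qed

lemma qden_nonzero: "i < l \<Longrightarrow> n > 0 \<Longrightarrow> t powi (dm i * int n) - t powi (- (dm i * int n)) \<noteq> 0"
  using powi_eq_inverse[of "dm i * int n"] d_pos[of i] by auto

lemma qden_nonzero1: "i < l \<Longrightarrow> t powi dm i - t powi (- dm i) \<noteq> 0"
  using qden_nonzero[of i 1] by simp

lemma bra_self: "i < l \<Longrightarrow> bra i (dm i) = 1"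
  using qden_nonzero1 by (simp add: bra_def)

text \<open>The induction step behind \<open>E_Fp_eq\<close>: the bracket created by one further F_i
  merges with the product of brackets already there. After clearing denominators it is an identity
  of Laurent polynomials in three powers of t.\<close>

lemma bra_rec:
  assumes "i < l"
  shows "bra i a * bra i z + bra i (z - a - dm i) = bra i (a + dm i) * bra i (z - dm i)"
proof -
  define A Z D q where "A = t powi a" and "Z = t powi z" and "D = t powi dm i"
    and "q = t powi dm i - t powi (- dm i)"
  have nz: "A \<noteq> 0" "Z \<noteq> 0" "D \<noteq> 0" using t_nonzero by (auto simp: A_def Z_def D_def)
  have q: "q \<noteq> 0" using qden_nonzero1[OF assms] by (simp add: q_def)
  have e: "t powi (z - a - dm i) = Z / (A * D)" "t powi (- (z - a - dm i)) = A * D / Z"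
    "t powi (a + dm i) = A * D" "t powi (- (a + dm i)) = 1 / (A * D)"
    "t powi (z - dm i) = Z / D" "t powi (- (z - dm i)) = D / Z" "t powi (- a) = 1 / A" "t powi (- z) = 1 / Z"
    using t_nonzero by (auto simp: A_def Z_def D_def power_int_add power_int_diff power_int_minus field_simps)
  have "(A - 1/A) * (Z - 1/Z) + (Z / (A * D) - A * D / Z) * (D - 1/D) = (A * D - 1 / (A * D)) * (Z / D - D / Z)"
    using nz by (simp add: field_simps)
  moreover have "q = D - 1 / D" by (simp add: q_def D_def power_int_minus field_simps)
  ultimately have "(A - 1/A) * (Z - 1/Z) + (Z / (A * D) - A * D / Z) * q = (A * D - 1 / (A * D)) * (Z / D - D / Z)"
    by simp
  then have "((A - 1/A) * (Z - 1/Z) + (Z / (A * D) - A * D / Z) * q) / (q * q) = (A * D - 1 / (A * D)) * (Z / D - D / Z) / (q * q)"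
    by simp
  then show ?thesis
    unfolding bra_def e q_def[symmetric] A_def[symmetric] Z_def[symmetric] using q
    by (simp add: add_divide_distrib)
qed

lemma W_zero [simp]: "0 \<in> W b" and W_scale: "x \<in> W b \<Longrightarrow> c *s x \<in> W b" and W_sum: "(\<And>a. a \<in> S \<Longrightarrow> f a \<in> W b) \<Longrightarrow> sum f S \<in> W b"
  and W_diff: "x \<in> W b \<Longrightarrow> y \<in> W b \<Longrightarrow> x - y \<in> W b"
  using W_subspace[of b] by (auto simp: subspace_0 subspace_add subspace_scale subspace_sum subspace_diff)

lemma E_zero [simp]: "E i 0 = 0" and F_zero [simp]: "F i 0 = 0"
  using E_scale[of i 0 0] F_scale[of i 0 0] by auto

lemma E_sum: "E i (sum f S) = (\<Sum>a\<in>S. E i (f a))"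
  by (induction S rule: infinite_finite_induct) (auto simp: E_add)

lemma E_diff: "E i (x - y) = E i x - E i y"
  using E_add[of i "x - y" y] by simp

lemma Fp_scale: "(F i ^^ n) (c *s x) = c *s (F i ^^ n) x"
  by (induction n) (auto simp: F_scale)

lemma Fp_add: "(F i ^^ n) (x + y) = (F i ^^ n) x + (F i ^^ n) y"
  by (induction n) (auto simp: F_add)

lemma Fp_zero [simp]: "(F i ^^ n) 0 = 0"
  by (induction n) auto

lemma Fp_diff: "(F i ^^ n) (x - y) = (F i ^^ n) x - (F i ^^ n) y"
  using Fp_add[of n i "x - y" y] by (simp add: eq_diff_eq)

lemma Fp_W: "i < l \<Longrightarrow> x \<in> W b \<Longrightarrow> (F i ^^ n) x \<in> W (b(i := b i + n))"
proof (induction n)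
  case (Suc n)
  have "b(i := b i + n, i := (b(i := b i + n)) i + 1) = b(i := b i + Suc n)" by simp
  then show ?case using F_W[OF Suc.prems(1) Suc.IH[OF Suc.prems]] by (simp only: funpow.simps o_apply)
qed simp

lemma Fp_W_low: "i < l \<Longrightarrow> n \<le> b i \<Longrightarrow> x \<in> W (b(i := b i - n)) \<Longrightarrow> (F i ^^ n) x \<in> W b"
  using Fp_W[of i x "b(i := b i - n)" n] by simp

lemma E_Fp_neq:
  assumes "i < l" "j < l" "i \<noteq> j" "x \<in> W b"
  shows "E i ((F j ^^ n) x) = (F j ^^ n) (E i x)"
proof (induction n)
  case (Suc n)
  show ?case using EF_neq[OF assms(1-3) Fp_W[OF assms(2,4), of n]] Suc by simp
qed simp

text \<open>The rank one computation. The second bracket depends on the weight of x and vanishes if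
  that weight pairs with alpha_i to n d_i, which is how singular vectors arise in
  \<open>lam_antidominant\<close>.\<close>

lemma E_Fp_eq:
  assumes "i < l" "x \<in> W b"
  shows "E i ((F i ^^ Suc n) x) = (F i ^^ Suc n) (E i x) +
    (bra i (dm i * int (Suc n)) * bra i (lm i - lin l 0 (Bm i) b - int n * dm i)) *s (F i ^^ n) x"
proof (induction n)
  case 0
  show ?case using EF_eq[OF assms] bra_self[OF assms(1)] by (simp add: bra_def)
next
  case (Suc n)
  let ?k = "lm i - lin l 0 (Bm i) b"
  let ?c = "bra i (dm i * int (Suc n)) * bra i (?k - int n * dm i)"
  \<comment> \<open>The weight has dropped by (n+1) alpha_i, hence its exponent by 2(n+1)d_i; it is
    split so as to have the shape \<open>z - a - dm i\<close> of \<open>bra_rec\<close>.\<close>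
  have w: "lm i - lin l 0 (Bm i) (b(i := b i + Suc n)) = ?k - int n * dm i - dm i * int (Suc n) - dm i"
    using lin_Suc[OF assms(1), of 0 "Bm i" b "Suc n"] B_diag[OF assms(1)] by (simp add: algebra_simps)
  have "E i ((F i ^^ Suc (Suc n)) x) = F i (E i ((F i ^^ Suc n) x)) +
      bra i (?k - int n * dm i - dm i * int (Suc n) - dm i) *s (F i ^^ Suc n) x"
    using EF_eq[OF assms(1) Fp_W[OF assms, of "Suc n"]] unfolding w bra_def[symmetric] by simp
  also have "\<dots> = (F i ^^ Suc (Suc n)) (E i x) + (?c + bra i (?k - int n * dm i - dm i * int (Suc n) - dm i)) *s (F i ^^ Suc n) x"
    unfolding Suc by (simp add: F_add F_scale scale_left_distrib)
  also have "?c + bra i (?k - int n * dm i - dm i * int (Suc n) - dm i) =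
      bra i (dm i * int (Suc (Suc n))) * bra i (?k - int (Suc n) * dm i)"
    using bra_rec[OF assms(1), of "dm i * int (Suc n)" "?k - int n * dm i"] by (simp add: algebra_simps)
  finally show ?case .
qed

section \<open>Twisted q-exponentials and their effect on Whittaker conditions\<close>

primrec kco :: "nat \<Rightarrow> 'k \<Rightarrow> int \<Rightarrow> int \<Rightarrow> nat \<Rightarrow> 'k" where
  "kco j a p m 0 = 1"
| "kco j a p m (Suc n) = kco j a p m n * a * (t powi dm j - t powi (- dm j))^2 *
     t powi (p + lm j + (int n + 2) * dm j - int n * m) /
     (t powi (dm j * int (Suc n)) - t powi (- (dm j * int (Suc n))))"

abbreviation step_coeff :: "nat \<Rightarrow> 'k \<Rightarrow> int \<Rightarrow> (nat \<Rightarrow> int) \<Rightarrow> (nat \<Rightarrow> nat) \<Rightarrow> nat \<Rightarrow> 'k" where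
  "step_coeff j a p M b n \<equiv> kco j a p (M j) n * t powi (int n * lin l 0 (\<lambda>r. M r - Bm j r) b)"

text \<open>A q-exponential in F_j, twisted by Cartan elements: for \<open>M r\<close> = (nu_j,
  alpha_r), the power of t in front of F_j^n is the action of the n-th power of K_mu, mu = alpha_j -
  nu_j, on the component of index b, up to a factor independent of b.\<close>

definition step :: "nat \<Rightarrow> 'k \<Rightarrow> int \<Rightarrow> (nat \<Rightarrow> int) \<Rightarrow> ((nat \<Rightarrow> nat) \<Rightarrow> 'v) \<Rightarrow> (nat \<Rightarrow> nat) \<Rightarrow> 'v" where
  "step j a p M xi b = (\<Sum>n\<le>b j. (step_coeff j a p M b n) *s
     (F j ^^ n) (xi (b(j := b j - n))))"

text \<open>The failure of a Whittaker condition in which the Cartan factor has become a power of t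
  with exponent affine in b. Subtraction is truncated, so without the case distinction
  \<open>b(i := b i - 1)\<close> would be b itself when b i = 0.\<close>

definition defect :: "nat \<Rightarrow> 'k \<Rightarrow> int \<Rightarrow> (nat \<Rightarrow> int) \<Rightarrow> ((nat \<Rightarrow> nat) \<Rightarrow> 'v) \<Rightarrow> (nat \<Rightarrow> nat) \<Rightarrow> 'v" where
  "defect i a p M xi b = E i (xi b) - (if b i = 0 then 0 else (a * t powi (lin l p M b)) *s xi (b(i := b i - 1)))"

lemma step_W: "j < l \<Longrightarrow> (\<And>b. xi b \<in> W b) \<Longrightarrow> step j a p M xi b \<in> W b"
  unfolding step_def by (intro W_sum W_scale Fp_W_low) auto

text \<open>E_i commutes with F_j, so only powers of t have to match. Lowering b at i divides the
  factor of F_j^n by t^(n (M i - B_ji)); lowering the argument of xi by n at j divides the twist of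
  condition i by t^(n M' j). The hypothesis \<open>c\<close> equates the two.\<close>

lemma defect_step_neq:
  assumes ij: "i < l" "j < l" "i \<noteq> j" and xi: "\<And>b. xi b \<in> W b" and c: "M' j = M i - Bm j i"
  shows "defect i a' p' M' (step j a p M xi) b =
    (\<Sum>n\<le>b j. (step_coeff j a p M b n) *s
     (F j ^^ n) (defect i a' p' M' xi (b(j := b j - n))))"
proof -
  define Lf where "Lf = lin l 0 (\<lambda>r. M r - Bm j r)"
  define K where "K n = kco j a p (M j) n" for n
  have E: "E i (step j a p M xi b) = (\<Sum>n\<le>b j. (K n * t powi (int n * Lf b)) *s (F j ^^ n) (E i (xi (b(j := b j - n)))))"
    unfolding step_def E_sum K_def Lf_def
    by (intro sum.cong refl) (simp add: E_scale E_Fp_neq[OF ij xi])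
  show ?thesis
  proof (cases "b i = 0")
    case True
    then show ?thesis using ij(3) unfolding defect_def E by (simp add: K_def Lf_def)
  next
    case False
    define b' where "b' = b(i := b i - 1)"
    have Lb': "Lf b' = Lf b - M' j"
      using lin_low[OF ij(1), of 1 b 0 "\<lambda>r. M r - Bm j r"] False c by (simp add: Lf_def b'_def)
    have "(a' * t powi lin l p' M' b) *s step j a p M xi b' =
      (\<Sum>n\<le>b j. (K n * t powi (int n * Lf b)) *s (F j ^^ n) ((a' * t powi (lin l p' M' (b(j := b j - n)))) *s xi ((b(j := b j - n))(i := b i - 1))))"
      unfolding step_def scale_sum_right
    proof (intro sum.cong)
      show "{..b' j} = {..b j}" using ij(3) by (simp add: b'_def)
    next
      fix n assume n: "n \<in> {..b j}"
      have e1: "b'(j := b' j - n) = (b(j := b j - n))(i := b i - 1)"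
        using ij(3) by (auto simp: b'_def fun_upd_twist)
      have e2: "lin l p' M' (b(j := b j - n)) = lin l p' M' b - int n * M' j"
        using lin_low[OF ij(2), of n b p' M'] n by simp
      have e3: "t powi (int n * Lf b) * t powi (lin l p' M' (b(j := b j - n))) = t powi (lin l p' M' b) * t powi (int n * Lf b')"
        unfolding e2 Lb' power_int_add[symmetric, OF disjI1[OF t_nonzero]] by (simp add: algebra_simps)
      have e4: "K n * t powi (int n * Lf b) * (a' * t powi (lin l p' M' (b(j := b j - n)))) = 
          (a' * t powi lin l p' M' b) * (K n * t powi (int n * Lf b'))"
        using e3 by (simp add: algebra_simps)
      show "(a' * t powi lin l p' M' b) *s (kco j a p (M j) n * t powi (int n * lin l 0 (\<lambda>r. M r - Bm j r) b')) *s
           (F j ^^ n) (xi (b'(j := b' j - n))) =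
         (K n * t powi (int n * Lf b)) *s (F j ^^ n) ((a' * t powi (lin l p' M' (b(j := b j - n)))) *s xi ((b(j := b j - n))(i := b i - 1)))"
        unfolding Fp_scale scale_scale e1 Lf_def[symmetric] K_def[symmetric] e4 ..
    qed
    then show ?thesis using False ij(3) unfolding defect_def E b'_def
      by (simp add: sum_subtractf[symmetric] Fp_diff scale_right_diff_distrib K_def Lf_def)
  qed
qed

lemma kco_rec:
  assumes "j < l"
  shows "kco j a p m (Suc n) * bra j (dm j * int (Suc n)) =
    kco j a p m n * a * (t powi dm j - t powi (- dm j)) * t powi (p + lm j + (int n + 2) * dm j - int n * m)"
proof -
  have "kco j a p m (Suc n) * bra j (dm j * int (Suc n)) = 
    kco j a p m n * a * (t powi dm j - t powi (- dm j))^2 * t powi (p + lm j + (int n + 2) * dm j - int n * m) /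
     (t powi dm j - t powi (- dm j))"
    using qden_nonzero[OF assms, of "Suc n"] unfolding bra_def kco.simps
    by (simp del: of_nat_Suc)
  then show ?thesis using qden_nonzero1[OF assms] by (simp add: power2_eq_square)
qed

text \<open>Commuting E_j past F_j^n leaves terms with F_j^(n-1). After an index shift they have to
  make up the difference between the new and the old twist; comparing coefficients yields both the
  recursion defining \<open>kco\<close> and the change 2(lam - b, alpha_j) + 4 d_j of the
  exponent.\<close>

lemma defect_step_eq:
  assumes j: "j < l" and xi: "\<And>b. xi b \<in> W b" and M': "\<And>r. M' r = M r - 2 * Bm j r"
    and p': "p' = p + 2 * lm j + 4 * dm j"
  shows "defect j a p' M' (step j a p M xi) b =
    (\<Sum>n\<le>b j. (step_coeff j a p M b n) *s
     (F j ^^ n) (defect j a p M xi (b(j := b j - n))))"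
proof -
  define Lf where "Lf = lin l 0 (\<lambda>r. M r - Bm j r)"
  define K where "K n = kco j a p (M j) n" for n
  define d where "d = dm j"
  define lb where "lb = lin l p M b"
  define z where "z = lm j - lin l 0 (Bm j) b"
  define G where "G n = (K (Suc n) * t powi (int (Suc n) * Lf b) * (bra j (d * int (Suc n)) * bra j (z + (int n + 2) * d))) *s (F j ^^ n) (xi (b(j := b j - Suc n)))" for n
  have E0: "E j ((F j ^^ n) (xi (b(j := b j - n)))) = (F j ^^ n) (E j (xi (b(j := b j - n)))) +
      (if n = 0 then 0 else (bra j (d * int n) * bra j (z + (int n + 1) * d)) *s (F j ^^ (n - 1)) (xi (b(j := b j - n))))"
    if "n \<le> b j" for n
  proof (cases n)
    case (Suc m)
    have "lm j - lin l 0 (Bm j) (b(j := b j - n)) - int m * dm j = z + (int n + 1) * d"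
      using lin_low[of j l n b 0 "Bm j"] that j B_diag[OF j] Suc by (simp add: z_def d_def algebra_simps)
    then show ?thesis using E_Fp_eq[OF j xi, of m "b(j := b j - n)"] Suc by (simp add: d_def)
  qed simp
  have "E j (step j a p M xi b) = (\<Sum>n\<le>b j. (K n * t powi (int n * Lf b)) *s (F j ^^ n) (E j (xi (b(j := b j - n)))))
     + (\<Sum>n\<le>b j. if n = 0 then 0 else G (n - 1))"
    unfolding step_def E_sum sum.distrib[symmetric]
    by (intro sum.cong refl) (auto simp: E_scale E0 scale_right_distrib K_def Lf_def G_def add.commute)
  also have "(\<Sum>n\<le>b j. if n = 0 then 0 else G (n - 1)) = (\<Sum>n<b j. G n)"
  proof -
    have "(\<Sum>n\<le>b j. if n = 0 then 0 else G (n - 1)) = (\<Sum>n<Suc (b j). if n = 0 then 0 else G (n - 1))"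
      by (simp add: lessThan_Suc_atMost)
    also have "\<dots> = (\<Sum>n<b j. G n)" by (subst sum.lessThan_Suc_shift) simp
    finally show ?thesis .
  qed
  finally have E: "E j (step j a p M xi b) = (\<Sum>n\<le>b j. (K n * t powi (int n * Lf b)) *s (F j ^^ n) (E j (xi (b(j := b j - n)))))
     + (\<Sum>n<b j. G n)" .
  show ?thesis
  proof (cases "b j = 0")
    case True
    then show ?thesis unfolding defect_def E by (simp add: K_def Lf_def)
  next
    case False
    define b' where "b' = b(j := b j - 1)"
    have lp': "lin l p' M' b = lb + 2 * z + 4 * d"
      by (simp add: lin_def M' p' lb_def z_def d_def algebra_simps sum_subtractf sum_distrib_left)
    have Lb': "Lf b' = Lf b - M j + 2 * d"
      using lin_low[OF j, of 1 b 0 "\<lambda>r. M r - Bm j r"] False B_diag[OF j] by (simp add: Lf_def b'_def d_def)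
    have pb: "p + lm j = lb - Lf b + z"
      by (simp add: lb_def Lf_def z_def lin_def algebra_simps sum_subtractf)
    \<comment> \<open>The comparison of coefficients at F_j^n: the new twist on the left, the old
      twist and the commutator on the right. With X the exponent of the old term and 2y its
      increase, it is the identity t^(X+y) (t^y - t^(-y)) = t^(X+2y) - t^X.\<close>
    have key: "a * t powi (lin l p' M' b) * (K n * t powi (int n * Lf b')) =
        K n * t powi (int n * Lf b) * (a * t powi (lb - int n * M j)) +
        K (Suc n) * t powi (int (Suc n) * Lf b) * (bra j (d * int (Suc n)) * bra j (z + (int n + 2) * d))" for n
    proof -
      define y where "y = z + (int n + 2) * d"
      define X where "X = int n * Lf b + lb - int n * M j"
      have "K (Suc n) * t powi (int (Suc n) * Lf b) * (bra j (d * int (Suc n)) * bra j y)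
          = (K (Suc n) * bra j (d * int (Suc n))) * t powi (int (Suc n) * Lf b) * bra j y" by simp
      also have "\<dots> = K n * a * (t powi d - t powi (- d)) * t powi (p + lm j + (int n + 2) * d - int n * M j) * t powi (int (Suc n) * Lf b) * bra j y"
        unfolding K_def d_def kco_rec[OF j] ..
      also have "\<dots> = K n * a * (t powi (p + lm j + (int n + 2) * d - int n * M j) * t powi (int (Suc n) * Lf b)) * (t powi y - t powi (- y))"
        using qden_nonzero1[OF j] by (simp add: bra_def d_def)
      also have "t powi (p + lm j + (int n + 2) * d - int n * M j) * t powi (int (Suc n) * Lf b) = t powi (X + y)"
        unfolding powadd pb X_def y_def by (simp add: algebra_simps)
      also have "K n * a * t powi (X + y) * (t powi y - t powi (- y)) = K n * a * (t powi (X + 2 * y) - t powi X)"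
      proof -
        have "t powi (X + y) * (t powi y - t powi (- y)) = t powi (X + 2 * y) - t powi X"
          unfolding right_diff_distrib powadd by (simp add: algebra_simps)
        then show ?thesis by (simp only: mult.assoc)
      qed
      finally have 1: "K (Suc n) * t powi (int (Suc n) * Lf b) * (bra j (d * int (Suc n)) * bra j y) = K n * a * (t powi (X + 2 * y) - t powi X)" .
      have 2: "a * t powi (lin l p' M' b) * (K n * t powi (int n * Lf b')) = K n * a * t powi (X + 2 * y)"
      proof -
        have "t powi (lin l p' M' b) * t powi (int n * Lf b') = t powi (X + 2 * y)"
          unfolding powadd lp' Lb' X_def y_def by (simp add: algebra_simps)
        then show ?thesis by (simp only: mult.assoc mult.left_commute[of _ "K n"])
      qed
      have 3: "K n * t powi (int n * Lf b) * (a * t powi (lb - int n * M j)) = K n * a * t powi X"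
      proof -
        have "t powi (int n * Lf b) * t powi (lb - int n * M j) = t powi X"
          unfolding powadd X_def by (simp add: algebra_simps)
        then show ?thesis by (simp only: mult.assoc mult.left_commute[of _ a])
      qed
      show ?thesis unfolding y_def[symmetric] 1 2 3 by (simp add: right_diff_distrib)
    qed
    have bj: "{..b' j} = {..<b j}" using False by (auto simp: b'_def)
    have bn: "b'(j := b' j - n) = b(j := b j - Suc n)" for n by (simp add: b'_def)
    have "(a * t powi lin l p' M' b) *s step j a p M xi b' =
       (\<Sum>n<b j. (a * t powi (lin l p' M' b) * (K n * t powi (int n * Lf b'))) *s (F j ^^ n) (xi (b(j := b j - Suc n))))"
      unfolding step_def scale_sum_right bj bn Lf_def[symmetric] K_def[symmetric] scale_scale ..
    also have "\<dots> = (\<Sum>n<b j. (K n * t powi (int n * Lf b) * (a * t powi (lb - int n * M j))) *s (F j ^^ n) (xi (b(j := b j - Suc n)))) + (\<Sum>n<b j. G n)"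
      unfolding key G_def scale_left_distrib sum.distrib ..
    \<comment> \<open>At n = b j the index of xi has reached 0 at j, where the defect has no second
      summand; the range can therefore be extended by this term.\<close>
    also have "(\<Sum>n<b j. (K n * t powi (int n * Lf b) * (a * t powi (lb - int n * M j))) *s (F j ^^ n) (xi (b(j := b j - Suc n))))
       = (\<Sum>n\<le>b j. (K n * t powi (int n * Lf b)) *s (F j ^^ n) (if n = b j then 0 else (a * t powi lin l p M (b(j := b j - n))) *s xi (b(j := b j - Suc n))))"
    proof -
      have "(\<Sum>n\<le>b j. (K n * t powi (int n * Lf b)) *s (F j ^^ n) (if n = b j then 0 else (a * t powi lin l p M (b(j := b j - n))) *s xi (b(j := b j - Suc n))))
         = (\<Sum>n<b j. (K n * t powi (int n * Lf b)) *s (F j ^^ n) (if n = b j then 0 else (a * t powi lin l p M (b(j := b j - n))) *s xi (b(j := b j - Suc n))))"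
        unfolding lessThan_Suc_atMost[symmetric] sum.lessThan_Suc by simp
      also have "\<dots> = (\<Sum>n<b j. (K n * t powi (int n * Lf b) * (a * t powi (lb - int n * M j))) *s (F j ^^ n) (xi (b(j := b j - Suc n))))"
        by (intro sum.cong refl) (simp add: Fp_scale lin_low[OF j] lb_def)
      finally show ?thesis ..
    qed
    finally have S: "(a * t powi lin l p' M' b) *s step j a p M xi b' =
      (\<Sum>n\<le>b j. (K n * t powi (int n * Lf b)) *s (F j ^^ n) (if n = b j then 0 else (a * t powi lin l p M (b(j := b j - n))) *s xi (b(j := b j - Suc n)))) + (\<Sum>n<b j. G n)" .
    have "defect j a p' M' (step j a p M xi) b = E j (step j a p M xi b) - (a * t powi lin l p' M' b) *s step j a p M xi b'"
      using False by (simp add: defect_def b'_def)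
    also have "\<dots> = (\<Sum>n\<le>b j. (K n * t powi (int n * Lf b)) *s (F j ^^ n) (defect j a p M xi (b(j := b j - n))))"
      unfolding E S add_diff_cancel_right sum_subtractf[symmetric] scale_right_diff_distrib[symmetric] Fp_diff[symmetric]
      by (intro sum.cong refl) (auto simp: defect_def)
    finally show ?thesis by (simp add: K_def Lf_def)
  qed
qed

end

section \<open>Whittaker vectors\<close>

text \<open>The list is read from its end: an index is prepended once every adjacent index already present
  has an arrow to it, and none of the adjacent indices still missing does.\<close>
primrec arrow_sorted :: "nat \<Rightarrow> (nat \<Rightarrow> nat \<Rightarrow> int) \<Rightarrow> (nat \<Rightarrow> nat \<Rightarrow> int) \<Rightarrow> nat list \<Rightarrow> bool" where
  "arrow_sorted l Bm nm [] = True"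
| "arrow_sorted l Bm nm (j # rs) \<longleftrightarrow> arrow_sorted l Bm nm rs \<and> j < l \<and> j \<notin> set rs \<and>
     (\<forall>i<l. i \<noteq> j \<longrightarrow> nm j i - Bm j i = nm i j - (if i \<in> set rs then 2 * Bm i j else 0))"

lemma arrow_sorted_distinct: "arrow_sorted l Bm nm rs \<Longrightarrow> distinct rs"
  by (induction rs) auto

definition height :: "nat \<Rightarrow> (nat \<Rightarrow> nat) \<Rightarrow> nat" where
  "height l b = (\<Sum>r<l. b r)"

lemma height_low:
  assumes "j < l" "n \<le> b j"
  shows "height l (b(j := b j - n)) + n = height l b"
proof -
  have 1: "(\<Sum>r\<in>{..<l} - {j}. (b(j := b j - n)) r) = (\<Sum>r\<in>{..<l} - {j}. b r)"
    by (rule sum.cong) auto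
  show ?thesis
    using assms sum.remove[of "{..<l}" j b] sum.remove[of "{..<l}" j "b(j := b j - n)"] 1 by (simp add: height_def)
qed

lemma height_eq_0: "height l b = 0 \<longleftrightarrow> (\<forall>r<l. b r = 0)"
  by (auto simp: height_def)

lemma finite_below: "finite {c :: nat \<Rightarrow> nat. c \<le> b \<and> (\<forall>i. i \<notin> set rs \<longrightarrow> c i = b i)}"
proof (induction rs)
  case Nil
  have "{c. c \<le> b \<and> (\<forall>i. i \<notin> set [] \<longrightarrow> c i = b i)} = {b}" by auto
  then show ?case by simp
next
  case (Cons j rs)
  let ?S = "\<lambda>rs. {c. c \<le> b \<and> (\<forall>i. i \<notin> set rs \<longrightarrow> c i = b i)}"
  have "?S (j # rs) \<subseteq> (\<Union>n\<le>b j. (\<lambda>c. c(j := n)) ` ?S rs)"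
  proof
    fix c assume c: "c \<in> ?S (j # rs)"
    have "c j \<le> b j" using c by (auto simp: le_fun_def)
    moreover have "c(j := b j) \<in> ?S rs" using c by (auto simp: le_fun_def)
    moreover have "c = (c(j := b j))(j := c j)" by simp
    ultimately show "c \<in> (\<Union>n\<le>b j. (\<lambda>c. c(j := n)) ` ?S rs)" by blast
  qed
  then show ?case using Cons by (auto intro: finite_subset)
qed

text \<open>In the application \<open>nm i r\<close> is (nu_i, alpha_r), \<open>nl i\<close> is
  (nu_i, lam) and \<open>a i\<close> is c_i/(1 - v_i^2), all pairings multiplied by N.
  \<open>fe\<close> is the potential 2(lam+rho, beta) - (beta, beta), and \<open>fe_low\<close> says
  that its increment in direction alpha_i is the change of exponent in
  \<open>defect_step_eq\<close>.\<close>

locale whittaker_module = hw_module scale l t Bm dm lm E F W hwv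
  for scale :: "'k::field \<Rightarrow> 'v::ab_group_add \<Rightarrow> 'v" (infixr "*s" 75)
    and l t Bm dm lm E F W hwv +
  fixes nm :: "nat \<Rightarrow> nat \<Rightarrow> int" and nl :: "nat \<Rightarrow> int" and a :: "nat \<Rightarrow> 'k" and rs0 :: "nat list"
    and fe :: "(nat \<Rightarrow> nat) \<Rightarrow> int"
  assumes sorted: "arrow_sorted l Bm nm rs0" and set_rs0: "set rs0 = {..<l}"
    and fe_low: "i < l \<Longrightarrow> b i > 0 \<Longrightarrow> fe b = fe (b(i := b i - 1)) + 2 * (lm i - lin l 0 (Bm i) b) + 4 * dm i"
    and fe_0: "height l b = 0 \<Longrightarrow> fe b = 0"
    and fe_nonzero: "height l b > 0 \<Longrightarrow> fe b \<noteq> 0"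
begin

text \<open>The set S collects the steps already carried out: condition i has the exponent of
  \<open>defect_step_eq\<close> once i belongs to S, and its original one before.\<close>

definition dft :: "nat set \<Rightarrow> nat \<Rightarrow> ((nat \<Rightarrow> nat) \<Rightarrow> 'v) \<Rightarrow> (nat \<Rightarrow> nat) \<Rightarrow> 'v" where
  "dft S i = defect i (a i) (- nl i + (if i \<in> S then 2 * lm i + 4 * dm i else 0))
      (\<lambda>r. nm i r - (if i \<in> S then 2 * Bm i r else 0))"

primrec chain :: "nat list \<Rightarrow> ((nat \<Rightarrow> nat) \<Rightarrow> 'v) \<Rightarrow> (nat \<Rightarrow> nat) \<Rightarrow> 'v" where
  "chain [] xi = xi"
| "chain (j # rs) xi = step j (a j) (- nl j) (nm j) (chain rs xi)"

lemma chain_W: "arrow_sorted l Bm nm rs \<Longrightarrow> (\<And>b. xi b \<in> W b) \<Longrightarrow> chain rs xi b \<in> W b"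
  by (induction rs arbitrary: b) (auto intro!: step_W)

lemma chain_height_0: "arrow_sorted l Bm nm rs \<Longrightarrow> height l b = 0 \<Longrightarrow> chain rs xi b = xi b"
proof (induction rs)
  case (Cons j rs)
  then have "b j = 0" by (simp add: height_eq_0)
  moreover from this have "b(j := 0) = b" by (simp add: fun_upd_idem)
  ultimately show ?case using Cons by (simp add: step_def del: fun_upd_apply)
qed simp

text \<open>The equation in \<open>arrow_sorted\<close> is the hypothesis of
  \<open>defect_step_neq\<close> for every i other than j; its case distinction records whether the
  twist of condition i has already been changed.\<close>

lemma dft_step:
  assumes "arrow_sorted l Bm nm (j # rs)" "\<And>b. xi b \<in> W b" "i < l"
  shows "dft (set (j # rs)) i (step j (a j) (- nl j) (nm j) xi) b =
    (\<Sum>n\<le>b j. (step_coeff j (a j) (- nl j) (nm j) b n) *s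
     (F j ^^ n) (dft (set rs) i xi (b(j := b j - n))))"
proof (cases "i = j")
  case True
  have "defect j (a j) (- nl j + (2 * lm j + 4 * dm j)) (\<lambda>r. nm j r - 2 * Bm j r) (step j (a j) (- nl j) (nm j) xi) b =
    (\<Sum>n\<le>b j. (step_coeff j (a j) (- nl j) (nm j) b n) *s
     (F j ^^ n) (defect j (a j) (- nl j) (nm j) xi (b(j := b j - n))))"
    by (rule defect_step_eq) (use assms in auto)
  then show ?thesis using True assms(1) by (simp add: dft_def)
next
  case False
  have S: "(i \<in> set (j # rs)) = (i \<in> set rs)" using False by simp
  show ?thesis unfolding dft_def S
    by (rule defect_step_neq) (use assms False in auto)
qed

text \<open>Each F_j leads back to a component of smaller height, where the defects vanish by
  assumption, so only the n = 0 terms of all steps survive. Nothing is assumed at b itself, because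
  the construction of the Whittaker vector applies this where the condition does not yet
  hold.\<close>

lemma chain_dft:
  assumes "arrow_sorted l Bm nm rs" "\<And>b. xi b \<in> W b" "i < l"
    and "\<And>c. height l c < height l b \<Longrightarrow> dft {} i xi c = 0"
  shows "dft (set rs) i (chain rs xi) b = dft {} i xi b"
  using assms(1,4)
proof (induction rs arbitrary: b)
  case (Cons j rs)
  have j: "j < l" and rs: "arrow_sorted l Bm nm rs" using Cons.prems(1) by auto
  let ?k = "\<lambda>n. step_coeff j (a j) (- nl j) (nm j) b n"
  have "dft (set (j # rs)) i (chain (j # rs) xi) b =
    (\<Sum>n\<le>b j. ?k n *s (F j ^^ n) (dft (set rs) i (chain rs xi) (b(j := b j - n))))"
    unfolding chain.simps by (rule dft_step[OF Cons.prems(1) chain_W[OF rs assms(2)] assms(3)])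
  also have "\<dots> = (\<Sum>n\<le>b j. if n = 0 then dft {} i xi b else 0)"
  proof (intro sum.cong refl)
    fix n assume n: "n \<in> {..b j}"
    have h: "height l (b(j := b j - n)) + n = height l b" using height_low[of j l n b] j n by simp
    have e: "dft (set rs) i (chain rs xi) (b(j := b j - n)) = dft {} i xi (b(j := b j - n))"
      by (rule Cons.IH[OF rs]) (use h Cons.prems(2) in \<open>simp del: fun_upd_apply\<close>)
    show "?k n *s (F j ^^ n) (dft (set rs) i (chain rs xi) (b(j := b j - n))) = (if n = 0 then dft {} i xi b else 0)"
    proof (cases "n = 0")
      case False
      then have "height l (b(j := b j - n)) < height l b" using h by linarith
      then have "dft {} i xi (b(j := b j - n)) = 0" by (rule Cons.prems(2))
      then show ?thesis using False e by simp
    qed (use e in simp)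
  qed
  also have "\<dots> = dft {} i xi b" by simp
  finally show ?case .
qed simp

section \<open>The scalar action of the composite and the existence of Whittaker vectors\<close>

definition llin :: "nat \<Rightarrow> (nat \<Rightarrow> nat) \<Rightarrow> int" where
  "llin i b = lin l (- nl i) (nm i) b"

lemma dft_empty: "dft {} i xi b = E i (xi b) - (if b i = 0 then 0 else (a i * t powi llin i b) *s xi (b(i := b i - 1)))"
  by (simp add: dft_def defect_def llin_def)

text \<open>Since the changes of the exponents are the increments of one potential
  \<open>fe\<close>, the conditions after all steps are the original ones conjugated by
  multiplication with t^fe.\<close>

lemma dft_full:
  assumes "i < l"
  shows "dft (set rs0) i xi b = E i (xi b) - (if b i = 0 then 0 else
    (a i * t powi (llin i b + fe b - fe (b(i := b i - 1)))) *s xi (b(i := b i - 1)))"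
proof (cases "b i = 0")
  case False
  have "lin l (- nl i + (2 * lm i + 4 * dm i)) (\<lambda>r. nm i r - 2 * Bm i r) b = llin i b + fe b - fe (b(i := b i - 1))"
    using fe_low[OF assms, of b] False
    by (simp add: llin_def lin_def algebra_simps sum_subtractf sum_distrib_left)
  then show ?thesis using False set_rs0 assms by (simp add: dft_def defect_def)
qed (simp add: dft_def defect_def)

text \<open>The composite of all steps acts on Whittaker vectors like a Casimir element: it multiplies the
  component of index b by a scalar, which separates b from 0.\<close>
lemma chain_casimir:
  assumes "\<And>b. xi b \<in> W b" "\<And>i c. i < l \<Longrightarrow> height l c \<le> h \<Longrightarrow> dft {} i xi c = 0" "height l b \<le> h"
  shows "chain rs0 xi b = t powi fe b *s xi b"
  using assms(3)
proof (induction "height l b" arbitrary: b rule: less_induct)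
  case less
  show ?case
  proof (cases "height l b = 0")
    case True
    then show ?thesis using chain_height_0[OF sorted] fe_0 by simp
  next
    case False
    \<comment> \<open>Both terms of y satisfy the conditions of \<open>dft_full\<close>, with the
      same component at b - alpha_i by induction. Hence y is killed by every E_i.\<close>
    define y where "y = chain rs0 xi b - t powi fe b *s xi b"
    have yW: "y \<in> W b" unfolding y_def by (intro W_diff W_scale chain_W sorted assms)
    have "E i y = 0" if i: "i < l" for i
    proof -
      have 0: "dft {} i xi b = 0" using assms(2)[OF i] less.prems by simp
      have "dft (set rs0) i (chain rs0 xi) b = dft {} i xi b"
        by (rule chain_dft[OF sorted assms(1) i]) (use assms(2)[OF i] less.prems in auto)
      then have 1: "dft (set rs0) i (chain rs0 xi) b = 0" using 0 by simp
      show ?thesis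
      proof (cases "b i = 0")
        case True
        then show ?thesis using 0 1 by (simp add: dft_empty dft_full[OF i] y_def E_diff E_scale)
      next
        case False
        let ?b = "b(i := b i - 1)"
        have "height l ?b < height l b" using height_low[of i l 1 b] i False by simp
        then have IH: "chain rs0 xi ?b = t powi fe ?b *s xi ?b" using less.hyps[of ?b] less.prems by simp
        have "t powi (llin i b + fe b - fe ?b) * t powi fe ?b = t powi fe b * t powi llin i b"
          using t_nonzero by (simp add: add.commute flip: power_int_add)
        then have "a i * t powi (llin i b + fe b - fe ?b) * t powi fe ?b = t powi fe b * (a i * t powi llin i b)"
          by (simp add: mult.assoc mult.left_commute)
        then show ?thesis using 0 1 False IH
          by (simp add: dft_empty dft_full[OF i] y_def E_diff E_scale)
      qed
    qed
    moreover obtain i where "i < l" "b i > 0" using False by (auto simp: height_eq_0)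
    ultimately have "y = 0" using singular_zero[OF yW] by blast
    then show ?thesis by (simp add: y_def)
  qed
qed

text \<open>The factor K_(nu_i) acts on the component of index b by a power of t. It has been moved
  to the right-hand side, and \<open>llin i b\<close> is the exponent of its inverse.\<close>

definition whittaker :: "((nat \<Rightarrow> nat) \<Rightarrow> 'v) \<Rightarrow> bool" where
  "whittaker xi \<longleftrightarrow> (\<forall>b. xi b \<in> W b) \<and> (\<forall>b. height l b = 0 \<longrightarrow> xi b = hwv) \<and>
     (\<forall>i<l. \<forall>b. b i > 0 \<longrightarrow> E i (xi b) = (a i * t powi llin i b) *s xi (b(i := b i - 1)))"

lemma whittaker_dft: "whittaker xi \<longleftrightarrow>
  (\<forall>b. xi b \<in> W b) \<and> (\<forall>b. height l b = 0 \<longrightarrow> xi b = hwv) \<and> (\<forall>i<l. \<forall>b. dft {} i xi b = 0)"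
  unfolding whittaker_def dft_empty using E_W0 by (auto split: if_splits)

lemma whittaker_casimir: "whittaker xi \<Longrightarrow> chain rs0 xi b = t powi fe b *s xi b"
  by (rule chain_casimir[where h = "height l b"]) (auto simp: whittaker_dft)

text \<open>In the identity of \<open>chain_casimir\<close> at b, the left-hand side is xi b plus
  terms from components of smaller height. Solved for xi b it becomes a definition:
  \<open>theta_upto h\<close> is 0 at height h+1, so its chain there consists of the terms of
  smaller height only.\<close>

primrec theta_upto :: "nat \<Rightarrow> (nat \<Rightarrow> nat) \<Rightarrow> 'v" where
  "theta_upto 0 = (\<lambda>b. if height l b = 0 then hwv else 0)"
| "theta_upto (Suc h) = (\<lambda>b. if height l b = Suc h then inverse (t powi fe b - 1) *s chain rs0 (theta_upto h) b
     else theta_upto h b)"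

lemma theta_upto_W: "theta_upto h b \<in> W b"
  by (induction h arbitrary: b) (auto simp: height_eq_0 intro!: hwv_W W_scale chain_W[OF sorted])

lemma theta_upto_zero: "height l b > h \<Longrightarrow> theta_upto h b = 0"
  by (induction h) auto

lemma theta_upto_stable: "height l b \<le> h \<Longrightarrow> theta_upto h b = theta_upto (height l b) b"
  by (induction h) (auto simp: le_Suc_eq)

lemma theta_upto_dft: "i < l \<Longrightarrow> height l b \<le> h \<Longrightarrow> dft {} i (theta_upto h) b = 0"
proof (induction h arbitrary: b i)
  case 0
  then show ?case by (auto simp: dft_empty height_eq_0 intro!: E_W0 hwv_W)
next
  case (Suc h)
  note i = Suc.prems(1)
  show ?case
  proof (cases "height l b = Suc h")
    case False
    then have hb: "height l b \<le> h" using Suc.prems by simp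
    have "dft {} i (theta_upto (Suc h)) b = dft {} i (theta_upto h) b"
      using hb height_low[of i l 1 b] i by (auto simp: dft_empty)
    then show ?thesis using Suc.IH[OF i hb] by simp
  next
    case True
    let ?x = "theta_upto h" and ?b = "b(i := b i - 1)"
    have x0: "?x b = 0" using theta_upto_zero True by simp
    have nz: "t powi fe b - 1 \<noteq> 0" using fe_nonzero[of b] t_root[of "fe b"] True by auto
    \<comment> \<open>The component of ?x at b is 0, so the defect on the right is just minus the
      twisted component at b - alpha_i. It supplies the -1 in the factor t^(fe b) - 1, which the
      definition divides out.\<close>
    have "dft (set rs0) i (chain rs0 ?x) b = dft {} i ?x b"
      by (rule chain_dft[OF sorted theta_upto_W i]) (use Suc.IH[OF i] True in auto)
    then have e: "E i (chain rs0 ?x b) = (if b i = 0 then 0 else (a i * t powi (llin i b + fe b - fe ?b)) *s chain rs0 ?x ?b) -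
        (if b i = 0 then 0 else (a i * t powi llin i b) *s ?x ?b)"
      unfolding dft_full[OF i] dft_empty[of i ?x] x0 by (simp add: eq_diff_eq diff_eq_eq split: if_splits)
    show ?thesis
    proof (cases "b i = 0")
      case bi: True
      then show ?thesis using e True by (simp add: dft_empty E_scale)
    next
      case False
      have hb: "height l ?b = h" using height_low[of i l 1 b] i False True by simp
      have "chain rs0 ?x ?b = t powi fe ?b *s ?x ?b"
        by (rule chain_casimir[where h = h]) (use theta_upto_W Suc.IH hb in auto)
      moreover have "t powi (llin i b + fe b - fe ?b) * t powi fe ?b = t powi fe b * t powi llin i b"
        using t_nonzero by (simp add: add.commute flip: power_int_add)
      ultimately have "E i (chain rs0 ?x b) = ((t powi fe b - 1) * (a i * t powi llin i b)) *s ?x ?b"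
        using e False by (simp add: mult.assoc scale_left_diff_distrib left_diff_distrib right_diff_distrib mult.left_commute)
      then have "E i (theta_upto (Suc h) b) = (a i * t powi llin i b) *s ?x ?b"
        using True nz by (simp add: E_scale mult.assoc[symmetric])
      then show ?thesis using False hb by (simp add: dft_empty)
    qed
  qed
qed

lemma whittaker_exists: "\<exists>xi. whittaker xi"
proof
  let ?x = "\<lambda>b. theta_upto (height l b) b"
  have "dft {} i ?x b = 0" if "i < l" for i b
  proof -
    have "dft {} i ?x b = dft {} i (theta_upto (height l b)) b"
      using height_low[of i l 1 b] that theta_upto_stable[of "b(i := b i - 1)" "height l b"] by (auto simp: dft_empty)
    then show ?thesis using theta_upto_dft[OF that] by simp
  qed
  then show "whittaker ?x" using theta_upto_W by (simp add: whittaker_dft)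
qed

subsection \<open>The pairing of two Whittaker vectors\<close>

text \<open>The q-shifted factorial (q_j;q_j)_n with q_j = \<open>t powi (2 * dm j)\<close>.\<close>

definition qp :: "nat \<Rightarrow> nat \<Rightarrow> 'k" where
  "qp j n = (\<Prod>k<n. 1 - t powi (2 * dm j * (int k + 1)))"

primrec csum :: "nat list \<Rightarrow> ((nat \<Rightarrow> nat) \<Rightarrow> 'k) \<Rightarrow> (nat \<Rightarrow> nat) \<Rightarrow> 'k" where
  "csum [] u = u"
| "csum (j # rs) u = (\<lambda>b. \<Sum>n\<le>b j. inverse (qp j n) * csum rs u (b(j := b j - n)))"

text \<open>Because the indices in rs are distinct, coordinate j is lowered only once. The summation
  index n is therefore recovered from c as b j - c j, and the nested sums become one sum over
  c.\<close>

lemma csum_eq: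
  "distinct rs \<Longrightarrow> csum rs u b = (\<Sum>c\<in>{c. c \<le> b \<and> (\<forall>i. i \<notin> set rs \<longrightarrow> c i = b i)}.
     (\<Prod>j\<in>set rs. inverse (qp j (b j - c j))) * u c)"
proof (induction rs arbitrary: b)
  case Nil
  have "{c. c \<le> b \<and> (\<forall>i. c i = b i)} = {b}" by auto
  then show ?case by simp
next
  case (Cons j rs)
  let ?S = "\<lambda>rs b. {c. c \<le> b \<and> (\<forall>i. i \<notin> set rs \<longrightarrow> c i = b i)}"
  let ?w = "\<lambda>rs b c. (\<Prod>j\<in>set rs. inverse (qp j (b j - c j))) * u c"
  have j: "j \<notin> set rs" and d: "distinct rs" using Cons.prems by auto
  have "csum (j # rs) u b = (\<Sum>n\<le>b j. \<Sum>c\<in>?S rs (b(j := b j - n)). inverse (qp j n) * ?w rs (b(j := b j - n)) c)"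
    by (simp only: csum.simps Cons.IH[OF d] sum_distrib_left)
  also have "\<dots> = (\<Sum>(n, c)\<in>Sigma {..b j} (\<lambda>n. ?S rs (b(j := b j - n))). inverse (qp j n) * ?w rs (b(j := b j - n)) c)"
    by (rule sum.Sigma) (use finite_below in blast)+
  also have "\<dots> = (\<Sum>c\<in>?S (j # rs) b. ?w (j # rs) b c)"
  proof (rule sum.reindex_bij_witness[where i = "\<lambda>c. (b j - c j, c)" and j = snd])
    fix x assume "x \<in> Sigma {..b j} (\<lambda>n. ?S rs (b(j := b j - n)))"
    then obtain n c where x: "x = (n, c)" "n \<le> b j" "c \<le> b(j := b j - n)" "\<forall>i. i \<notin> set rs \<longrightarrow> c i = (b(j := b j - n)) i"
      by auto
    have cj: "c j = b j - n" using x(4) j by auto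
    then show "(b j - (snd x) j, snd x) = x" using x by simp
    have "c \<le> b" unfolding le_fun_def
    proof
      fix i show "c i \<le> b i" using le_funD[OF x(3), of i] by (cases "i = j") auto
    qed
    then show "snd x \<in> ?S (j # rs) b" using x by auto
    have "(\<Prod>i\<in>set rs. inverse (qp i ((b(j := b j - n)) i - c i))) = (\<Prod>i\<in>set rs. inverse (qp i (b i - c i)))"
      by (rule prod.cong) (use j in auto)
    then show "?w (j # rs) b (snd x) = (case x of (n, c) \<Rightarrow> inverse (qp j n) * ?w rs (b(j := b j - n)) c)"
      using x j cj by simp
  next
    fix c assume c: "c \<in> ?S (j # rs) b"
    then have "c j \<le> b j" by (auto simp: le_fun_def)
    then show "(b j - c j, c) \<in> Sigma {..b j} (\<lambda>n. ?S rs (b(j := b j - n)))" using c by (auto simp: le_fun_def)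
  qed simp
  finally show ?case .
qed

text \<open>In the application \<open>ge\<close> is \<open>fe\<close> minus the exponent in front of
  the pairing in J, so that this is t^(-fe b) J_b, the quantity summed in the recursion.\<close>

definition uphi :: "((nat \<Rightarrow> nat) \<Rightarrow> 'v \<Rightarrow> 'k) \<Rightarrow> ((nat \<Rightarrow> nat) \<Rightarrow> int) \<Rightarrow> ((nat \<Rightarrow> nat) \<Rightarrow> 'v) \<Rightarrow> (nat \<Rightarrow> nat) \<Rightarrow> 'k" where
  "uphi phi ge xi b = t powi (- ge b) * phi b (xi b)"

text \<open>phi b is the pairing with the component of index b of a dual Whittaker vector.\<close>
context
  fixes phi :: "(nat \<Rightarrow> nat) \<Rightarrow> 'v \<Rightarrow> 'k" and a' :: "nat \<Rightarrow> 'k" and ge :: "(nat \<Rightarrow> nat) \<Rightarrow> int"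
  assumes phi_add: "x \<in> W b \<Longrightarrow> y \<in> W b \<Longrightarrow> phi b (x + y) = phi b x + phi b y"
    and phi_scale: "x \<in> W b \<Longrightarrow> phi b (c *s x) = c * phi b x"
    and phi_F: "j < l \<Longrightarrow> b j > 0 \<Longrightarrow> x \<in> W (b(j := b j - 1)) \<Longrightarrow>
      phi b (F j x) = a' j * t powi (- llin j b) * phi (b(j := b j - 1)) x"
    and aa': "j < l \<Longrightarrow> a j * a' j * (t powi dm j - t powi (- dm j))^2 = -1"
    and ge_low: "j < l \<Longrightarrow> b j > 0 \<Longrightarrow> ge b = ge (b(j := b j - 1)) + lm j - lin l 0 (Bm j) b + 3 * dm j"
begin

lemma phi_sum: "(\<And>n. n \<in> S \<Longrightarrow> f n \<in> W b) \<Longrightarrow> phi b (\<Sum>n\<in>S. f n) = (\<Sum>n\<in>S. phi b (f n))"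
proof (induction S rule: infinite_finite_induct)
  case (insert x S)
  then show ?case by (simp add: phi_add W_sum)
qed (use phi_scale[OF W_zero, of b 0] in simp_all)

text \<open>Each F_j is moved to the dual Whittaker vector, where E_j acts by the scalar a' j
  t^(-llin). The nu part of that exponent cancels against the twist of the step, the scalars combine
  to -1 by \<open>aa'\<close>, and the denominators of \<open>kco\<close> together with the
  remaining powers of t are the factors of (q_j;q_j)_n.\<close>

lemma phi_Fp:
  assumes "j < l"
  shows "n \<le> b j \<Longrightarrow> x \<in> W (b(j := b j - n)) \<Longrightarrow>
    step_coeff j (a j) (- nl j) (nm j) b n * phi b ((F j ^^ n) x) =
    inverse (qp j n) * t powi (ge b - ge (b(j := b j - n))) * phi (b(j := b j - n)) x"
proof (induction n arbitrary: x)
  case 0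
  then show ?case by (simp add: qp_def)
next
  case (Suc n)
  let ?L = "lin l 0 (\<lambda>r. nm j r - Bm j r) b" and ?c = "b(j := b j - n)" and ?c' = "b(j := b j - Suc n)"
  let ?K = "kco j (a j) (- nl j) (nm j j)"
  define d where "d = dm j"
  have c': "?c(j := ?c j - 1) = ?c'" by simp
  have FW: "F j x \<in> W ?c" using F_W[OF assms Suc.prems(2)] Suc.prems(1) by (simp add: Suc_diff_Suc fun_upd_upd del: fun_upd_apply) (simp add: Suc_diff_Suc)
  define y where "y = - nl j + lm j + (int n + 2) * d - int n * nm j j"
  define D where "D = t powi (d * int (Suc n)) - t powi (- (d * int (Suc n)))"
  have D: "D \<noteq> 0" unfolding D_def d_def using qden_nonzero[OF assms] by blast
  have cj: "?c j > 0" using Suc.prems(1) by simp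
  have sw: "(F j ^^ Suc n) x = (F j ^^ n) (F j x)" by (simp add: funpow_swap1)
  note ph = phi_F[where b = ?c and j = j and x = x, OF assms cj, unfolded c', OF Suc.prems(2)]
  have IH: "?K n * t powi (int n * ?L) * phi b ((F j ^^ Suc n) x) =
      inverse (qp j n) * t powi (ge b - ge ?c) * (a' j * t powi (- llin j ?c) * phi ?c' x)"
    unfolding sw ph[symmetric] by (rule Suc.IH[OF Suc_leD[OF Suc.prems(1)] FW])
  have K: "?K (Suc n) = ?K n * (a j * (t powi d - t powi (- d))^2 * t powi y / D)"
    unfolding kco.simps D_def y_def d_def by simp
  have L: "t powi (int (Suc n) * ?L) = t powi (int n * ?L) * t powi ?L"
    unfolding powadd by (simp add: algebra_simps)
  have "?K (Suc n) * t powi (int (Suc n) * ?L) * phi b ((F j ^^ Suc n) x) =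
     (a j * (t powi d - t powi (- d))^2 * t powi y / D * t powi ?L) * (?K n * t powi (int n * ?L) * phi b ((F j ^^ Suc n) x))"
    unfolding K L by (simp only: mult_ac)
  also have "\<dots> = (a j * a' j * (t powi d - t powi (- d))^2) / D * inverse (qp j n) *
      (t powi y * t powi ?L * t powi (ge b - ge ?c) * t powi (- llin j ?c)) * phi ?c' x"
    unfolding IH by (simp add: mult_ac)
  also have "t powi y * t powi ?L * t powi (ge b - ge ?c) * t powi (- llin j ?c) =
      t powi (ge b - ge ?c') * t powi (- (d * int (Suc n)))"
  proof -
    have "llin j ?c = llin j b - int n * nm j j"
      unfolding llin_def using lin_low[of j l n b] assms Suc.prems by simp
    moreover have "?L - llin j b = nl j - lin l 0 (Bm j) b"
      by (simp add: llin_def lin_def algebra_simps sum_subtractf)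
    moreover have "ge ?c = ge ?c' + lm j - (lin l 0 (Bm j) b - int n * (2 * d)) + 3 * d"
      using ge_low[OF assms, of ?c] lin_low[of j l n b 0 "Bm j"] assms Suc.prems B_diag[OF assms] unfolding c' d_def by simp
    ultimately have "y + ?L + (ge b - ge ?c) + (- llin j ?c) = ge b - ge ?c' + (- (d * int (Suc n)))"
      unfolding y_def by (simp add: algebra_simps)
    then show ?thesis unfolding powadd by (rule arg_cong)
  qed
  also have "(a j * a' j * (t powi d - t powi (- d))^2) / D * inverse (qp j n) *
      (t powi (ge b - ge ?c') * t powi (- (d * int (Suc n)))) * phi ?c' x =
     (- (t powi (- (d * int (Suc n)))) / D) * inverse (qp j n) * t powi (ge b - ge ?c') * phi ?c' x"
    using aa'[OF assms] unfolding d_def by simp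
  also have "- (t powi (- (d * int (Suc n)))) / D = inverse (1 - t powi (2 * d * (int n + 1)))"
  proof -
    define z where "z = t powi (d * int (Suc n))"
    have z: "z \<noteq> 0" unfolding z_def using t_nonzero by simp
    have 1: "t powi (2 * d * (int n + 1)) = z * z"
      unfolding powadd z_def by (simp add: algebra_simps)
    have 2: "t powi (- (d * int (Suc n))) = inverse z" by (simp add: z_def power_int_minus)
    have 3: "D = z - inverse z" unfolding D_def 2 z_def ..
    have 4: "1 - z * z = - (z * D)" using z by (simp add: 3 right_diff_distrib)
    show ?thesis unfolding 1 2 4 using z D by (simp add: field_simps)
  qed
  finally show ?case by (simp add: qp_def d_def mult.assoc del: of_nat_Suc fun_upd_apply)
qed

lemma uphi_step:
  assumes j: "j < l" and xi: "\<And>b. xi b \<in> W b"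
  shows "uphi phi ge (step j (a j) (- nl j) (nm j) xi) b = (\<Sum>n\<le>b j. inverse (qp j n) * uphi phi ge xi (b(j := b j - n)))"
proof -
  let ?k = "\<lambda>n. step_coeff j (a j) (- nl j) (nm j) b n"
  have W: "(F j ^^ n) (xi (b(j := b j - n))) \<in> W b" if "n \<le> b j" for n
    by (rule Fp_W_low) (use that j xi in auto)
  have "uphi phi ge (step j (a j) (- nl j) (nm j) xi) b = (\<Sum>n\<le>b j. t powi (- ge b) * phi b (?k n *s (F j ^^ n) (xi (b(j := b j - n)))))"
    unfolding uphi_def step_def by (subst phi_sum) (auto intro!: W_scale W simp: sum_distrib_left)
  also have "\<dots> = (\<Sum>n\<le>b j. inverse (qp j n) * uphi phi ge xi (b(j := b j - n)))"
  proof (intro sum.cong refl)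
    fix n assume n: "n \<in> {..b j}"
    have "t powi (- ge b) * phi b (?k n *s (F j ^^ n) (xi (b(j := b j - n)))) =
      t powi (- ge b) * (?k n * phi b ((F j ^^ n) (xi (b(j := b j - n)))))"
      using W n by (simp add: phi_scale)
    also have "?k n * phi b ((F j ^^ n) (xi (b(j := b j - n)))) =
        inverse (qp j n) * t powi (ge b - ge (b(j := b j - n))) * phi (b(j := b j - n)) (xi (b(j := b j - n)))"
      by (rule phi_Fp) (use n j xi in auto)
    also have "t powi (ge b - ge (b(j := b j - n))) = t powi ge b * t powi (- ge (b(j := b j - n)))"
      using t_nonzero by (simp flip: power_int_add)
    finally show "t powi (- ge b) * phi b (?k n *s (F j ^^ n) (xi (b(j := b j - n)))) = inverse (qp j n) * uphi phi ge xi (b(j := b j - n))"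
      using t_nonzero by (simp add: uphi_def power_int_minus del: fun_upd_apply)
  qed
  finally show ?thesis .
qed

lemma uphi_chain:
  assumes "arrow_sorted l Bm nm rs" "\<And>b. xi b \<in> W b"
  shows "uphi phi ge (chain rs xi) = csum rs (uphi phi ge xi)"
  using assms(1)
proof (induction rs)
  case (Cons j rs)
  then have "uphi phi ge (chain (j # rs) xi) b = csum (j # rs) (uphi phi ge xi) b" for b
    using uphi_step[of j "chain rs xi" b] chain_W[of rs xi] assms(2) by simp
  then show ?case by blast
qed simp

text \<open>The pairing with the composite of all steps is computed twice: the composite acts by
  t^(fe b), and it can be moved step by step to the dual vector, where every step becomes a sum with
  coefficients 1/(q_j;q_j)_n.\<close>

theorem whittaker_pairing_recursion:
  assumes "whittaker xi"
  shows "t powi fe b * uphi phi ge xi b = (\<Sum>c\<in>{c. c \<le> b \<and> (\<forall>i\<ge>l. c i = b i)}.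
     (\<Prod>j<l. inverse (qp j (b j - c j))) * uphi phi ge xi c)"
proof -
  have W: "xi b \<in> W b" for b using assms by (simp add: whittaker_def)
  have "t powi fe b * uphi phi ge xi b = uphi phi ge (chain rs0 xi) b"
    using W by (simp add: uphi_def whittaker_casimir[OF assms] phi_scale)
  also have "\<dots> = csum rs0 (uphi phi ge xi) b" using uphi_chain[OF sorted W] by simp
  also have "\<dots> = (\<Sum>c\<in>{c. c \<le> b \<and> (\<forall>i. i \<notin> set rs0 \<longrightarrow> c i = b i)}. (\<Prod>j\<in>set rs0. inverse (qp j (b j - c j))) * uphi phi ge xi c)"
    by (rule csum_eq[OF arrow_sorted_distinct[OF sorted]])
  finally show ?thesis unfolding set_rs0 by (simp add: not_less)
qed

end

end

section \<open>Quantum binomials and the Serre relations\<close>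

definition generic_q :: "'k::field \<Rightarrow> bool" where
  "generic_q v \<longleftrightarrow> v \<noteq> 0 \<and> (\<forall>n::int. v powi n = 1 \<longrightarrow> n = 0)"

lemma generic_q_inverse: "generic_q v \<Longrightarrow> generic_q (inverse v)"
  by (auto simp: generic_q_def power_int_inverse)

lemma generic_q_powi_add: "generic_q v \<Longrightarrow> v powi x * v powi y = v powi (x + y)"
  by (simp add: generic_q_def power_int_add)

lemma powi_power: "(v powi m) ^ r = v powi (m * int r)" for v :: "'k::field"
  by (simp add: power_int_mult)

lemma generic_q_powi:
  assumes "generic_q v" "d \<noteq> 0"
  shows "generic_q (v powi d)"
proof -
  have "(v powi d) powi n = v powi (d * n)" for n
    by (simp add: power_int_mult)
  then show ?thesis using assms by (auto simp: generic_q_def)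
qed

lemma qint_powi: "qint v n = (v powi int n - v powi (- int n)) / (v - inverse v)"
  by (simp add: qint_def power_int_minus power_inverse)

lemma qint_0 [simp]: "qint v 0 = 0"
  by (simp add: qint_def)

lemma qint_inverse: "qint (inverse v) n = qint v n"
proof -
  have "qint (inverse v) n = - (v ^ n - inverse v ^ n) / - (v - inverse v)" by (simp add: qint_def)
  then show ?thesis by (simp only: minus_divide_divide qint_def)
qed

lemma generic_q_diff:
  assumes "generic_q v" "n \<noteq> 0"
  shows "v powi n - v powi (- n) \<noteq> 0"
proof
  assume a: "v powi n - v powi (- n) = 0"
  have "v \<noteq> 0" using assms by (simp add: generic_q_def)
  then have "v powi (n + n) = 1"
    unfolding power_int_add[OF disjI1[OF \<open>v \<noteq> 0\<close>]] using a
    by (metis eq_iff_diff_eq_0 power_int_minus power_int_not_zero right_inverse)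
  then have "n + n = 0" using assms(1) unfolding generic_q_def by blast
  then show False using assms(2) by simp
qed

lemma qint_Suc_rec:
  assumes "generic_q v"
  shows "qint v m * v powi (int m - 1) + v powi (2 * int m) = qint v (Suc m) * v powi int m"
proof -
  have "v - inverse v \<noteq> 0" using generic_q_diff[OF assms, of 1] by (simp add: power_int_minus)
  moreover have "(v powi int m - v powi (- int m)) * v powi (int m - 1) + v powi (2 * int m) * (v powi 1 - v powi (-1)) = (v powi int (Suc m) - v powi (- int (Suc m))) * v powi int m"
    unfolding left_diff_distrib right_diff_distrib generic_q_powi_add[OF assms] by (simp add: algebra_simps)
  ultimately show ?thesis by (simp add: qint_powi power_int_minus field_simps)
qed

lemma qint_nonzero:
  assumes "generic_q v" "n > 0"
  shows "qint v n \<noteq> 0"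
  using generic_q_diff[OF assms(1), of "int n"] generic_q_diff[OF assms(1), of 1] assms(2)
  by (simp add: qint_powi power_int_minus)

lemma qbinom_rec:
  assumes "generic_q v" "r < n"
  shows "qbinom v n r * qint v (n - r) = qbinom v n (Suc r) * qint v (Suc r)"
proof -
  have nz: "qfact v m \<noteq> 0" for m using qint_nonzero[OF assms(1)] by (simp add: qfact_def)
  have S: "qfact v (Suc m) = qfact v m * qint v (Suc m)" for m
    by (simp add: qfact_def)
  have "n - r = Suc (n - Suc r)" using assms(2) by simp
  then have 1: "qfact v (n - r) = qfact v (n - Suc r) * qint v (n - r)" using S by simp
  have q: "qint v (Suc r) \<noteq> 0" "qint v (n - r) \<noteq> 0" using qint_nonzero[OF assms(1)] assms(2) by auto
  show ?thesis unfolding qbinom_def S[of r] 1 using nz q by simp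
qed

section \<open>The coefficients of the Serre relations and their vanishing sums\<close>

definition serre_coeff :: "K \<Rightarrow> nat \<Rightarrow> nat \<Rightarrow> K" where
  "serre_coeff v n r = (-1) ^ r * qbinom v n r"

lemma serre_coeff_rec:
  assumes "generic_q v" "r < n"
  shows "serre_coeff v n r * qint v (n - r) = - (serre_coeff v n (Suc r) * qint v (Suc r))"
  using qbinom_rec[OF assms] by (simp add: serre_coeff_def)

text \<open>The partial sum up to m, multiplied by [n], telescopes to c_m v^(nm) [n-m], which is 0
  at m = n. The coefficients are kept abstract because the result is also applied at the inverse of
  v, where the quantum integers and hence the recursion are the same.\<close>

lemma serre_coeff_sum_aux:
  assumes v: "generic_q v" and n: "n > 0"
    and rec: "\<And>r. r < n \<Longrightarrow> c r * qint v (n - r) = - (c (Suc r) * qint v (Suc r))"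
  shows "(\<Sum>r\<le>n. c r * v powi ((int n - 1) * int r)) = 0"
proof -
  note powadd = generic_q_powi_add[OF v(1)]
  have qn: "qint v n \<noteq> 0" using qint_nonzero[OF v n] .
  have part: "m \<le> n \<Longrightarrow> (\<Sum>r\<le>m. c r * v powi ((int n - 1) * int r)) * qint v n = c m * v powi (int n * int m) * qint v (n - m)" for m
  proof (induction m)
    case 0
    then show ?case by simp
  next
    case (Suc m)
    have e: "qint v n * v powi ((int n - 1) * int (Suc m)) = qint v (Suc m) * v powi (int n * int m) + v powi (int n * int (Suc m)) * qint v (n - Suc m)"
    proof -
      have a: "int (n - Suc m) = int n - int m - 1" using Suc.prems by simp
      have "(v powi int n - v powi (- int n)) * v powi ((int n - 1) * int (Suc m)) =
         (v powi int (Suc m) - v powi (- int (Suc m))) * v powi (int n * int m) +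
          v powi (int n * int (Suc m)) * (v powi int (n - Suc m) - v powi (- int (n - Suc m)))"
        unfolding left_diff_distrib right_diff_distrib powadd a by (simp add: algebra_simps)
      then have "((v powi int n - v powi (- int n)) * v powi ((int n - 1) * int (Suc m))) / (v - inverse v) =
         ((v powi int (Suc m) - v powi (- int (Suc m))) * v powi (int n * int m) +
          v powi (int n * int (Suc m)) * (v powi int (n - Suc m) - v powi (- int (n - Suc m)))) / (v - inverse v)"
        by simp
      then show ?thesis unfolding qint_powi by (simp only: add_divide_distrib times_divide_eq_left times_divide_eq_right)
    qed
    have "(\<Sum>r\<le>Suc m. c r * v powi ((int n - 1) * int r)) * qint v n =
        c m * qint v (n - m) * v powi (int n * int m) + c (Suc m) * (qint v n * v powi ((int n - 1) * int (Suc m)))"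
      using Suc by (simp add: ring_distribs mult_ac del: of_nat_Suc)
    also have "\<dots> = c (Suc m) * v powi (int n * int (Suc m)) * qint v (n - Suc m)"
      unfolding e rec[OF Suc_le_lessD[OF Suc.prems]] by (simp add: algebra_simps del: of_nat_Suc)
    finally show ?case .
  qed
  show ?thesis using part[of n] qn by simp
qed

lemma serre_coeff_sum:
  assumes "generic_q v" "n > 0"
  shows "(\<Sum>r\<le>n. serre_coeff v n r * v powi ((int n - 1) * int r)) = 0"
    and "(\<Sum>r\<le>n. serre_coeff v n r * v powi (- ((int n - 1) * int r))) = 0"
proof -
  show "(\<Sum>r\<le>n. serre_coeff v n r * v powi ((int n - 1) * int r)) = 0"
    by (rule serre_coeff_sum_aux[OF assms]) (rule serre_coeff_rec[OF assms(1)])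
  have "(\<Sum>r\<le>n. serre_coeff v n r * inverse v powi ((int n - 1) * int r)) = 0"
    by (rule serre_coeff_sum_aux[OF generic_q_inverse[OF assms(1)] assms(2)])
       (simp only: qint_inverse serre_coeff_rec[OF assms(1)])
  then show "(\<Sum>r\<le>n. serre_coeff v n r * v powi (- ((int n - 1) * int r))) = 0"
    by (simp only: power_int_inverse power_int_minus)
qed

section \<open>Commutation of Serre elements with the opposite generators\<close>

locale operator_space = vector_space scale
  for scale :: "'a::field \<Rightarrow> 'b::ab_group_add \<Rightarrow> 'b" (infixr "*s" 75)
begin

definition linear_op :: "('b \<Rightarrow> 'b) \<Rightarrow> bool" where
  "linear_op X \<longleftrightarrow> (\<forall>x y. X (x + y) = X x + X y) \<and> (\<forall>c x. X (c *s x) = c *s X x)"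

lemma linear_opD:
  fixes x y :: 'b
  assumes "linear_op X"
  shows "X (x + y) = X x + X y" "X (c *s x) = c *s X x" "X 0 = 0" "X (x - y) = X x - X y" "X (sum f S) = (\<Sum>a\<in>S. X (f a))"
proof -
  show a: "X (x + y) = X x + X y" and s: "X (c *s x) = c *s X x" for x y c using assms by (auto simp: linear_op_def)
  show 0: "X 0 = 0" using s[of 0 0] by simp
  show "X (x - y) = X x - X y" using a[of "x - y" y] by simp
  show "X (sum f S) = (\<Sum>a\<in>S. X (f a))"
    by (induction S rule: infinite_finite_induct) (auto simp: a 0)
qed

lemma linear_op_funpow: "linear_op X \<Longrightarrow> linear_op (X ^^ n)"
  by (induction n) (auto simp: linear_op_def)

definition serre_op :: "(nat \<Rightarrow> 'a) \<Rightarrow> nat \<Rightarrow> ('b \<Rightarrow> 'b) \<Rightarrow> ('b \<Rightarrow> 'b) \<Rightarrow> 'b \<Rightarrow> 'b" where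
  "serre_op c n X X' x = (\<Sum>r\<le>n. c r *s (X ^^ (n - r)) (X' ((X ^^ r) x)))"

lemma funpow_commute:
  assumes "linear_op X" "\<And>x. Y (X x) = c *s X (Y x)"
  shows "Y ((X ^^ r) x) = (c ^ r) *s (X ^^ r) (Y x)"
  by (induction r) (simp_all add: assms(2) linear_opD[OF assms(1)] mult.commute)

lemma serre_op_commute_other:
  assumes X: "linear_op X" "linear_op X'" "linear_op Y" "\<And>x. Y (X x) = X (Y x)" "\<And>x. Y (X' x) = X' (Y x)"
  shows "Y (serre_op c n X X' x) = serre_op c n X X' (Y x)"
proof -
  have 1: "Y ((X ^^ r) x) = (X ^^ r) (Y x)" for r x using funpow_commute[OF X(1), of Y 1] X(4) by simp
  show ?thesis unfolding serre_op_def linear_opD[OF X(3)] by (simp add: 1 X(5))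
qed

end

text \<open>The case of the generator opposite to X', which occurs once in each term. H and H' only
  pick up powers of v when moved past X, so all extra terms are multiples of X^n (H x) and X^n (H'
  x); the total coefficients are the two sums of \<open>serre_coeff_sum\<close>.\<close>

lemma serre_op_commute_last:
  fixes scale :: "K \<Rightarrow> 'v::ab_group_add \<Rightarrow> 'v" (infixr "*s" 75)
  assumes "operator_space scale"
  assumes X: "operator_space.linear_op scale X" "operator_space.linear_op scale X'" "operator_space.linear_op scale Y"
    and v: "generic_q v" "n > 0"
    and YX: "\<And>x. Y (X x) = X (Y x)" and YX': "\<And>x. Y (X' x) = X' (Y x) + s *s (H x - H' x)"
    and HX: "\<And>x. H (X x) = v powi (1 - int n) *s X (H x)" and H'X: "\<And>x. H' (X x) = v powi (int n - 1) *s X (H' x)"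
  shows "Y (operator_space.serre_op scale (serre_coeff v n) n X X' x) = operator_space.serre_op scale (serre_coeff v n) n X X' (Y x)"
proof -
  interpret operator_space scale by fact
  have 1: "Y ((X ^^ r) x) = (X ^^ r) (Y x)" for r x using funpow_commute[OF X(1), of Y 1] YX by simp
  have 2: "H ((X ^^ r) x) = (v powi (- ((int n - 1) * int r))) *s (X ^^ r) (H x)" for r x
  proof -
    have "(v powi (1 - int n)) ^ r = v powi (- ((int n - 1) * int r))"
      unfolding powi_power by (simp add: algebra_simps)
    then show ?thesis using funpow_commute[where Y = H and X = X, OF X(1) HX, of r x] by simp
  qed
  have 3: "H' ((X ^^ r) x) = (v powi ((int n - 1) * int r)) *s (X ^^ r) (H' x)" for r x
  proof -
    have "(v powi (int n - 1)) ^ r = v powi ((int n - 1) * int r)"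
      unfolding powi_power ..
    then show ?thesis using funpow_commute[where Y = H' and X = X, OF X(1) H'X, of r x] by simp
  qed
  note lin = linear_opD[OF X(1)] linear_opD[OF X(2)] linear_opD[OF X(3)] linear_opD[OF linear_op_funpow[OF X(1)]]
  let ?c = "serre_coeff v n"
  have "Y (serre_op ?c n X X' x) = (\<Sum>r\<le>n. ?c r *s (X ^^ (n - r)) (X' ((X ^^ r) (Y x))) +
      ((?c r * v powi (- ((int n - 1) * int r))) *s s *s (X ^^ n) (H x) - (?c r * v powi ((int n - 1) * int r)) *s s *s (X ^^ n) (H' x)))"
    unfolding serre_op_def lin
  proof (intro sum.cong refl)
    fix r assume "r \<in> {..n}"
    then have XX: "(X ^^ (n - r)) ((X ^^ r) y) = (X ^^ n) y" for y
      using funpow_add[of "n - r" r X] by (simp add: o_def fun_eq_iff)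
    show "?c r *s Y ((X ^^ (n - r)) (X' ((X ^^ r) x))) = ?c r *s (X ^^ (n - r)) (X' ((X ^^ r) (Y x))) +
      ((?c r * v powi (- ((int n - 1) * int r))) *s s *s (X ^^ n) (H x) - (?c r * v powi ((int n - 1) * int r)) *s s *s (X ^^ n) (H' x))"
      unfolding 1 YX' 2 3 lin XX by (simp add: algebra_simps)
  qed
  also have "\<dots> = serre_op ?c n X X' (Y x) + ((\<Sum>r\<le>n. ?c r * v powi (- ((int n - 1) * int r))) *s s *s (X ^^ n) (H x) -
      (\<Sum>r\<le>n. ?c r * v powi ((int n - 1) * int r)) *s s *s (X ^^ n) (H' x))"
    unfolding serre_op_def sum.distrib sum_subtractf scale_sum_left ..
  finally show ?thesis unfolding serre_coeff_sum[OF v] by simp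
qed

text \<open>The case of the generator opposite to X. It can remove an X to the left or to the right
  of X'. Removal on the left in term r and removal on the right in term r+1 give multiples of the
  same vector T r, and these cancel by \<open>serre_coeff_rec\<close>.\<close>

lemma serre_op_commute_first:
  fixes scale :: "K \<Rightarrow> 'v::ab_group_add \<Rightarrow> 'v" (infixr "*s" 75)
  assumes "operator_space scale"
  assumes X: "operator_space.linear_op scale X" "operator_space.linear_op scale X'" "operator_space.linear_op scale Y"
    and v: "generic_q v" "n > 0"
    and YX': "\<And>x. Y (X' x) = X' (Y x)" and YX: "\<And>x. Y (X x) = X (Y x) + s *s (H x - H' x)"
    and HX: "\<And>x. H (X x) = v powi 2 *s X (H x)" and H'X: "\<And>x. H' (X x) = v powi (- 2) *s X (H' x)"
    and HX': "\<And>x. H (X' x) = v powi (1 - int n) *s X' (H x)" and H'X': "\<And>x. H' (X' x) = v powi (int n - 1) *s X' (H' x)"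
  shows "Y (operator_space.serre_op scale (serre_coeff v n) n X X' x) = operator_space.serre_op scale (serre_coeff v n) n X X' (Y x)"
proof -
  interpret operator_space scale by fact
  note lin = linear_opD[OF X(1)] linear_opD[OF X(2)] linear_opD[OF X(3)] linear_opD[OF linear_op_funpow[OF X(1)]]
  note powadd = generic_q_powi_add[OF v(1)]
  have H: "H ((X ^^ r) x) = (v powi (2 * int r)) *s (X ^^ r) (H x)" for r x
    using funpow_commute[where Y = H and X = X, OF X(1) HX, of r x] unfolding powi_power .
  have H': "H' ((X ^^ r) x) = (v powi (- (2 * int r))) *s (X ^^ r) (H' x)" for r x
  proof -
    have "(v powi (- 2)) ^ r = v powi (- (2 * int r))"
      unfolding powi_power by simp
    then show ?thesis using funpow_commute[where Y = H' and X = X, OF X(1) H'X, of r x] by simp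
  qed
  define D where "D m x = v powi m *s H x - v powi (- m) *s H' x" for m x
  have YXn: "Y ((X ^^ m) x) = (X ^^ m) (Y x) + (if m = 0 then 0 else (s * qint v m) *s (X ^^ (m - 1)) (D (int m - 1) x))" for m x
  proof (induction m)
    case (Suc m)
    have "Y ((X ^^ Suc m) x) = X (Y ((X ^^ m) x)) + s *s (v powi (2 * int m) *s (X ^^ m) (H x) - v powi (- (2 * int m)) *s (X ^^ m) (H' x))"
      by (simp add: YX H H')
    also have "X (Y ((X ^^ m) x)) = (X ^^ Suc m) (Y x) + (s * qint v m) *s (X ^^ m) (D (int m - 1) x)"
      unfolding Suc.IH by (cases m) (simp_all add: lin)
    also have "(X ^^ Suc m) (Y x) + (s * qint v m) *s (X ^^ m) (D (int m - 1) x) + s *s (v powi (2 * int m) *s (X ^^ m) (H x) - v powi (- (2 * int m)) *s (X ^^ m) (H' x)) =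
      (X ^^ Suc m) (Y x) + (s * qint v (Suc m)) *s (X ^^ m) (D (int m) x)"
    proof -
      note a = qint_Suc_rec[OF v(1), of m]
      have b: "qint v m * v powi (- (int m - 1)) + v powi (- (2 * int m)) = qint v (Suc m) * v powi (- int m)"
        using qint_Suc_rec[OF generic_q_inverse[OF v(1)], of m]
        by (simp only: qint_inverse power_int_inverse power_int_minus)
      have "(s * qint v m) *s (X ^^ m) (D (int m - 1) x) + s *s (v powi (2 * int m) *s (X ^^ m) (H x) - v powi (- (2 * int m)) *s (X ^^ m) (H' x))
        = (s * (qint v m * v powi (int m - 1) + v powi (2 * int m))) *s (X ^^ m) (H x)
         - (s * (qint v m * v powi (- (int m - 1)) + v powi (- (2 * int m)))) *s (X ^^ m) (H' x)"
        by (simp add: D_def lin scale_right_diff_distrib scale_left_distrib distrib_left mult.assoc)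
      also have "\<dots> = (s * qint v (Suc m)) *s (X ^^ m) (D (int m) x)"
        unfolding a b by (simp add: D_def lin scale_right_diff_distrib mult.assoc)
      finally show ?thesis by (simp add: add.assoc)
    qed
    finally show ?case by simp
  qed simp
  define T where "T r = (X ^^ (n - 1 - r)) (X' ((X ^^ r) (D (int r) x)))" for r
  let ?c = "serre_coeff v n"
  \<comment> \<open>Moving D past X' and X^r changes its parameter from n-r-1 to r, the parameter
    that a removal on the right produces; this is why both kinds of terms lead to T r.\<close>
  have D1: "D (int (n - r) - 1) (X' ((X ^^ r) x)) = X' ((X ^^ r) (D (int r) x))" if "r < n" for r
  proof -
    have e: "int (n - r) - 1 + (1 - int n) + 2 * int r = int r" "- (int (n - r) - 1) + (int n - 1) + - (2 * int r) = - int r"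
      using that by auto
    have "D (int (n - r) - 1) (X' ((X ^^ r) x)) = v powi (int (n - r) - 1 + (1 - int n) + 2 * int r) *s X' ((X ^^ r) (H x)) -
       v powi (- (int (n - r) - 1) + (int n - 1) + - (2 * int r)) *s X' ((X ^^ r) (H' x))"
      unfolding D_def HX' H'X' H H' lin scale_scale powadd by (simp add: algebra_simps)
    then show ?thesis unfolding e by (simp add: D_def lin)
  qed
  have YT: "Y ((X ^^ (n - r)) (X' ((X ^^ r) x))) = (X ^^ (n - r)) (X' ((X ^^ r) (Y x))) +
     (if r < n then (s * qint v (n - r)) *s T r else 0) + (if r = 0 then 0 else (s * qint v r) *s T (r - 1))" if r: "r \<le> n" for r
  proof -
    have "Y ((X ^^ (n - r)) (X' ((X ^^ r) x))) = (X ^^ (n - r)) (X' (Y ((X ^^ r) x))) +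
      (if n - r = 0 then 0 else (s * qint v (n - r)) *s (X ^^ (n - r - 1)) (D (int (n - r) - 1) (X' ((X ^^ r) x))))"
      unfolding YXn[of "n - r" "X' ((X ^^ r) x)"] YX' ..
    also have "(if n - r = 0 then 0 else (s * qint v (n - r)) *s (X ^^ (n - r - 1)) (D (int (n - r) - 1) (X' ((X ^^ r) x)))) = (if r < n then (s * qint v (n - r)) *s T r else 0)"
      using r D1[of r] by (simp add: T_def diff_commute)
    also have "(X ^^ (n - r)) (X' (Y ((X ^^ r) x))) = (X ^^ (n - r)) (X' ((X ^^ r) (Y x))) + (if r = 0 then 0 else (s * qint v r) *s T (r - 1))"
    proof (cases r)
      case (Suc m)
      have "n - 1 - m = n - r" using Suc by simp
      then show ?thesis unfolding YXn[of r x] using Suc by (simp add: lin T_def)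
    qed simp
    finally show ?thesis by (simp add: add_ac)
  qed
  have "Y (serre_op ?c n X X' x) = serre_op ?c n X X' (Y x) + ((\<Sum>r\<le>n. if r < n then ?c r *s (s * qint v (n - r)) *s T r else 0)
     + (\<Sum>r\<le>n. if r = 0 then 0 else ?c r *s (s * qint v r) *s T (r - 1)))"
    unfolding serre_op_def lin sum.distrib[symmetric]
    by (intro sum.cong refl) (simp add: YT scale_right_distrib add_ac)
  also have "(\<Sum>r\<le>n. if r < n then ?c r *s (s * qint v (n - r)) *s T r else 0) = (\<Sum>r<n. ?c r *s (s * qint v (n - r)) *s T r)"
    unfolding lessThan_Suc_atMost[symmetric] by simp
  also have "(\<Sum>r\<le>n. if r = 0 then 0 else ?c r *s (s * qint v r) *s T (r - 1)) = (\<Sum>r<n. ?c (Suc r) *s (s * qint v (Suc r)) *s T r)"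
    unfolding lessThan_Suc_atMost[symmetric] by (subst sum.lessThan_Suc_shift) simp
  also have "(\<Sum>r<n. ?c r *s (s * qint v (n - r)) *s T r) + (\<Sum>r<n. ?c (Suc r) *s (s * qint v (Suc r)) *s T r) = 0"
    unfolding sum.distrib[symmetric]
  proof (rule sum.neutral, intro ballI)
    fix r assume "r \<in> {..<n}"
    then have "?c r * qint v (n - r) + ?c (Suc r) * qint v (Suc r) = 0"
      using serre_coeff_rec[OF v(1), of r n] by simp
    then have "s * (?c r * qint v (n - r) + ?c (Suc r) * qint v (Suc r)) = 0" by simp
    then have "(?c r * (s * qint v (n - r)) + ?c (Suc r) * (s * qint v (Suc r))) *s T r = 0"
      by (simp add: distrib_left mult.left_commute)
    then show "?c r *s (s * qint v (n - r)) *s T r + ?c (Suc r) *s (s * qint v (Suc r)) *s T r = 0"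
      by (simp add: scale_left_distrib)
  qed
  finally show ?thesis by simp
qed

section \<open>Root data\<close>

lemmas fun_ops = plus_fun_apply zero_fun_apply minus_apply uminus_apply

declare fun_ops [simp del]

lemma form_add_left: "form l B (x + y) z = form l B x z + form l B y z"
  by (simp add: form_def algebra_simps sum.distrib fun_ops)

lemma form_add_right: "form l B z (x + y) = form l B z x + form l B z y"
  by (simp add: form_def algebra_simps sum.distrib fun_ops)

lemma form_diff_left: "form l B (x - y) z = form l B x z - form l B y z"
  by (simp add: form_def algebra_simps sum_subtractf fun_ops)

lemma form_diff_right: "form l B z (x - y) = form l B z x - form l B z y"
  by (simp add: form_def algebra_simps sum_subtractf fun_ops)

lemma form_uminus_left: "form l B (- x) z = - form l B x z"
  by (simp add: form_def sum_negf fun_ops)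

lemma form_zero_left [simp]: "form l B 0 z = 0" and form_zero_right [simp]: "form l B z 0 = 0"
  by (simp_all add: form_def fun_ops)

lemma form_sum_left: "form l B (sum f S) z = (\<Sum>s\<in>S. form l B (f s) z)"
  by (induction S rule: infinite_finite_induct) (simp_all add: form_add_left)

lemma form_alpha_right:
  assumes "j < l"
  shows "form l B x (alpha j) = (\<Sum>i<l. x i * of_int (B i j))"
proof -
  have "(\<Sum>k<l. x i * alpha j k * of_int (B i k)) = x i * of_int (B i j)" for i
  proof -
    have "(\<Sum>k<l. x i * alpha j k * of_int (B i k)) = (\<Sum>k<l. if k = j then x i * of_int (B i j) else 0)"
      by (rule sum.cong) (auto simp: alpha_def)
    then show ?thesis using assms by simp
  qed
  then show ?thesis by (simp add: form_def)
qed

lemma form_expand: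
  "form l B x y = (\<Sum>j<l. y j * form l B x (alpha j))"
proof -
  have "form l B x y = (\<Sum>j<l. \<Sum>i<l. x i * y j * of_int (B i j))"
    unfolding form_def by (rule sum.swap)
  also have "\<dots> = (\<Sum>j<l. y j * form l B x (alpha j))"
    by (intro sum.cong refl) (simp add: form_alpha_right sum_distrib_left mult_ac)
  finally show ?thesis .
qed

definition wt_of :: "nat \<Rightarrow> (nat \<Rightarrow> nat) \<Rightarrow> wt" where
  "wt_of l b = (\<lambda>i. if i < l then of_nat (b i) else 0)"

lemma wt_of_inQplus: "inQplus l (wt_of l b)"
  by (auto simp: inQplus_def wt_of_def)

lemma inQplus_wt_of:
  assumes "inQplus l beta"
  obtains b where "beta = wt_of l b" "\<And>i. i \<ge> l \<Longrightarrow> b i = 0"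
proof -
  have "\<forall>i. \<exists>n::nat. beta i = of_nat n \<and> (i \<ge> l \<longrightarrow> n = 0)"
  proof
    fix i show "\<exists>n::nat. beta i = of_nat n \<and> (i \<ge> l \<longrightarrow> n = 0)"
      using assms unfolding inQplus_def by (cases "i < l") auto
  qed
  then obtain b where "\<forall>i. beta i = of_nat (b i) \<and> (i \<ge> l \<longrightarrow> b i = 0)" by metis
  then show ?thesis using that[of b] by (auto simp: wt_of_def fun_eq_iff)
qed

lemma wt_of_Suc: "i < l \<Longrightarrow> wt_of l (b(i := b i + 1)) = wt_of l b + alpha i"
  by (auto simp: wt_of_def alpha_def fun_eq_iff fun_ops)

lemma wt_of_low: "i < l \<Longrightarrow> b i > 0 \<Longrightarrow> wt_of l (b(i := b i - 1)) = wt_of l b - alpha i"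
  by (auto simp: wt_of_def alpha_def fun_eq_iff fun_ops of_nat_diff)

lemma wt_of_0: "(\<And>r. r < l \<Longrightarrow> b r = 0) \<Longrightarrow> wt_of l b = 0"
  by (auto simp: wt_of_def fun_eq_iff fun_ops)

text \<open>Off-diagonal terms come in equal pairs. Hence (beta, beta) is even on Q, and (beta,
  beta)/2 is an admissible exponent, which integrality of N (P,P) alone would not give.\<close>

lemma even_symmetric_sum:
  fixes M :: "nat \<Rightarrow> nat \<Rightarrow> int"
  assumes "\<And>i j. i < n \<Longrightarrow> j < n \<Longrightarrow> M i j = M j i" "\<And>i. i < n \<Longrightarrow> even (M i i)"
  shows "even (\<Sum>i<n. \<Sum>j<n. M i j)"
  using assms
proof (induction n)
  case (Suc n)
  have "(\<Sum>j<n. M n j) = (\<Sum>i<n. M i n)" by (rule sum.cong) (use Suc.prems in auto)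
  then have "(\<Sum>i<Suc n. \<Sum>j<Suc n. M i j) = (\<Sum>i<n. \<Sum>j<n. M i j) + 2 * (\<Sum>i<n. M i n) + M n n"
    by (simp add: sum.distrib)
  then show ?case using Suc by simp
qed simp

locale root_datum =
  fixes l N :: nat and B :: "nat \<Rightarrow> nat \<Rightarrow> int"
  assumes srd: "simple_root_datum l B" and adm: "admissible_N l B N"
begin

lemma srd_unfold:
  "\<forall>i<l. \<forall>j<l. B i j = B j i" "\<forall>i<l. B i i > 0 \<and> even (B i i)"
  "\<forall>i<l. \<forall>j<l. i \<noteq> j \<longrightarrow> B i j \<le> 0 \<and> (2 * B i j) mod (B i i) = 0"
  "\<forall>x::nat \<Rightarrow> real. (\<exists>i<l. x i \<noteq> 0) \<longrightarrow> (\<Sum>i<l. \<Sum>j<l. x i * x j * of_int (B i j)) > 0"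
  using srd unfolding simple_root_datum_def by - (elim conjE, assumption)+

lemma B_sym: "i < l \<Longrightarrow> j < l \<Longrightarrow> B i j = B j i"
  and B_even: "i < l \<Longrightarrow> B i i = 2 * dd B i"
  and dd_pos: "i < l \<Longrightarrow> dd B i > 0"
  and B_nonpos: "i < l \<Longrightarrow> j < l \<Longrightarrow> i \<noteq> j \<Longrightarrow> B i j \<le> 0"
proof -
  show "i < l \<Longrightarrow> j < l \<Longrightarrow> B i j = B j i" using srd_unfold(1) by blast
  show "i < l \<Longrightarrow> B i i = 2 * dd B i" using srd_unfold(2) by (simp add: dd_def)
  show "i < l \<Longrightarrow> dd B i > 0" using srd_unfold(2) by (fastforce simp: dd_def elim: evenE)
  show "i < l \<Longrightarrow> j < l \<Longrightarrow> i \<noteq> j \<Longrightarrow> B i j \<le> 0" using srd_unfold(3) by blast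
qed

lemma B_dvd:
  assumes "i < l" "j < l"
  shows "dd B i dvd B i j"
proof (cases "i = j")
  case False
  have "(2 * B i j) mod (B i i) = 0" using srd_unfold(3) assms False by blast
  then have "2 * dd B i dvd 2 * B i j" using B_even[OF assms(1)] by (simp add: mod_eq_0_iff_dvd)
  then show ?thesis by simp
qed (use B_even assms in simp)

lemma B_cartan:
  assumes "i < l" "j < l"
  shows "B i j = cartan B i j * dd B i"
proof -
  obtain k where k: "B i j = dd B i * k" using B_dvd[OF assms] by blast
  have "cartan B i j = (2 * dd B i * k) div (2 * dd B i)" using k B_even[OF assms(1)] by (simp add: cartan_def)
  also have "\<dots> = k" using dd_pos[OF assms(1)] by simp
  finally show ?thesis using k by simp
qed

lemma cartan_nonpos:
  assumes "i < l" "j < l" "i \<noteq> j"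
  shows "cartan B i j \<le> 0"
  using B_cartan[OF assms(1,2)] B_nonpos[OF assms] dd_pos[OF assms(1)] by (simp add: mult_le_0_iff)

lemma form_sym: "form l B x y = form l B y x"
proof -
  have "form l B x y = (\<Sum>j<l. \<Sum>i<l. x i * y j * of_int (B i j))"
    unfolding form_def by (rule sum.swap)
  also have "\<dots> = form l B y x"
    unfolding form_def by (intro sum.cong refl) (simp add: B_sym mult_ac)
  finally show ?thesis .
qed

lemma form_alpha_alpha: "i < l \<Longrightarrow> j < l \<Longrightarrow> form l B (alpha i) (alpha j) = of_int (B i j)"
proof -
  assume i: "i < l" and j: "j < l"
  have "form l B (alpha i) (alpha j) = (\<Sum>k<l. if k = i then of_int (B i j) else 0)"
    unfolding form_alpha_right[OF j] by (rule sum.cong) (auto simp: alpha_def)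
  then show ?thesis using i by simp
qed

lemma form_pos:
  assumes "i < l" "x i \<noteq> 0"
  shows "form l B x x > 0"
proof -
  have "(\<Sum>i<l. \<Sum>j<l. real_of_rat (x i) * real_of_rat (x j) * of_int (B i j)) > 0"
  proof -
    have "\<exists>i<l. real_of_rat (x i) \<noteq> 0" using assms by auto
    then show ?thesis by (rule srd_unfold(4)[rule_format])
  qed
  moreover have "real_of_rat (form l B x x) = (\<Sum>i<l. \<Sum>j<l. real_of_rat (x i) * real_of_rat (x j) * of_int (B i j))"
    by (simp add: form_def of_rat_sum of_rat_mult)
  ultimately show ?thesis by (metis zero_less_of_rat_iff)
qed

lemma inP_zero: "inP l B 0"
  by (auto simp: inP_def fun_ops intro!: exI[of _ 0])

lemma inP_add: "inP l B x \<Longrightarrow> inP l B y \<Longrightarrow> inP l B (x + y)"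
proof -
  assume a: "inP l B x" "inP l B y"
  have "\<exists>k::int. form l B (x + y) (alpha j) = of_int (k * dd B j)" if j: "j < l" for j
  proof -
    obtain k m where "form l B x (alpha j) = of_int (k * dd B j)" "form l B y (alpha j) = of_int (m * dd B j)"
      using a j unfolding inP_def by blast
    then show ?thesis by (intro exI[of _ "k + m"]) (simp add: form_add_left distrib_right)
  qed
  then show ?thesis using a by (simp add: inP_def fun_ops)
qed

lemma inP_uminus: "inP l B x \<Longrightarrow> inP l B (- x)"
proof -
  assume a: "inP l B x"
  have "\<exists>k::int. form l B (- x) (alpha j) = of_int (k * dd B j)" if j: "j < l" for j
  proof -
    obtain k where "form l B x (alpha j) = of_int (k * dd B j)" using a j unfolding inP_def by blast
    then show ?thesis by (intro exI[of _ "- k"]) (simp add: form_uminus_left)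
  qed
  then show ?thesis using a by (simp add: inP_def fun_ops)
qed

lemma inP_diff: "inP l B x \<Longrightarrow> inP l B y \<Longrightarrow> inP l B (x - y)"
  using inP_add[OF _ inP_uminus, of x y] by simp

lemma inP_alpha: "i < l \<Longrightarrow> inP l B (alpha i)"
proof -
  assume i: "i < l"
  have "\<exists>k::int. form l B (alpha i) (alpha j) = of_int (k * dd B j)" if j: "j < l" for j
    using B_dvd[OF j i] B_sym[OF j i] by (auto simp: form_alpha_alpha[OF i j] mult.commute elim!: dvdE)
  then show ?thesis using i by (auto simp: inP_def alpha_def)
qed

lemma wt_of_induct:
  assumes "Pr 0" "\<And>x i. i < l \<Longrightarrow> Pr x \<Longrightarrow> Pr (x + alpha i)"
  shows "Pr (wt_of l b)"
proof (induction "height l b" arbitrary: b)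
  case 0
  then have "wt_of l b = 0" by (intro wt_of_0) (metis height_eq_0)
  then show ?case using assms by simp
next
  case (Suc n)
  then obtain i where i: "i < l" "b i > 0" using height_eq_0[of l b] by auto
  have "n = height l (b(i := b i - 1))" using height_low[of i l 1 b] i Suc(2) by simp
  then have "Pr (wt_of l (b(i := b i - 1)))" by (rule Suc.hyps)
  then show ?case using assms(2)[OF i(1)] wt_of_low[where l = l and b = b and i = i, OF i] by (metis diff_add_cancel)
qed

lemma inP_wt_of: "inP l B (wt_of l b)"
  by (rule wt_of_induct) (auto intro: inP_zero inP_add inP_alpha)

text \<open>The rational r for which v^r is an integral power of the generator of the ground field.\<close>
definition admr :: "rat \<Rightarrow> bool" where "admr r \<longleftrightarrow> (\<exists>k::int. of_nat N * r = of_int k)"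

text \<open>The same rounding as in \<open>vpow\<close>. It is additive on admissible exponents
  only, so admissibility accompanies every manipulation of exponents.\<close>

definition xp :: "rat \<Rightarrow> int" where "xp r = \<lfloor>of_nat N * r\<rfloor>"

lemma xp_of: "admr r \<Longrightarrow> of_int (xp r) = of_nat N * r"
  by (auto simp: admr_def xp_def)

lemma N_pos: "N > 0"
  using adm by (simp add: admissible_N_def)

lemma admr_add: "admr r \<Longrightarrow> admr s \<Longrightarrow> admr (r + s)"
  unfolding admr_def distrib_left by (elim exE) (metis of_int_add)

lemma admr_minus: "admr r \<Longrightarrow> admr (- r)"
  unfolding admr_def mult_minus_right by (elim exE) (metis of_int_minus)

lemma admr_diff: "admr r \<Longrightarrow> admr s \<Longrightarrow> admr (r - s)"
  using admr_add[of r "- s"] admr_minus by simp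

lemma admr_int [simp]: "admr (of_int k)" "admr 0"
  by (auto simp: admr_def intro: exI[of _ "int N * k"])

lemma admr_mult_int: "admr r \<Longrightarrow> admr (of_int k * r)"
proof -
  assume "admr r"
  then obtain m where "of_nat N * r = of_int m" by (auto simp: admr_def)
  then have "of_nat N * (of_int k * r) = of_int (k * m)" by (simp add: mult.left_commute)
  then show ?thesis unfolding admr_def by blast
qed

lemma xp_add: "admr r \<Longrightarrow> admr s \<Longrightarrow> xp (r + s) = xp r + xp s"
  by (auto simp: admr_def xp_def distrib_left)

lemma xp_minus: "admr r \<Longrightarrow> xp (- r) = - xp r"
  by (auto simp: admr_def xp_def)

lemma xp_diff: "admr r \<Longrightarrow> admr s \<Longrightarrow> xp (r - s) = xp r - xp s"
  by (auto simp: admr_def xp_def right_diff_distrib)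

lemma xp_eqI: "of_nat N * r = of_int k \<Longrightarrow> xp r = k"
  by (simp add: xp_def)

lemma xp_int: "xp (of_int k) = int N * k"
  by (rule xp_eqI) simp

lemma xp_mult_int: "admr r \<Longrightarrow> xp (of_int k * r) = k * xp r"
  by (rule xp_eqI) (simp add: xp_of mult.left_commute)

lemma xp_0 [simp]: "xp 0 = 0"
  by (simp add: xp_def)

lemma xp_sum: "(\<And>s. s \<in> S \<Longrightarrow> admr (f s)) \<Longrightarrow> xp (sum f S) = (\<Sum>s\<in>S. xp (f s)) \<and> admr (sum f S)"
  by (induction S rule: infinite_finite_induct) (auto simp: xp_add admr_add)

lemma xp_eq_0: "admr r \<Longrightarrow> xp r = 0 \<longleftrightarrow> r = 0"
  using xp_of[of r] N_pos by auto

lemma vpow_xp: "vpow tt N r = tt powi xp r"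
  by (simp add: vpow_def xp_def)

lemma admr_form: "inP l B x \<Longrightarrow> inP l B y \<Longrightarrow> admr (form l B x y)"
  using adm by (auto simp: admissible_N_def admr_def)

lemma admr_half: "admr (form l B (wt_of l b) (wt_of l b) / 2)"
proof -
  define S where "S = (\<Sum>i<l. \<Sum>j<l. int (b i) * int (b j) * B i j)"
  have "even S"
    unfolding S_def by (rule even_symmetric_sum) (auto simp: B_sym B_even mult_ac)
  then obtain k where k: "S = 2 * k" by blast
  have "form l B (wt_of l b) (wt_of l b) = of_int S"
    by (simp add: S_def form_def wt_of_def)
  then have "form l B (wt_of l b) (wt_of l b) / 2 = of_int k" by (simp add: k)
  then show ?thesis by simp
qed

text \<open>Orthogonalization over the rationals. The vector z is alpha_m made orthogonal to the
  earlier roots, so (z, alpha_m) = (z, z) > 0 by positive definiteness; adding a multiple of z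
  settles equation m without disturbing the earlier ones.\<close>

lemma solve_form:
  "m \<le> l \<Longrightarrow> \<exists>x. (\<forall>k\<ge>m. x k = 0) \<and> (\<forall>j<m. form l B x (alpha j) = b j)"
proof (induction m arbitrary: b)
  case 0
  show ?case by (rule exI[of _ 0]) (simp add: fun_ops)
next
  case (Suc m)
  then have m: "m < l" by simp
  obtain x where x: "\<forall>k\<ge>m. x k = 0" "\<forall>j<m. form l B x (alpha j) = b j" using Suc.IH[of b] m by auto
  obtain y where y: "\<forall>k\<ge>m. y k = 0" "\<forall>j<m. form l B y (alpha j) = form l B (alpha m) (alpha j)"
    using Suc.IH[of "\<lambda>j. form l B (alpha m) (alpha j)"] m by auto
  define z where "z = alpha m - y"
  have z0: "form l B z (alpha j) = 0" if "j < m" for j using y that by (simp add: z_def form_diff_left)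
  have zy: "form l B z y = 0"
    unfolding form_expand[of l B z y] by (rule sum.neutral) (use z0 y(1) in \<open>metis linorder_not_less mult_zero_left mult_zero_right\<close>)
  have "z m = 1" using y(1) by (simp add: z_def alpha_def fun_ops)
  then have "form l B z z > 0" using form_pos[OF m, of z] by simp
  moreover have "form l B z z = form l B z (alpha m)"
    using zy form_diff_right[of l B z "alpha m" y] by (simp add: z_def[symmetric])
  ultimately have zm: "form l B z (alpha m) \<noteq> 0" by simp
  define c where "c = (b m - form l B x (alpha m)) / form l B z (alpha m)"
  define w where "w = x + (\<lambda>i. c * z i)"
  have cz: "form l B (\<lambda>i. c * z i) u = c * form l B z u" for u
    by (simp add: form_def sum_distrib_left mult_ac)
  have "form l B w (alpha j) = b j" if "j < Suc m" for j
  proof (cases "j = m")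
    case True
    then show ?thesis using zm by (simp add: w_def form_add_left cz) (simp add: c_def)
  next
    case False
    then show ?thesis using that x(2) z0[of j] by (simp add: w_def form_add_left cz)
  qed
  moreover have "\<forall>k\<ge>Suc m. w k = 0" using x(1) y(1) by (simp add: w_def z_def alpha_def fun_ops)
  ultimately show ?case by blast
qed

lemma form_eq_0D:
  assumes "\<And>j. j < l \<Longrightarrow> form l B x (alpha j) = 0" "\<forall>k\<ge>l. x k = 0"
  shows "x = 0"
proof (rule ccontr)
  assume "x \<noteq> 0"
  then obtain i where i: "x i \<noteq> 0" by (auto simp: fun_eq_iff fun_ops)
  then have "i < l" using assms(2) by (meson linorder_not_less)
  then have "form l B x x > 0" using form_pos i by simp
  moreover have "form l B x x = 0" unfolding form_expand[of l B x x] using assms(1) by simp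
  ultimately show False by simp
qed

lemma fundw_form:
  assumes "j < l"
  shows "form l B (fundw l B i) (alpha j) = (if i = j then of_int (dd B i) else 0)"
proof -
  let ?Q = "\<lambda>mu. (\<forall>k\<ge>l. mu k = 0) \<and> (\<forall>j<l. form l B mu (alpha j) = (if i = j then of_int (dd B i) else 0))"
  have "\<exists>!mu. ?Q mu"
  proof (rule ex_ex1I)
    show "\<exists>mu. ?Q mu" by (rule solve_form) simp
  next
    fix mu mu' assume "?Q mu" "?Q mu'"
    then have "mu - mu' = 0" by (intro form_eq_0D) (auto simp: form_diff_left fun_ops)
    then show "mu = mu'" by simp
  qed
  then have "?Q (fundw l B i)" unfolding fundw_def by (rule theI')
  then show ?thesis using assms by simp
qed

lemma rho_form: "j < l \<Longrightarrow> form l B (rho l B) (alpha j) = of_int (dd B j)"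
  by (simp add: rho_def form_sum_left fundw_form)

lemma rho_wt_of: "form l B (rho l B) (wt_of l b) = of_int (\<Sum>j<l. int (b j) * dd B j)"
  unfolding form_expand[of l B "rho l B" "wt_of l b"] by (simp add: rho_form wt_of_def)

section \<open>Ordering the simple roots along the arrows\<close>

lemma B_offdiag_bound:
  assumes "i < l" "j < l" "i \<noteq> j" "B i j \<noteq> 0"
  shows "real_of_int (B i j) \<le> - (sqrt (dd B i) * sqrt (dd B j))"
proof -
  obtain k where k: "B i j = dd B i * k" using B_dvd[OF assms(1,2)] by blast
  obtain m where m: "B i j = dd B j * m" using B_dvd[OF assms(2,1)] B_sym[OF assms(1,2)] by auto
  have neg: "B i j < 0" using B_nonpos[OF assms(1-3)] assms(4) by simp
  have "k < 0" using neg dd_pos[OF assms(1)] unfolding k by (simp add: mult_less_0_iff)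
  moreover have "m < 0" using neg dd_pos[OF assms(2)] unfolding m by (simp add: mult_less_0_iff)
  \<comment> \<open>A negative multiple of d_i has absolute value at least d_i, and B_ij is one of
    both d_i and d_j; so its absolute value bounds their geometric mean.\<close>
  ultimately have "dd B i \<le> - B i j" "dd B j \<le> - B i j"
    using mult_left_mono[of 1 "- k" "dd B i"] mult_left_mono[of 1 "- m" "dd B j"]
      dd_pos[OF assms(1)] dd_pos[OF assms(2)] by (simp_all add: k) (simp add: m flip: k)
  then have "sqrt (dd B i) * sqrt (dd B j) \<le> sqrt (- B i j) * sqrt (- B i j)"
    using dd_pos[OF assms(1)] dd_pos[OF assms(2)] neg by (intro mult_mono) auto
  also have "\<dots> = - B i j" using neg by simp
  finally show ?thesis by simp
qed

text \<open>An orientation without a source on R would give at least card R edges within R, contradicting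
  positive definiteness at the sum of the simple roots in R, each divided by the square root of d_i.\<close>
lemma orientation_source:
  assumes eps: "\<forall>i<l. \<forall>j<l. eps i j = - eps j i" "\<forall>i<l. \<forall>j<l. adjacent B i j \<longrightarrow> eps i j = 1 \<or> eps i j = (-1::int)"
    and R: "R \<subseteq> {..<l}" "R \<noteq> {}"
  shows "\<exists>j\<in>R. \<forall>i\<in>R. adjacent B j i \<longrightarrow> eps j i = 1"
proof (rule ccontr)
  assume "\<not> ?thesis"
  then have "\<forall>j\<in>R. \<exists>i\<in>R. adjacent B j i \<and> eps j i \<noteq> 1" by blast
  then obtain s where s: "\<And>j. j \<in> R \<Longrightarrow> s j \<in> R \<and> adjacent B j (s j) \<and> eps j (s j) \<noteq> 1" by metis
  have Rl: "i < l" if "i \<in> R" for i using R that by auto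
  have s1: "eps j (s j) = -1" if "j \<in> R" for j using s[OF that] eps(2) Rl that by blast
  define x where "x i = (if i \<in> R then 1 / sqrt (dd B i) else 0)" for i
  have fin: "finite R" using R(1) finite_subset by blast
  define f where "f i j = x i * x j * of_int (B i j)" for i j
  have "(\<Sum>i<l. \<Sum>j<l. f i j) > 0"
  proof -
    obtain i where i: "i \<in> R" using R(2) by blast
    then have "x i \<noteq> 0" using dd_pos[OF Rl[OF i]] by (simp add: x_def)
    then show ?thesis using srd_unfold(4)[rule_format, of x] Rl[OF i] unfolding f_def by blast
  qed
  moreover have "(\<Sum>i<l. \<Sum>j<l. f i j) = (\<Sum>i\<in>R. \<Sum>j\<in>R. f i j)"
  proof -
    have "(\<Sum>j<l. f i j) = (\<Sum>j\<in>R. f i j)" for i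
      by (rule sum.mono_neutral_right) (use R in \<open>auto simp: f_def x_def\<close>)
    moreover have "(\<Sum>i<l. \<Sum>j\<in>R. f i j) = (\<Sum>i\<in>R. \<Sum>j\<in>R. f i j)"
      by (rule sum.mono_neutral_right) (use R in \<open>auto simp: f_def x_def\<close>)
    ultimately show ?thesis by simp
  qed
  \<comment> \<open>The normalization by square roots makes diagonal terms 2 and terms of edges at
    most -1. The two indicators cannot both be 1, since eps would then be -1 in both directions; so
    every edge from j to s j is counted twice, once in each order, and the bound sums to 0.\<close>
  moreover have "(\<Sum>i\<in>R. \<Sum>j\<in>R. f i j) \<le> (\<Sum>i\<in>R. \<Sum>j\<in>R. (if j = i then 2 else 0) - (if j = s i then 1 else 0) - (if i = s j then 1 else 0))"
  proof (intro sum_mono)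
    fix i j assume ij: "i \<in> R" "j \<in> R"
    have d: "dd B i > 0" "dd B j > 0" using dd_pos Rl ij by auto
    show "f i j \<le> (if j = i then 2 else 0) - (if j = s i then 1 else 0) - (if i = s j then 1 else 0)"
    proof (cases "j = i")
      case True
      have "s i \<noteq> i" using s[OF ij(1)] by (auto simp: adjacent_def)
      moreover have "f i i = 2"
      proof -
        have "x i * x i = 1 / dd B i" using d(1) ij(1) by (simp add: x_def)
        then show ?thesis using d(1) unfolding f_def B_even[OF Rl[OF ij(1)]] by simp
      qed
      ultimately show ?thesis using True by auto
    next
      case False
      have xx: "x i * x j = 1 / (sqrt (dd B i) * sqrt (dd B j))" using ij by (simp add: x_def)
      have pos: "sqrt (dd B i) * sqrt (dd B j) > 0" using d by simp
      have le0: "f i j \<le> 0"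
        using B_nonpos[OF Rl[OF ij(1)] Rl[OF ij(2)]] False pos unfolding f_def xx
        by (intro mult_nonneg_nonpos) auto
      have le1: "f i j \<le> -1" if "B i j \<noteq> 0"
        using B_offdiag_bound[OF Rl[OF ij(1)] Rl[OF ij(2)] False[symmetric] that] pos unfolding f_def xx
        by (simp add: field_simps)
      have "eps i j = - eps j i" using eps(1) Rl[OF ij(1)] Rl[OF ij(2)] by blast
      then have "\<not> (j = s i \<and> i = s j)"
        using s1[OF ij(1)] s1[OF ij(2)] by force
      moreover have "B i j \<noteq> 0" if "j = s i \<or> i = s j"
        using that s[OF ij(1)] s[OF ij(2)] B_sym[OF Rl[OF ij(1)] Rl[OF ij(2)]] by (auto simp: adjacent_def)
      ultimately show ?thesis using le0 le1 False by auto
    qed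
  qed
  moreover have "(\<Sum>i\<in>R. \<Sum>j\<in>R. (if j = i then 2 else 0) - (if j = s i then 1 else 0) - (if i = s j then 1 else (0::real))) = 0"
  proof -
    have "(\<Sum>i\<in>R. \<Sum>j\<in>R. (if i = s j then 1 else (0::real))) = (\<Sum>j\<in>R. \<Sum>i\<in>R. (if i = s j then 1 else 0))"
      by (rule sum.swap)
    also have "\<dots> = (\<Sum>j\<in>R. 1)" by (rule sum.cong) (use fin s in auto)
    finally have 1: "(\<Sum>i\<in>R. \<Sum>j\<in>R. (if i = s j then 1 else (0::real))) = (\<Sum>j\<in>R. 1)" .
    have 2: "(\<Sum>i\<in>R. \<Sum>j\<in>R. (if j = s i then 1 else (0::real))) = (\<Sum>j\<in>R. 1)"
      by (rule sum.cong) (use fin s in auto)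
    have 3: "(\<Sum>i\<in>R. \<Sum>j\<in>R. (if j = i then 2 else (0::real))) = (\<Sum>j\<in>R. 2)"
      by (rule sum.cong) (use fin in auto)
    show ?thesis unfolding sum_subtractf 1 2 3 by simp
  qed
  ultimately show False by linarith
qed

text \<open>A source j of the indices not yet taken is taken next. All arrows between taken and
  untaken indices then point to the untaken ones, so the sign of eps j i is determined by whether i
  was taken, and the relation between nu_i and nu_j becomes the equation in
  \<open>arrow_sorted\<close>.\<close>

lemma arrow_sorted_exists:
  assumes eps: "\<forall>i<l. \<forall>j<l. eps i j = - eps j i" "\<forall>i<l. \<forall>j<l. adjacent B i j \<longrightarrow> eps i j = 1 \<or> eps i j = (-1::int)"
    and nm: "\<And>i j. i < l \<Longrightarrow> j < l \<Longrightarrow> nm i j - nm j i = eps i j * Bm i j"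
    and Bm: "\<And>i j. Bm i j = int N * B i j"
  shows "\<exists>rs. arrow_sorted l Bm nm rs \<and> set rs = {..<l}"
proof -
  have "\<exists>rs. arrow_sorted l Bm nm rs \<and> length rs = m \<and> set rs \<subseteq> {..<l} \<and>
     (\<forall>i\<in>set rs. \<forall>k\<in>{..<l} - set rs. adjacent B i k \<longrightarrow> eps i k = 1)" if "m \<le> l" for m
    using that
  proof (induction m)
    case (Suc m)
    then obtain rs where rs: "arrow_sorted l Bm nm rs" "length rs = m" "set rs \<subseteq> {..<l}"
      "\<And>i k. i \<in> set rs \<Longrightarrow> k < l \<Longrightarrow> k \<notin> set rs \<Longrightarrow> adjacent B i k \<Longrightarrow> eps i k = 1" by auto
    have "card (set rs) < card {..<l}" using rs(2) card_length[of rs] Suc.prems by simp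
    then have "{..<l} - set rs \<noteq> {}" using card_mono[of "set rs" "{..<l}"] by force
    then obtain j where j: "j < l" "j \<notin> set rs" "\<And>i. i < l \<Longrightarrow> i \<notin> set rs \<Longrightarrow> adjacent B j i \<Longrightarrow> eps j i = 1"
      using orientation_source[OF eps, of "{..<l} - set rs"] by auto
    have Bs: "Bm i j = Bm j i" if "i < l" for i using B_sym[OF that j(1)] Bm by simp
    have "nm j i - Bm j i = nm i j - (if i \<in> set rs then 2 * Bm i j else 0)" if i: "i < l" "i \<noteq> j" for i
    proof (cases "B i j = 0")
      case True
      then show ?thesis using nm[OF i(1) j(1)] Bs[OF i(1)] Bm by simp
    next
      case False
      then have a: "adjacent B i j" "adjacent B j i" using i j B_sym by (auto simp: adjacent_def)
      show ?thesis
      proof (cases "i \<in> set rs")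
        case True
        then have "eps i j = 1" using rs(4)[OF True j(1,2)] a by simp
        then show ?thesis using nm[OF i(1) j(1)] Bs[OF i(1)] True by simp
      next
        case False
        then have "eps j i = 1" using j(3)[OF i(1) False] a by simp
        then show ?thesis using nm[OF j(1) i(1)] Bs[OF i(1)] False by simp
      qed
    qed
    then have "arrow_sorted l Bm nm (j # rs)" using rs(1) j by simp
    moreover have "\<forall>i\<in>set (j # rs). \<forall>k\<in>{..<l} - set (j # rs). adjacent B i k \<longrightarrow> eps i k = 1"
      using rs(4) j(3) by auto
    ultimately show ?case using rs(2,3) j(1) by (intro exI[of _ "j # rs"]) simp
  qed (auto intro: exI[of _ "[]"])
  then obtain rs where rs: "arrow_sorted l Bm nm rs" "length rs = l" "set rs \<subseteq> {..<l}" by blast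
  then have "card (set rs) = card {..<l}" using distinct_card[OF arrow_sorted_distinct[OF rs(1)]] by simp
  then have "set rs = {..<l}" using rs(3) by (intro card_subset_eq) auto
  then show ?thesis using rs(1) by blast
qed

end

section \<open>The free algebra\<close>

lemma fmul_add_left: "fmul (x + y) z = fmul x z + fmul y z"
  by (simp add: fmul_def fun_eq_iff fun_ops distrib_right sum.distrib)

lemma fmul_add_right: "fmul z (x + y) = fmul z x + fmul z y"
  by (simp add: fmul_def fun_eq_iff fun_ops distrib_left sum.distrib)

lemma fmul_diff_left: "fmul (x - y) z = fmul x z - fmul y z"
  by (simp add: fmul_def fun_eq_iff fun_ops left_diff_distrib sum_subtractf)

lemma fmul_diff_right: "fmul z (x - y) = fmul z x - fmul z y"
  by (simp add: fmul_def fun_eq_iff fun_ops right_diff_distrib sum_subtractf)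

lemma fmul_zero_left [simp]: "fmul 0 z = 0" and fmul_zero_right [simp]: "fmul z 0 = 0"
  by (simp_all add: fmul_def fun_eq_iff fun_ops)

lemma fmul_fsc_left: "fmul (fsc c x) z = fsc c (fmul x z)"
  by (simp add: fmul_def fsc_def fun_eq_iff sum_distrib_left mult_ac)

lemma fmul_fsc_right: "fmul z (fsc c x) = fsc c (fmul z x)"
  by (simp add: fmul_def fsc_def fun_eq_iff sum_distrib_left mult_ac)

lemma fmul_sum_left: "fmul (sum f S) z = (\<Sum>s\<in>S. fmul (f s) z)"
  by (induction S rule: infinite_finite_induct) (simp_all add: fmul_add_left)

lemma fmul_sum_right: "fmul z (sum f S) = (\<Sum>s\<in>S. fmul z (f s))"
  by (induction S rule: infinite_finite_induct) (simp_all add: fmul_add_right)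

lemma fmul_mono: "fmul (mono u) x = (\<lambda>w. if take (length u) w = u then x (drop (length u) w) else 0)"
proof
  fix w
  have "fmul (mono u) x w = (\<Sum>k\<le>length w. if k = length u then (if take (length u) w = u then x (drop (length u) w) else 0) else 0)"
    unfolding fmul_def by (intro sum.cong refl) (auto simp: mono_def)
  then show "fmul (mono u) x w = (if take (length u) w = u then x (drop (length u) w) else 0)"
    by auto
qed

lemma take_append_iff:
  "take (length u + length v) w = u @ v \<longleftrightarrow> take (length u) w = u \<and> take (length v) (drop (length u) w) = v"
proof (cases "length u \<le> length w")
  case True
  then have "length (take (length u) w) = length u" by simp
  then show ?thesis unfolding take_add by (rule append_eq_append_conv[OF disjI1])
next
  case False
  have n: "take n w \<noteq> y" if "length w < length y" for n and y :: "'a list"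
  proof
    assume "take n w = y"
    then have "length y \<le> length w" by (metis length_take min.cobounded1)
    then show False using that by simp
  qed
  have "take (length u + length v) w \<noteq> u @ v" "take (length u) w \<noteq> u"
    by (rule n, use False in simp)+
  then show ?thesis by blast
qed

lemma fmul_mono_assoc: "fmul (mono u) (fmul (mono w) x) = fmul (mono (u @ w)) x"
proof
  fix z
  show "fmul (mono u) (fmul (mono w) x) z = fmul (mono (u @ w)) x z"
    unfolding fmul_mono length_append take_append_iff by (simp add: add.commute)
qed

lemma fmul_mono_mono [simp]: "fmul (mono u) (mono w) = mono (u @ w)"
proof
  fix z
  show "fmul (mono u) (mono w) z = mono (u @ w) z"
    unfolding fmul_mono using append_eq_conv_conj[of u w z] by (auto simp: mono_def)
qed

lemma fmul_fone_left [simp]: "fmul fone x = x"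
  by (simp add: fone_def fmul_mono)

lemma fsc_uminus: "fsc (- 1) x = - x" and fsc_zero [simp]: "fsc 0 x = 0"
  by (simp_all add: fsc_def fun_eq_iff fun_ops algebra_simps)

lemma fspan_diff: "x \<in> fspan T \<Longrightarrow> y \<in> fspan T \<Longrightarrow> x - y \<in> fspan T"
  using fspan_add[of x T "fsc (-1) y"] fspan_scale[of y T "-1"] by (simp add: fsc_uminus)

definition valid_word :: "nat \<Rightarrow> (nat \<Rightarrow> nat \<Rightarrow> int) \<Rightarrow> letter list \<Rightarrow> bool" where
  "valid_word l B w \<longleftrightarrow> (\<forall>a\<in>set w. valid_letter l B a)"

lemma valid_word_simps [simp]: "valid_word l B []" "valid_word l B (a # w) \<longleftrightarrow> valid_letter l B a \<and> valid_word l B w"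
  "valid_word l B (u @ w) \<longleftrightarrow> valid_word l B u \<and> valid_word l B w"
  by (auto simp: valid_word_def)

lemma Aset_induct [consumes 1, case_names zero mono add scale]:
  assumes "x \<in> Aset l B" "Pr 0" "\<And>w. valid_word l B w \<Longrightarrow> Pr (mono w)"
    "\<And>x y. x \<in> Aset l B \<Longrightarrow> y \<in> Aset l B \<Longrightarrow> Pr x \<Longrightarrow> Pr y \<Longrightarrow> Pr (x + y)" "\<And>c x. x \<in> Aset l B \<Longrightarrow> Pr x \<Longrightarrow> Pr (fsc c x)"
  shows "Pr x"
  using assms(1) unfolding Aset_def
  by (induction rule: fspan.induct) (use assms(2-) in \<open>auto simp: Aset_def valid_word_def\<close>)

lemma Aset_mono [simp]: "valid_word l B w \<Longrightarrow> mono w \<in> Aset l B"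
  by (auto simp: Aset_def valid_word_def intro: fspan_base)

lemma Aset_closed [simp]: "0 \<in> Aset l B" "fone \<in> Aset l B" "x \<in> Aset l B \<Longrightarrow> y \<in> Aset l B \<Longrightarrow> x + y \<in> Aset l B"
  "x \<in> Aset l B \<Longrightarrow> y \<in> Aset l B \<Longrightarrow> x - y \<in> Aset l B" "x \<in> Aset l B \<Longrightarrow> fsc c x \<in> Aset l B"
  using Aset_mono[of l B "[]"] by (auto simp: Aset_def fone_def intro: fspan.intros fspan_diff)

lemma Aset_fmul_mono: "x \<in> Aset l B \<Longrightarrow> valid_word l B u \<Longrightarrow> fmul (mono u) x \<in> Aset l B"
  by (induction rule: Aset_induct) (auto simp: fmul_add_right fmul_fsc_right)

lemma Aset_fmul [simp]: "x \<in> Aset l B \<Longrightarrow> y \<in> Aset l B \<Longrightarrow> fmul x y \<in> Aset l B"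
  by (induction rule: Aset_induct) (auto simp: fmul_add_left fmul_fsc_left Aset_fmul_mono)

definition funscale :: "'k::field \<Rightarrow> ('x \<Rightarrow> 'k) \<Rightarrow> 'x \<Rightarrow> 'k" where
  "funscale c f = (\<lambda>x. c * f x)"

global_interpretation funspace: operator_space funscale
  by standard (simp_all add: funscale_def fun_eq_iff fun_ops algebra_simps)

section \<open>The Verma module without Serre relations\<close>

text \<open>Functions on words in the letters F_i; the word js stands for the vector obtained by applying
  the F_j, j in js, to the highest weight vector. The Serre elements in the E_i act by zero on its
  finitely supported vectors, and those in the F_i generate a submodule without components at powers
  of a single F_i.\<close>
context root_datum
begin

definition Bm :: "nat \<Rightarrow> nat \<Rightarrow> int" where "Bm i j = int N * B i j"
definition dm :: "nat \<Rightarrow> int" where "dm i = int N * dd B i"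

lemma xp_form_alpha: "i < l \<Longrightarrow> j < l \<Longrightarrow> xp (form l B (alpha i) (alpha j)) = Bm i j"
  by (simp add: form_alpha_alpha xp_int Bm_def)

lemma vpow_dd: "vpow tt N (of_int (dd B i)) = tt powi dm i"
  by (simp add: vpow_xp xp_int dm_def)

lemma admr_form_alpha: "inP l B mu \<Longrightarrow> admr (form l B mu (alpha i))"
proof (cases "i < l")
  case False
  have "form l B mu (alpha i) = 0"
    unfolding form_def alpha_def by (intro sum.neutral ballI) (use False in auto)
  then show ?thesis by simp
qed (simp add: admr_form inP_alpha)

end

locale free_verma = root_datum +
  fixes tt :: K and lam :: wt
  assumes tt: "generic_q tt" and lam: "inP l B lam"
begin

lemma tt0: "tt \<noteq> 0" and powi_add: "tt powi (m + n) = tt powi m * tt powi n"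
  using tt by (auto simp: generic_q_def power_int_add)

definition ew :: "wt \<Rightarrow> nat list \<Rightarrow> int" where
  "ew mu js = xp (form l B mu lam) - (\<Sum>j\<leftarrow>js. xp (form l B mu (alpha j)))"

definition opK :: "wt \<Rightarrow> (nat list \<Rightarrow> K) \<Rightarrow> nat list \<Rightarrow> K" where
  "opK mu f js = tt powi ew mu js * f js"

definition opF :: "nat \<Rightarrow> (nat list \<Rightarrow> K) \<Rightarrow> nat list \<Rightarrow> K" where
  "opF i f js = (case js of [] \<Rightarrow> 0 | k # ks \<Rightarrow> if k = i then f ks else 0)"

definition qd :: "nat \<Rightarrow> K" where "qd i = inverse (tt powi dm i - inverse (tt powi dm i))"

text \<open>E_i deletes one letter i from a word in all possible ways; commuting E_i up to the
  deleted F_i leaves (K_i - K_i^(-1))/(v_i - v_i^(-1)) acting on the letters behind it. On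
  coefficient functions deletion becomes insertion, and the letters behind are
  \<open>drop a js\<close>.\<close>

definition opE :: "nat \<Rightarrow> (nat list \<Rightarrow> K) \<Rightarrow> nat list \<Rightarrow> K" where
  "opE i f js = (\<Sum>a\<le>length js. qd i * (tt powi ew (alpha i) (drop a js) - tt powi ew (- alpha i) (drop a js)) *
     f (take a js @ i # drop a js))"

lemma linear_ops: "funspace.linear_op (opK mu)" "funspace.linear_op (opF i)" "funspace.linear_op (opE i)"
  unfolding funspace.linear_op_def
  by (auto simp: opK_def opF_def opE_def fun_eq_iff fun_ops funscale_def algebra_simps sum.distrib sum_distrib_left sum_subtractf split: list.splits)

lemmas opK_lin = funspace.linear_opD[OF linear_ops(1)]
lemmas opF_lin = funspace.linear_opD[OF linear_ops(2)]
lemmas opE_lin = funspace.linear_opD[OF linear_ops(3)]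

lemma ew_add: "inP l B mu \<Longrightarrow> inP l B mu' \<Longrightarrow> ew (mu + mu') js = ew mu js + ew mu' js"
  by (induction js) (auto simp: ew_def form_add_left xp_add admr_form lam admr_form_alpha)

lemma ew_insert: "ew mu (us @ i # ws) = ew mu (us @ ws) - xp (form l B mu (alpha i))"
  by (simp add: ew_def)

lemma opK_add: "inP l B mu \<Longrightarrow> inP l B mu' \<Longrightarrow> opK mu (opK mu' f) = opK (mu + mu') f"
  by (simp add: opK_def fun_eq_iff ew_add powi_add mult_ac)

lemma opK_0: "opK 0 f = f"
proof -
  have "ew 0 js = 0" for js by (induction js) (simp_all add: ew_def)
  then show ?thesis by (simp add: opK_def fun_eq_iff)
qed

lemma opK_opE: "opK mu (opE i f) = funscale (tt powi xp (form l B mu (alpha i))) (opE i (opK mu f))"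
proof
  fix js
  have "tt powi ew mu js = tt powi xp (form l B mu (alpha i)) * tt powi ew mu (take a js @ i # drop a js)" for a
    unfolding ew_insert by (simp flip: powi_add)
  then show "opK mu (opE i f) js = funscale (tt powi xp (form l B mu (alpha i))) (opE i (opK mu f)) js"
    unfolding opK_def opE_def funscale_def sum_distrib_left by (intro sum.cong refl) (simp add: mult_ac)
qed

lemma opK_opF: "opK mu (opF i f) = funscale (tt powi (- xp (form l B mu (alpha i)))) (opF i (opK mu f))"
proof
  fix js
  show "opK mu (opF i f) js = funscale (tt powi (- xp (form l B mu (alpha i)))) (opF i (opK mu f)) js"
  proof (cases js)
    case (Cons k ks)
    have "tt powi ew mu (i # ks) = tt powi (- xp (form l B mu (alpha i))) * tt powi ew mu ks"
      using ew_insert[of mu "[]" i ks] by (simp flip: powi_add)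
    then show ?thesis using Cons by (simp add: opK_def opF_def funscale_def)
  qed (simp add: opK_def opF_def funscale_def)
qed

lemma opE_opF:
  "opE i (opF j f) = opF j (opE i f) + (if i = j then funscale (qd i) (opK (alpha i) f - opK (- alpha i) f) else 0)"
proof
  fix js
  show "opE i (opF j f) js = (opF j (opE i f) + (if i = j then funscale (qd i) (opK (alpha i) f - opK (- alpha i) f) else 0)) js"
  proof (cases js)
    case Nil
    then show ?thesis by (simp add: opE_def opF_def opK_def funscale_def fun_ops algebra_simps)
  next
    case (Cons k ks)
    have "opE i (opF j f) js = qd i * (tt powi ew (alpha i) js - tt powi ew (- alpha i) js) * (if i = j then f js else 0) +
       (\<Sum>a\<le>length ks. qd i * (tt powi ew (alpha i) (drop a ks) - tt powi ew (- alpha i) (drop a ks)) * (if k = j then f (take a ks @ i # drop a ks) else 0))"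
      unfolding opE_def Cons length_Cons sum.atMost_Suc_shift by (simp add: opF_def)
    then show ?thesis using Cons by (cases "k = j") (auto simp: opE_def opF_def opK_def funscale_def fun_ops algebra_simps)
  qed
qed

definition dvec :: "nat list \<Rightarrow> K" where "dvec js = (if js = [] then 1 else 0)"

lemma opE_dvec: "opE i dvec = 0"
  by (simp add: opE_def dvec_def fun_eq_iff fun_ops)

lemma opK_dvec: "opK mu dvec = funscale (tt powi xp (form l B mu lam)) dvec"
  by (auto simp: opK_def dvec_def fun_eq_iff funscale_def ew_def)

inductive_set wordspan :: "(nat list \<Rightarrow> K) set" where
  ws_zero: "0 \<in> wordspan"
| ws_dvec: "dvec \<in> wordspan"
| ws_F: "x \<in> wordspan \<Longrightarrow> i < l \<Longrightarrow> opF i x \<in> wordspan"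
| ws_add: "x \<in> wordspan \<Longrightarrow> y \<in> wordspan \<Longrightarrow> x + y \<in> wordspan"
| ws_scale: "x \<in> wordspan \<Longrightarrow> funscale c x \<in> wordspan"

lemma ws_diff: "x \<in> wordspan \<Longrightarrow> y \<in> wordspan \<Longrightarrow> x - y \<in> wordspan"
  using ws_add[of x "funscale (-1) y"] ws_scale[of y "-1"] by simp

lemma wordspan_K: "x \<in> wordspan \<Longrightarrow> opK mu x \<in> wordspan"
  by (induction rule: wordspan.induct) (auto simp: opK_lin opK_opF opK_dvec intro: wordspan.intros)

lemma wordspan_E: "x \<in> wordspan \<Longrightarrow> opE i x \<in> wordspan"
  by (induction rule: wordspan.induct)
     (auto simp: opE_lin opE_opF opE_dvec intro!: wordspan.intros ws_diff wordspan_K)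

section \<open>The Serre elements acting on functions of words\<close>

definition snum :: "nat \<Rightarrow> nat \<Rightarrow> nat" where "snum i j = nat (1 - cartan B i j)"

lemma snum: "i < l \<Longrightarrow> j < l \<Longrightarrow> i \<noteq> j \<Longrightarrow> snum i j > 0"
  "i < l \<Longrightarrow> j < l \<Longrightarrow> i \<noteq> j \<Longrightarrow> Bm i j = dm i * (1 - int (snum i j))"
  using cartan_nonpos[of i j] B_cartan[of i j] by (auto simp: snum_def Bm_def dm_def)

lemma generic_vi: "i < l \<Longrightarrow> generic_q (tt powi dm i)"
  by (rule generic_q_powi[OF tt]) (use dd_pos[of i] N_pos in \<open>auto simp: dm_def\<close>)

lemma vi_powi: "(tt powi dm i) powi m = tt powi (dm i * m)"
  by (simp add: power_int_mult)

lemma Bm_sym: "i < l \<Longrightarrow> j < l \<Longrightarrow> Bm i j = Bm j i"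
  by (simp add: Bm_def B_sym)

lemma Bm_diag: "i < l \<Longrightarrow> Bm i i = 2 * dm i"
  by (simp add: Bm_def dm_def B_even)

lemma xp_minus_alpha: "i < l \<Longrightarrow> j < l \<Longrightarrow> xp (form l B (- alpha i) (alpha j)) = - Bm i j"
  using xp_minus[of "form l B (alpha i) (alpha j)"] by (simp add: form_uminus_left form_alpha_alpha xp_int Bm_def)

abbreviation qserre :: "nat \<Rightarrow> nat \<Rightarrow> ((nat list \<Rightarrow> K) \<Rightarrow> nat list \<Rightarrow> K) \<Rightarrow> ((nat list \<Rightarrow> K) \<Rightarrow> nat list \<Rightarrow> K) \<Rightarrow> (nat list \<Rightarrow> K) \<Rightarrow> nat list \<Rightarrow> K" where
  "qserre i j \<equiv> funspace.serre_op (serre_coeff (tt powi dm i) (snum i j)) (snum i j)"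
abbreviation serreF :: "nat \<Rightarrow> nat \<Rightarrow> (nat list \<Rightarrow> K) \<Rightarrow> nat list \<Rightarrow> K" where
  "serreF i j \<equiv> qserre i j (opF i) (opF j)"
abbreviation serreE :: "nat \<Rightarrow> nat \<Rightarrow> (nat list \<Rightarrow> K) \<Rightarrow> nat list \<Rightarrow> K" where
  "serreE i j \<equiv> qserre i j (opE i) (opE j)"

text \<open>One statement for both families: (X, Y) is (F, E) or (E, F), with K_i and its inverse
  exchanged. The cases k = i, k = j and k distinct from both are the three commutation lemmas
  above.\<close>

lemma serre_op_commute:
  assumes lin: "\<And>i. funspace.linear_op (X i)" "\<And>i. funspace.linear_op (Y i)"
    and YX: "\<And>i j x. i < l \<Longrightarrow> j < l \<Longrightarrow> Y i (X j x) = X j (Y i x) + (if i = j then funscale (s i) (H i x - H' i x) else 0)"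
    and HX: "\<And>i j x. i < l \<Longrightarrow> j < l \<Longrightarrow> H i (X j x) = funscale (tt powi Bm i j) (X j (H i x))"
    and H'X: "\<And>i j x. i < l \<Longrightarrow> j < l \<Longrightarrow> H' i (X j x) = funscale (tt powi (- Bm i j)) (X j (H' i x))"
    and ij: "i < l" "j < l" "i \<noteq> j" and k: "k < l"
  shows "Y k (qserre i j (X i) (X j) x) =
    qserre i j (X i) (X j) (Y k x)"
proof -
  have os: "operator_space (funscale :: K \<Rightarrow> _)" by unfold_locales
  have B: "Bm i j = dm i * (1 - int (snum i j))" "Bm i i = dm i * 2"
    using snum(2)[OF ij] Bm_diag[OF ij(1)] by simp_all
  consider "k = i" | "k = j" | "k \<noteq> i" "k \<noteq> j" by blast
  then show ?thesis
  proof cases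
    case 1
    show ?thesis unfolding 1
      by (rule serre_op_commute_first[OF os lin(1) lin(1) lin(2) generic_vi[OF ij(1)] snum(1)[OF ij], where s = "s i" and H = "H i" and H' = "H' i"])
        (use ij ij(3)[symmetric] in \<open>simp_all only: YX HX H'X B vi_powi if_False if_True refl add_0_right minus_mult_right minus_diff_eq\<close>)
  next
    case 2
    have B': "Bm j i = Bm i j" by (rule Bm_sym[OF ij(2,1)])
    show ?thesis unfolding 2
      by (rule serre_op_commute_last[OF os lin(1) lin(1) lin(2) generic_vi[OF ij(1)] snum(1)[OF ij], where s = "s j" and H = "H j" and H' = "H' j"])
        (use ij ij(3)[symmetric] in \<open>simp_all only: YX HX H'X B' B vi_powi if_False if_True refl add_0_right minus_mult_right minus_diff_eq\<close>)
  next
    case 3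
    then show ?thesis
      by (intro funspace.serre_op_commute_other lin) (simp_all add: YX ij k)
  qed
qed

lemma opE_serreF:
  assumes "i < l" "j < l" "i \<noteq> j" "k < l"
  shows "opE k (serreF i j x) = serreF i j (opE k x)"
  by (rule serre_op_commute[where s = "\<lambda>i. - qd i" and H = "\<lambda>i. opK (- alpha i)" and H' = "\<lambda>i. opK (alpha i)", OF linear_ops(2,3) _ _ _ assms])
    (simp_all add: opE_opF opK_opF xp_minus_alpha xp_form_alpha, (simp add: funscale_def fun_eq_iff fun_ops algebra_simps)?)

lemma opF_serreE:
  assumes "i < l" "j < l" "i \<noteq> j" "k < l"
  shows "opF k (serreE i j x) = serreE i j (opF k x)"
  by (rule serre_op_commute[where s = "\<lambda>i. - qd i" and H = "\<lambda>i. opK (alpha i)" and H' = "\<lambda>i. opK (- alpha i)", OF linear_ops(3,2) _ _ _ assms])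
    (simp_all add: opE_opF opK_opE xp_minus_alpha xp_form_alpha, (simp add: funscale_def fun_eq_iff fun_ops algebra_simps)?)

lemma serre_op_lin:
  assumes "funspace.linear_op X" "funspace.linear_op X'"
  shows "funspace.linear_op (funspace.serre_op c n X X')"
  unfolding funspace.serre_op_def funspace.linear_op_def
  by (simp add: funspace.linear_opD[OF assms(1)] funspace.linear_opD[OF assms(2)] funspace.linear_opD[OF funspace.linear_op_funpow[OF assms(1)]]
      funspace.scale_right_distrib sum.distrib funspace.scale_sum_right mult.commute)

text \<open>The operator commutes with every F_k, so it suffices to look at the highest weight
  vector, which the rightmost E of each term kills.\<close>

lemma serreE_wordspan:
  assumes "i < l" "j < l" "i \<noteq> j"
  shows "x \<in> wordspan \<Longrightarrow> serreE i j x = 0"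
proof (induction rule: wordspan.induct)
  case ws_dvec
  have "(opE i ^^ r) dvec = (if r = 0 then dvec else 0)" for r
    by (induction r) (simp_all add: opE_dvec opE_lin)
  then have "(opE i ^^ (n - r)) (opE j ((opE i ^^ r) dvec)) = 0" for n r
    by (simp add: opE_dvec opE_lin funspace.linear_opD[OF funspace.linear_op_funpow[OF linear_ops(3)]])
  then show ?case by (simp add: funspace.serre_op_def)
qed (use assms in \<open>simp_all add: funspace.linear_opD[OF serre_op_lin[OF linear_ops(3) linear_ops(3)]] opF_serreE[symmetric] opF_lin\<close>)

text \<open>Only stability under the F_i is built in. Letters to the right of a Serre element are
  covered by allowing any x, and stability under K_mu and E_k follows since the Serre operators are
  rescaled by K_mu and commute with E_k.\<close>

inductive_set serre_ideal :: "(nat list \<Rightarrow> K) set" where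
  si_zero: "0 \<in> serre_ideal"
| si_serre: "i < l \<Longrightarrow> j < l \<Longrightarrow> i \<noteq> j \<Longrightarrow> serreF i j x \<in> serre_ideal"
| si_F: "x \<in> serre_ideal \<Longrightarrow> i < l \<Longrightarrow> opF i x \<in> serre_ideal"
| si_add: "x \<in> serre_ideal \<Longrightarrow> y \<in> serre_ideal \<Longrightarrow> x + y \<in> serre_ideal"
| si_scale: "x \<in> serre_ideal \<Longrightarrow> funscale c x \<in> serre_ideal"

lemma si_diff: "x \<in> serre_ideal \<Longrightarrow> y \<in> serre_ideal \<Longrightarrow> x - y \<in> serre_ideal"
  using si_add[of x "funscale (-1) y"] si_scale[of y "-1"] by simp

lemma opK_serreF:
  "opK mu (serreF i j x) = funscale ((tt powi (- xp (form l B mu (alpha i)))) ^ snum i j * tt powi (- xp (form l B mu (alpha j)))) (serreF i j (opK mu x))"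
proof -
  let ?a = "tt powi (- xp (form l B mu (alpha i)))" and ?b = "tt powi (- xp (form l B mu (alpha j)))"
  have Kp: "opK mu ((opF i ^^ r) y) = funscale (?a ^ r) ((opF i ^^ r) (opK mu y))" for r y
    by (rule funspace.funpow_commute[OF linear_ops(2)]) (rule opK_opF)
  note lin = opF_lin opK_lin funspace.linear_opD[OF funspace.linear_op_funpow[OF linear_ops(2)]]
  have "opK mu (serreF i j x) = (\<Sum>r\<le>snum i j. funscale (serre_coeff (tt powi dm i) (snum i j) r) (opK mu ((opF i ^^ (snum i j - r)) (opF j ((opF i ^^ r) x)))))"
    unfolding funspace.serre_op_def opK_lin ..
  also have "\<dots> = (\<Sum>r\<le>snum i j. funscale (?a ^ snum i j * ?b) (funscale (serre_coeff (tt powi dm i) (snum i j) r) ((opF i ^^ (snum i j - r)) (opF j ((opF i ^^ r) (opK mu x))))))"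
  proof (intro sum.cong refl)
    fix r assume r: "r \<in> {..snum i j}"
    have a: "?a ^ (snum i j - r) * ?a ^ r = ?a ^ snum i j" using r by (simp flip: power_add)
    show "funscale (serre_coeff (tt powi dm i) (snum i j) r) (opK mu ((opF i ^^ (snum i j - r)) (opF j ((opF i ^^ r) x)))) =
      funscale (?a ^ snum i j * ?b) (funscale (serre_coeff (tt powi dm i) (snum i j) r) ((opF i ^^ (snum i j - r)) (opF j ((opF i ^^ r) (opK mu x)))))"
      unfolding Kp opK_opF lin funspace.scale_scale a[symmetric] by (simp only: mult_ac)
  qed
  also have "\<dots> = funscale (?a ^ snum i j * ?b) (serreF i j (opK mu x))"
    unfolding funspace.serre_op_def funspace.scale_sum_right ..
  finally show ?thesis .
qed

lemma serre_ideal_K: "x \<in> serre_ideal \<Longrightarrow> opK mu x \<in> serre_ideal"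
  by (induction rule: serre_ideal.induct) (auto simp: opK_lin opK_opF opK_serreF intro: serre_ideal.intros)

lemma serre_ideal_E: "x \<in> serre_ideal \<Longrightarrow> k < l \<Longrightarrow> opE k x \<in> serre_ideal"
proof (induction rule: serre_ideal.induct)
  case (si_serre i j x)
  then show ?case by (subst opE_serreF) (auto intro: serre_ideal.si_serre)
qed (auto simp: opE_lin opE_opF intro!: serre_ideal.intros si_diff serre_ideal_K)

lemma opFp_eval: "(opF i ^^ n) f js = (if take n js = replicate n i then f (drop n js) else 0)"
proof (induction n arbitrary: js)
  case (Suc n)
  then show ?case by (cases js) (auto simp: opF_def)
qed simp

text \<open>As n > 0, both letters i and j occur in every term of the Serre element, hence in every
  word on which it can be nonzero.\<close>

lemma serreF_eval:
  assumes "set js \<subseteq> {k}" "i < l" "j < l" "i \<noteq> j"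
  shows "serreF i j x js = 0"
proof -
  let ?n = "snum i j"
  have "(opF i ^^ (?n - r)) (opF j ((opF i ^^ r) x)) js = 0" if r: "r \<le> ?n" for r
  proof (rule ccontr)
    assume a: "(opF i ^^ (?n - r)) (opF j ((opF i ^^ r) x)) js \<noteq> 0"
    then have 1: "take (?n - r) js = replicate (?n - r) i" and 2: "opF j ((opF i ^^ r) x) (drop (?n - r) js) \<noteq> 0"
      by (auto simp: opFp_eval split: if_splits)
    from 2 obtain ks where 3: "drop (?n - r) js = j # ks" "(opF i ^^ r) x ks \<noteq> 0"
      by (auto simp: opF_def split: list.splits if_splits)
    then have 4: "take r ks = replicate r i" by (auto simp: opFp_eval split: if_splits)
    have "j \<in> set js" using 3(1) by (metis in_set_dropD list.set_intros(1))
    moreover have "i \<in> set js"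
    proof (cases "r = ?n")
      case True
      then have "i \<in> set (take r ks)" using 4 snum(1)[OF assms(2-4)] by simp
      then have "i \<in> set (drop (?n - r) js)" using 3(1) by (auto dest: in_set_takeD)
      then show ?thesis by (rule in_set_dropD)
    next
      case False
      then have "i \<in> set (take (?n - r) js)" using 1 r by simp
      then show ?thesis by (rule in_set_takeD)
    qed
    ultimately show False using assms by auto
  qed
  moreover have "sum f S js = (\<Sum>s\<in>S. f s js)" for f :: "nat \<Rightarrow> nat list \<Rightarrow> K" and S
    by (induction S rule: infinite_finite_induct) (simp_all add: fun_ops)
  ultimately show ?thesis by (simp add: funspace.serre_op_def funscale_def)
qed

lemma serre_ideal_eval: "x \<in> serre_ideal \<Longrightarrow> set js \<subseteq> {k} \<Longrightarrow> x js = 0"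
proof (induction arbitrary: js rule: serre_ideal.induct)
  case (si_F x i)
  then show ?case by (cases js) (auto simp: opF_def)
qed (auto simp: fun_ops funscale_def serreF_eval)

section \<open>Evaluating the free algebra on the highest weight vector of the model\<close>

fun op1 :: "letter \<Rightarrow> (nat list \<Rightarrow> K) \<Rightarrow> nat list \<Rightarrow> K" where
  "op1 (LE i) = opE i" | "op1 (LF i) = opF i" | "op1 (LK mu) = opK mu"

definition opw :: "letter list \<Rightarrow> (nat list \<Rightarrow> K) \<Rightarrow> nat list \<Rightarrow> K" where
  "opw w = foldr op1 w"

lemma opw_simps [simp]: "opw [] f = f" "opw (a # w) f = op1 a (opw w f)" "opw (u @ w) f = opw u (opw w f)"
  by (simp_all add: opw_def)

lemma opw_linear: "funspace.linear_op (opw w)"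
proof (induction w)
  case Nil
  show ?case by (simp add: funspace.linear_op_def)
next
  case (Cons a w)
  then show ?case by (cases a) (auto simp: funspace.linear_op_def opE_lin opF_lin opK_lin)
qed

lemmas opw_lin = funspace.linear_opD[OF opw_linear]

lemma opw_wordspan: "valid_word l B w \<Longrightarrow> x \<in> wordspan \<Longrightarrow> opw w x \<in> wordspan"
proof (induction w)
  case (Cons a w)
  then show ?case by (cases a) (auto intro: wordspan_E wordspan_K ws_F)
qed simp

lemma opw_serre_ideal: "valid_word l B w \<Longrightarrow> x \<in> serre_ideal \<Longrightarrow> opw w x \<in> serre_ideal"
proof (induction w)
  case (Cons a w)
  then show ?case by (cases a) (auto intro: serre_ideal_E serre_ideal_K si_F)
qed simp

text \<open>On an element of infinite support the sum has the default value 0, so additivity needs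
  \<open>fsup\<close>; this is why finiteness is proved along with the value in
  \<open>ev_rels\<close> and \<open>ev_Iv\<close>.\<close>

definition ev :: "fa \<Rightarrow> nat list \<Rightarrow> K" where
  "ev x = (\<Sum>w\<in>{w. x w \<noteq> 0}. funscale (x w) (opw w dvec))"

definition fsup :: "fa \<Rightarrow> bool" where "fsup x \<longleftrightarrow> finite {w. x w \<noteq> 0}"

lemma ev_superset: "finite S \<Longrightarrow> {w. x w \<noteq> 0} \<subseteq> S \<Longrightarrow> ev x = (\<Sum>w\<in>S. funscale (x w) (opw w dvec))"
  unfolding ev_def by (rule sum.mono_neutral_left) auto

lemma ev_add: "fsup x \<Longrightarrow> fsup y \<Longrightarrow> ev (x + y) = ev x + ev y" "fsup x \<Longrightarrow> fsup y \<Longrightarrow> fsup (x + y)"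
proof -
  assume f: "fsup x" "fsup y"
  let ?S = "{w. x w \<noteq> 0} \<union> {w. y w \<noteq> 0}"
  have S: "finite ?S" "{w. (x + y) w \<noteq> 0} \<subseteq> ?S" using f by (auto simp: fsup_def fun_ops)
  then show "fsup (x + y)" unfolding fsup_def by (rule finite_subset[rotated])
  show "ev (x + y) = ev x + ev y"
    by (subst (1 2 3) ev_superset[of ?S]) (use S in \<open>auto simp: fun_ops funspace.scale_left_distrib sum.distrib\<close>)
qed

lemma ev_fsc: "fsup x \<Longrightarrow> ev (fsc c x) = funscale c (ev x)" "fsup x \<Longrightarrow> fsup (fsc c x)"
proof -
  assume f: "fsup x"
  let ?S = "{w. x w \<noteq> 0}"
  have S: "finite ?S" "{w. fsc c x w \<noteq> 0} \<subseteq> ?S" using f by (auto simp: fsup_def fsc_def)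
  then show "fsup (fsc c x)" unfolding fsup_def by (rule finite_subset[rotated])
  show "ev (fsc c x) = funscale c (ev x)"
    by (subst (1 2) ev_superset[of ?S]) (use S in \<open>auto simp: fsc_def funspace.scale_sum_right\<close>)
qed

lemma ev_diff: "fsup x \<Longrightarrow> fsup y \<Longrightarrow> ev (x - y) = ev x - ev y" "fsup x \<Longrightarrow> fsup y \<Longrightarrow> fsup (x - y)"
  using ev_add[of x "fsc (-1) y"] ev_fsc[of y "-1"] by (simp_all add: fsc_uminus)

lemma ev_mono [simp]: "ev (mono w) = opw w dvec" "fsup (mono w)"
proof -
  have "{u. mono w u \<noteq> 0} = {w}" by (auto simp: mono_def)
  then show "ev (mono w) = opw w dvec" "fsup (mono w)" by (simp_all add: ev_def fsup_def mono_def)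
qed

lemma ev_zero [simp]: "ev 0 = 0" "fsup 0"
  by (simp_all add: ev_def fsup_def fun_ops)

lemma ev_sum: "(\<And>s. s \<in> S \<Longrightarrow> fsup (f s)) \<Longrightarrow> ev (sum f S) = (\<Sum>s\<in>S. ev (f s)) \<and> fsup (sum f S)"
  by (induction S rule: infinite_finite_induct) (auto simp: ev_add)

lemmas ev_simps = ev_add ev_diff ev_fsc

lemma opw_replicate: "opw (replicate n a) f = (op1 a ^^ n) f"
  by (induction n) simp_all

lemma ev_serre:
  assumes "X = LE \<or> X = LF"
  shows "ev (fmul (fmul (mono u) (serre l B N tt X i j)) (mono w)) =
    opw u (qserre i j (op1 (X i)) (op1 (X j)) (opw w dvec))"
    and "fsup (fmul (fmul (mono u) (serre l B N tt X i j)) (mono w))"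
proof -
  let ?t = "\<lambda>r. fsc (serre_coeff (tt powi dm i) (snum i j) r) (mono (u @ (replicate (snum i j - r) (X i) @ [X j] @ replicate r (X i)) @ w))"
  have e: "fmul (fmul (mono u) (serre l B N tt X i j)) (mono w) = (\<Sum>r\<le>snum i j. ?t r)"
    unfolding serre_def Let_def fmul_sum_right fmul_sum_left fmul_fsc_right fmul_fsc_left fmul_mono_mono vpow_dd snum_def[symmetric] serre_coeff_def
    by simp
  show "fsup (fmul (fmul (mono u) (serre l B N tt X i j)) (mono w))"
    unfolding e using ev_sum[of "{..snum i j}" ?t] by (simp add: ev_simps)
  have "ev (\<Sum>r\<le>snum i j. ?t r) = (\<Sum>r\<le>snum i j. ev (?t r))"
    using ev_sum[of "{..snum i j}" ?t] by (simp add: ev_simps)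
  also have "\<dots> = opw u (qserre i j (op1 (X i)) (op1 (X j)) (opw w dvec))"
    unfolding funspace.serre_op_def opw_lin by (intro sum.cong refl) (simp add: ev_simps opw_replicate)
  finally show "ev (fmul (fmul (mono u) (serre l B N tt X i j)) (mono w)) = \<dots>" unfolding e .
qed

lemma ev_rels:
  assumes "valid_word l B u" "valid_word l B w" "r \<in> rels l B N tt"
  shows "ev (fmul (fmul (mono u) r) (mono w)) \<in> serre_ideal \<and> fsup (fmul (fmul (mono u) r) (mono w))"
proof -
  note S = fmul_diff_left fmul_diff_right fmul_fsc_left fmul_fsc_right ev_simps opw_lin opK_add vpow_xp si_zero
  have z: "opw u 0 = 0" by (rule opw_lin)
  from assms(3) show ?thesis unfolding rels_def
  proof (elim UnE CollectE exE conjE)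
    fix mu mu' assume "r = mono [LK mu, LK mu'] - mono [LK (mu + mu')]" "inP l B mu" "inP l B mu'"
    then show ?thesis by (simp add: S)
  next
    assume "r \<in> {mono [LK 0] - fone}"
    then show ?thesis by (simp add: S fone_def opK_0)
  next
    fix mu i assume "r = mono [LK mu, LE i] - fsc (vpow tt N (form l B mu (alpha i))) (mono [LE i, LK mu])"
    then show ?thesis by (simp add: S opK_opE)
  next
    fix mu i assume "r = mono [LK mu, LF i] - fsc (vpow tt N (- form l B mu (alpha i))) (mono [LF i, LK mu])" "inP l B mu"
    then show ?thesis using xp_minus[OF admr_form_alpha] by (simp add: S opK_opF)
  next
    fix i j assume r: "r = mono [LE i, LF j] - mono [LF j, LE i]
        - (if i = j then fsc (inverse (vpow tt N (of_int (dd B i)) - inverse (vpow tt N (of_int (dd B i)))))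
                             (mono [LK (alpha i)] - mono [LK (- alpha i)]) else 0)" "i < l" "j < l"
    show ?thesis
    proof (cases "i = j")
      case True
      have "ev (fmul (fmul (mono u) r) (mono w)) = opw u (opE i (opF i (opw w dvec))) - opw u (opF i (opE i (opw w dvec))) -
         funscale (qd i) (opw u (opK (alpha i) (opw w dvec)) - opw u (opK (- alpha i) (opw w dvec)))"
        using r(1) True unfolding vpow_dd by (simp add: S qd_def)
      also have "\<dots> = 0" by (simp add: opE_opF opw_lin)
      finally show ?thesis using r(1) True si_zero by (simp add: S)
    next
      case False
      then show ?thesis using r(1) by (simp add: S opE_opF)
    qed
  next
    fix i j assume r: "r = serre l B N tt LE i j" "i < l" "j < l" "i \<noteq> j"
    have "serreE i j (opw w dvec) = 0"
      by (rule serreE_wordspan[OF r(2-4) opw_wordspan[OF assms(2) ws_dvec]])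
    then show ?thesis using ev_serre[of LE u i j w] si_zero z by (simp add: r(1))
  next
    fix i j assume r: "r = serre l B N tt LF i j" "i < l" "j < l" "i \<noteq> j"
    show ?thesis using ev_serre[of LF u i j w] opw_serre_ideal[OF assms(1) si_serre[OF r(2-4)]] by (simp add: r(1))
  qed
qed

lemma ev_Iv: "x \<in> Iv l B N tt lam \<Longrightarrow> ev x \<in> serre_ideal \<and> fsup x"
  unfolding Iv_def
proof (induction rule: fspan.induct)
  case (fspan_base x)
  then show ?case
  proof (elim UnE CollectE exE conjE)
    fix u r w assume "x = fmul (fmul (mono u) r) (mono w)" "\<forall>a\<in>set u. valid_letter l B a" "\<forall>a\<in>set w. valid_letter l B a" "r \<in> rels l B N tt"
    then show ?thesis using ev_rels[of u w r] by (simp add: valid_word_def)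
  next
    fix u i assume "x = fmul (mono u) (mono [LE i])"
    then show ?thesis by (simp add: opE_dvec opw_lin si_zero)
  next
    fix u mu assume "x = fmul (mono u) (mono [LK mu] - fsc (vpow tt N (form l B mu lam)) fone)"
    then show ?thesis by (simp add: fone_def fmul_diff_right fmul_fsc_right ev_simps opK_dvec opw_lin vpow_xp si_zero)
  qed
qed (auto simp: ev_simps intro: serre_ideal.intros)

text \<open>In the model F_i^n has coefficient 1 at the word consisting of n letters i, while
  everything coming from \<open>Iv\<close> vanishes at words in a single letter.\<close>

theorem power_not_in_Iv: "mono (replicate n (LF i)) \<notin> Iv l B N tt lam"
proof
  assume "mono (replicate n (LF i)) \<in> Iv l B N tt lam"
  then have "(opF i ^^ n) dvec \<in> serre_ideal" using ev_Iv by (fastforce simp: opw_replicate)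
  then have "(opF i ^^ n) dvec (replicate n i) = 0" by (rule serre_ideal_eval[where k = i]) auto
  then show False by (simp add: opFp_eval dvec_def)
qed

end

section \<open>The Verma module with its pairing\<close>

lemma swl_swl [simp]: "swl (swl a) = a"
  by (cases a) simp_all

lemma sigma_mono: "sigma (mono w) = mono (rev (map swl w))"
proof -
  have inv: "map swl (map swl u) = u" for u by (simp add: map_idI)
  have "(rev (map swl u) = w) = (u = rev (map swl w))" for u
    by (metis inv rev_map rev_rev_ident)
  then show ?thesis by (auto simp: sigma_def mono_def fun_eq_iff)
qed

lemma sigma_add: "sigma (x + y) = sigma x + sigma y" and sigma_fsc: "sigma (fsc c x) = fsc c (sigma x)"
  and sigma_zero: "sigma 0 = 0"
  by (simp_all add: sigma_def fsc_def fun_eq_iff fun_ops)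

lemma sigma_sigma [simp]: "sigma (sigma x) = x"
proof -
  have "map swl (map swl u) = u" for u by (simp add: map_idI)
  then show ?thesis by (simp add: sigma_def fun_eq_iff rev_map)
qed

text \<open>Formulated over an arbitrary generic \<open>tt\<close>, so that \<open>dual\<close> can
  exchange the two Verma modules and each result serves both of them.\<close>

locale verma_pairing = free_verma +
  fixes P :: "fa \<Rightarrow> fa \<Rightarrow> K"
  assumes P_add_left: "x \<in> Aset l B \<Longrightarrow> y \<in> Aset l B \<Longrightarrow> z \<in> Aset l B \<Longrightarrow> P (x + y) z = P x z + P y z"
    and P_add_right: "x \<in> Aset l B \<Longrightarrow> y \<in> Aset l B \<Longrightarrow> z \<in> Aset l B \<Longrightarrow> P z (x + y) = P z x + P z y"
    and P_scale_left: "x \<in> Aset l B \<Longrightarrow> y \<in> Aset l B \<Longrightarrow> P (fsc c x) y = c * P x y"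
    and P_scale_right: "x \<in> Aset l B \<Longrightarrow> y \<in> Aset l B \<Longrightarrow> P x (fsc c y) = c * P x y"
    and P_Iv_left: "x \<in> Iv l B N tt lam \<Longrightarrow> y \<in> Aset l B \<Longrightarrow> P x y = 0"
    and P_Iv_right: "x \<in> Aset l B \<Longrightarrow> y \<in> Iv l B N (inverse tt) lam \<Longrightarrow> P x y = 0"
    and P_one: "P fone fone = 1"
    and P_adj: "x \<in> Aset l B \<Longrightarrow> w \<in> Aset l B \<Longrightarrow> w' \<in> Aset l B \<Longrightarrow> P (fmul x w) w' = P w (fmul (sigma x) w')"
    and P_nondeg_left: "w \<in> Aset l B \<Longrightarrow> (\<And>w'. w' \<in> Aset l B \<Longrightarrow> P w w' = 0) \<Longrightarrow> w \<in> Iv l B N tt lam"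
    and P_nondeg_right: "w' \<in> Aset l B \<Longrightarrow> (\<And>w. w \<in> Aset l B \<Longrightarrow> P w w' = 0) \<Longrightarrow> w' \<in> Iv l B N (inverse tt) lam"
begin

lemma valid_swl: "valid_letter l B a \<Longrightarrow> valid_letter l B (swl a)"
  by (cases a) (auto intro: inP_uminus)

lemma valid_swl_iff [simp]: "valid_letter l B (swl a) = valid_letter l B a"
  using valid_swl[of a] valid_swl[of "swl a"] by auto

lemma Aset_sigma [simp]: "x \<in> Aset l B \<Longrightarrow> sigma x \<in> Aset l B"
proof (induction rule: Aset_induct)
  case (mono w)
  have "valid_word l B (rev (map swl w))" using mono by (auto simp: valid_word_def)
  then show ?case by (simp add: sigma_mono)
qed (simp_all add: sigma_add sigma_fsc sigma_zero)

lemma dual: "verma_pairing l N B (inverse tt) lam (\<lambda>x y. P y x)"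
proof (unfold_locales, goal_cases)
  case 1 show ?case by (rule generic_q_inverse[OF tt])
next
  case 2 show ?case by (rule lam)
next
  case (10 x w w')
  then show ?case using P_adj[of "sigma x" w' w] by simp
qed (auto simp: P_add_left P_add_right P_scale_left P_scale_right P_one intro: P_Iv_left P_Iv_right P_nondeg_left P_nondeg_right)

section \<open>The Verma module as a space of functionals on words\<close>

lemma Iv_zero: "0 \<in> Iv l B N tt lam" and Iv_add: "x \<in> Iv l B N tt lam \<Longrightarrow> y \<in> Iv l B N tt lam \<Longrightarrow> x + y \<in> Iv l B N tt lam"
  and Iv_fsc: "x \<in> Iv l B N tt lam \<Longrightarrow> fsc c x \<in> Iv l B N tt lam"
  unfolding Iv_def by (auto intro: fspan.intros)

text \<open>The image of \<open>Phi\<close> serves as the quotient module: by nondegeneracy two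
  elements have the same functional exactly if they agree modulo \<open>Iv\<close>, so congruences
  become equations.\<close>

definition Phi :: "fa \<Rightarrow> letter list \<Rightarrow> K" where
  "Phi x = (\<lambda>w. if valid_word l B w then P x (mono w) else 0)"

text \<open>By adjointness, multiplying the first argument of the pairing by a letter prepends its
  image under sigma to the word in the second argument.\<close>

definition act :: "letter \<Rightarrow> (letter list \<Rightarrow> K) \<Rightarrow> letter list \<Rightarrow> K" where
  "act a f = (\<lambda>w. f (swl a # w))"

lemma Aset_uminus [simp]: "x \<in> Aset l B \<Longrightarrow> - x \<in> Aset l B"
  using Aset_closed(5)[of x l B "- 1"] by (simp add: fsc_uminus)

lemma P_diff_left: "x \<in> Aset l B \<Longrightarrow> y \<in> Aset l B \<Longrightarrow> z \<in> Aset l B \<Longrightarrow> P (x - y) z = P x z - P y z"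
  using P_add_left[of x "fsc (-1) y" z] P_scale_left[of y z "-1"] by (simp add: fsc_uminus)

lemma Phi_add: "x \<in> Aset l B \<Longrightarrow> y \<in> Aset l B \<Longrightarrow> Phi (x + y) = Phi x + Phi y"
  by (auto simp: Phi_def fun_eq_iff fun_ops P_add_left)

lemma Phi_diff: "x \<in> Aset l B \<Longrightarrow> y \<in> Aset l B \<Longrightarrow> Phi (x - y) = Phi x - Phi y"
  by (auto simp: Phi_def fun_eq_iff fun_ops P_diff_left)

lemma Phi_fsc: "x \<in> Aset l B \<Longrightarrow> Phi (fsc c x) = funscale c (Phi x)"
  by (auto simp: Phi_def fun_eq_iff funscale_def P_scale_left)

lemma Phi_eq_0: 
  assumes "x \<in> Aset l B"
  shows "Phi x = 0 \<longleftrightarrow> x \<in> Iv l B N tt lam"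
proof
  assume a: "Phi x = 0"
  have "P x y = 0" if "y \<in> Aset l B" for y
    using that
  proof (induction rule: Aset_induct)
    case zero
    then show ?case using P_scale_right[OF assms, of 0 0] by simp
  next
    case (mono w)
    then show ?case using fun_cong[OF a, of w] by (simp add: Phi_def fun_ops)
  qed (simp_all add: assms P_add_right P_scale_right)
  then show "x \<in> Iv l B N tt lam" by (rule P_nondeg_left[OF assms])
next
  assume "x \<in> Iv l B N tt lam"
  then show "Phi x = 0" by (auto simp: Phi_def fun_eq_iff fun_ops P_Iv_left)
qed

lemma Phi_eq: "x \<in> Aset l B \<Longrightarrow> y \<in> Aset l B \<Longrightarrow> Phi x = Phi y \<longleftrightarrow> x - y \<in> Iv l B N tt lam"
  using Phi_eq_0[of "x - y"] by (simp add: Phi_diff)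

lemma P_letter: "valid_letter l B a \<Longrightarrow> x \<in> Aset l B \<Longrightarrow> y \<in> Aset l B \<Longrightarrow> P (fmul (mono [a]) x) y = P x (fmul (mono [swl a]) y)"
  using P_adj[of "mono [a]" x y] by (simp add: sigma_mono)

lemma Phi_mul: "valid_letter l B a \<Longrightarrow> x \<in> Aset l B \<Longrightarrow> Phi (fmul (mono [a]) x) = act a (Phi x)"
  by (auto simp: Phi_def act_def fun_eq_iff P_letter)

lemma Phi_mul2: "valid_letter l B a \<Longrightarrow> valid_letter l B b \<Longrightarrow> x \<in> Aset l B \<Longrightarrow> Phi (fmul (mono [a, b]) x) = act a (act b (Phi x))"
  using Phi_mul[of a "fmul (mono [b]) x"] Phi_mul[of b x] by (simp add: fmul_mono_assoc)

lemma act_linear: "funspace.linear_op (act a)"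
  by (simp add: funspace.linear_op_def act_def fun_eq_iff fun_ops funscale_def)

lemmas act_lin = funspace.linear_opD[OF act_linear]

definition VV :: "(letter list \<Rightarrow> K) set" where "VV = Phi ` Aset l B"

lemma VV_cases: "f \<in> VV \<Longrightarrow> (\<And>x. x \<in> Aset l B \<Longrightarrow> f = Phi x \<Longrightarrow> thesis) \<Longrightarrow> thesis"
  by (auto simp: VV_def)

lemma VV_act: "f \<in> VV \<Longrightarrow> valid_letter l B a \<Longrightarrow> act a f \<in> VV"
  by (erule VV_cases) (auto simp: VV_def Phi_mul[symmetric])

lemma VV_zero: "0 \<in> VV" and VV_add: "f \<in> VV \<Longrightarrow> g \<in> VV \<Longrightarrow> f + g \<in> VV" and VV_scale: "f \<in> VV \<Longrightarrow> funscale c f \<in> VV"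
proof -
  have "Phi 0 = 0" using Phi_eq_0[of 0] Iv_zero by simp
  then show "0 \<in> VV" unfolding VV_def by (metis Aset_closed(1) image_eqI)
  show "f \<in> VV \<Longrightarrow> g \<in> VV \<Longrightarrow> f + g \<in> VV"
    by (elim VV_cases) (auto simp: VV_def Phi_add[symmetric])
  show "f \<in> VV \<Longrightarrow> funscale c f \<in> VV"
    by (elim VV_cases) (auto simp: VV_def Phi_fsc[symmetric])
qed

lemma rels_Iv:
  assumes "r \<in> rels l B N tt" "x \<in> Aset l B"
  shows "fmul r x \<in> Iv l B N tt lam"
  using assms(2)
proof (induction rule: Aset_induct)
  case (mono w)
  have "fmul (fmul (mono []) r) (mono w) \<in> Iv l B N tt lam"
    unfolding Iv_def using mono assms(1) by (intro fspan_base) (fastforce simp: valid_word_def)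
  then show ?case by (simp add: fone_def[symmetric])
qed (simp_all add: fmul_add_right fmul_fsc_right Iv_zero Iv_add Iv_fsc)

lemma act_K_E:
  assumes "f \<in> VV" "inP l B mu" "i < l"
  shows "act (LK mu) (act (LE i) f) = funscale (tt powi xp (form l B mu (alpha i))) (act (LE i) (act (LK mu) f))"
  using assms(1)
proof (rule VV_cases)
  fix x assume x: "x \<in> Aset l B" "f = Phi x"
  have "mono [LK mu, LE i] - fsc (vpow tt N (form l B mu (alpha i))) (mono [LE i, LK mu]) \<in> rels l B N tt"
    using assms by (auto simp: rels_def)
  from rels_Iv[OF this x(1)] show ?thesis
    using x assms by (simp add: fmul_diff_left fmul_fsc_left Phi_eq[symmetric] Phi_fsc Phi_mul2 vpow_xp)
qed

lemma act_K_F: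
  assumes "f \<in> VV" "inP l B mu" "i < l"
  shows "act (LK mu) (act (LF i) f) = funscale (tt powi (- xp (form l B mu (alpha i)))) (act (LF i) (act (LK mu) f))"
  using assms(1)
proof (rule VV_cases)
  fix x assume x: "x \<in> Aset l B" "f = Phi x"
  have "mono [LK mu, LF i] - fsc (vpow tt N (- form l B mu (alpha i))) (mono [LF i, LK mu]) \<in> rels l B N tt"
    using assms by (auto simp: rels_def)
  from rels_Iv[OF this x(1)] show ?thesis
    using x assms xp_minus[OF admr_form_alpha[OF assms(2), of i]]
    by (simp add: fmul_diff_left fmul_fsc_left Phi_eq[symmetric] Phi_fsc Phi_mul2 vpow_xp)
qed

lemma act_E_F:
  assumes "f \<in> VV" "i < l" "j < l"
  shows "act (LE i) (act (LF j) f) = act (LF j) (act (LE i) f) +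
     (if i = j then funscale (qd i) (act (LK (alpha i)) f - act (LK (- alpha i)) f) else 0)"
  using assms(1)
proof (rule VV_cases)
  fix x assume x: "x \<in> Aset l B" "f = Phi x"
  let ?c = "if i = j then fsc (inverse (vpow tt N (of_int (dd B i)) - inverse (vpow tt N (of_int (dd B i)))))
                             (mono [LK (alpha i)] - mono [LK (- alpha i)]) else 0"
  have K: "inP l B (alpha i)" "inP l B (- alpha i)" using assms by (auto intro: inP_alpha inP_uminus)
  have 0: "mono [LE i, LF j] - mono [LF j, LE i] - ?c \<in> rels l B N tt"
    unfolding rels_def using assms by blast
  have c: "?c \<in> Aset l B" using K by auto
  have "fmul (mono [LE i, LF j] - mono [LF j, LE i] - ?c) x \<in> Iv l B N tt lam" by (rule rels_Iv[OF 0 x(1)])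
  then have "Phi (fmul (mono [LE i, LF j] - mono [LF j, LE i] - ?c) x) = 0"
    using x(1) c assms by (subst Phi_eq_0) auto
  then have "act (LE i) (act (LF j) f) - act (LF j) (act (LE i) f) - Phi (fmul ?c x) = 0"
    using x c assms unfolding fmul_diff_left by (subst (asm) Phi_diff) (auto simp: Phi_diff Phi_mul2)
  moreover have "Phi (fmul ?c x) = (if i = j then funscale (qd i) (act (LK (alpha i)) f - act (LK (- alpha i)) f) else 0)"
    using x K Phi_eq_0[of 0] Iv_zero
    by (auto simp: fmul_fsc_left fmul_diff_left Phi_fsc Phi_diff Phi_mul vpow_dd qd_def)
  ultimately show ?thesis by (simp add: algebra_simps)
qed

definition hv :: "letter list \<Rightarrow> K" where "hv = Phi fone"

lemma hv_VV: "hv \<in> VV"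
  by (simp add: hv_def VV_def)

lemma act_E_hv: "i < l \<Longrightarrow> act (LE i) hv = 0"
proof -
  assume i: "i < l"
  have "fmul (mono []) (mono [LE i]) \<in> Iv l B N tt lam"
    unfolding Iv_def by (rule fspan_base, rule UnI1, rule UnI2, rule CollectI, rule exI[of _ "[]"], rule exI[of _ i]) (simp add: i)
  then have "Phi (mono [LE i]) = 0" using i by (subst Phi_eq_0) auto
  then show ?thesis using Phi_mul[of "LE i" fone] i by (simp add: hv_def fone_def)
qed

lemma act_K_hv: "inP l B mu \<Longrightarrow> act (LK mu) hv = funscale (tt powi xp (form l B mu lam)) hv"
proof -
  assume mu: "inP l B mu"
  have "fmul (mono []) (mono [LK mu] - fsc (vpow tt N (form l B mu lam)) fone) \<in> Iv l B N tt lam"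
    unfolding Iv_def by (rule fspan_base, rule UnI2, rule CollectI, rule exI[of _ "[]"], rule exI[of _ mu]) (simp add: mu)
  then have "mono [LK mu] - fsc (vpow tt N (form l B mu lam)) fone \<in> Iv l B N tt lam"
    by (simp add: fone_def[symmetric])
  then have "Phi (mono [LK mu]) = Phi (fsc (vpow tt N (form l B mu lam)) fone)"
    using mu by (subst Phi_eq) auto
  then show ?thesis using Phi_mul[of "LK mu" fone] mu by (simp add: hv_def fone_def Phi_fsc vpow_xp)
qed

text \<open>The span of the F-monomials applied to the highest weight vector. It is the whole module
  by \<open>Phi_V0\<close>; its induction rule, used on the dual side, replaces a triangular
  decomposition.\<close>

inductive_set V0 :: "(letter list \<Rightarrow> K) set" where
  V0_zero: "0 \<in> V0"
| V0_hv: "hv \<in> V0"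
| V0_F: "x \<in> V0 \<Longrightarrow> i < l \<Longrightarrow> act (LF i) x \<in> V0"
| V0_add: "x \<in> V0 \<Longrightarrow> y \<in> V0 \<Longrightarrow> x + y \<in> V0"
| V0_scale: "x \<in> V0 \<Longrightarrow> funscale c x \<in> V0"

lemma V0_diff: "x \<in> V0 \<Longrightarrow> y \<in> V0 \<Longrightarrow> x - y \<in> V0"
  using V0_add[of x "funscale (-1) y"] V0_scale[of y "-1"] by simp

lemma V0_VV: "x \<in> V0 \<Longrightarrow> x \<in> VV"
  by (induction rule: V0.induct) (auto intro: VV_zero hv_VV VV_act VV_add VV_scale)

lemma V0_K: "x \<in> V0 \<Longrightarrow> inP l B mu \<Longrightarrow> act (LK mu) x \<in> V0"
  by (induction rule: V0.induct) (auto simp: act_lin act_K_F V0_VV act_K_hv intro: V0.intros)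

lemma V0_E: "x \<in> V0 \<Longrightarrow> i < l \<Longrightarrow> act (LE i) x \<in> V0"
  by (induction rule: V0.induct)
     (auto simp: act_lin act_E_F V0_VV act_E_hv intro!: V0.intros V0_diff V0_K inP_alpha inP_uminus)

lemma Phi_V0: "x \<in> Aset l B \<Longrightarrow> Phi x \<in> V0"
proof (induction rule: Aset_induct)
  case zero
  have "Phi 0 = 0" using Phi_eq_0[of 0] Iv_zero by simp
  then show ?case using V0_zero by simp
next
  case (mono w)
  then show ?case
  proof (induction w)
    case Nil
    show ?case using V0_hv by (simp add: hv_def fone_def)
  next
    case (Cons a w)
    then have "Phi (mono (a # w)) = act a (Phi (mono w))" using Phi_mul[of a "mono w"] by simp
    then show ?case using Cons by (cases a) (auto intro: V0_E V0_F V0_K)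
  qed
qed (simp_all add: Phi_add Phi_fsc V0_add V0_scale)

lemma Phi_eqD: "x \<in> Aset l B \<Longrightarrow> y \<in> Aset l B \<Longrightarrow> Phi x = Phi y \<Longrightarrow> z \<in> Aset l B \<Longrightarrow> P x z = P y z"
  using Phi_eq[of x y] P_Iv_left[of "x - y" z] P_diff_left[of x y z] by simp

text \<open>The dual Verma module is spanned by monomials in the F_i, so a vector of V is determined by the
  values at the dual highest weight vector of its images under monomials in the E_i.\<close>
lemma E_stable_zero:
  assumes S: "S \<subseteq> VV" "\<And>f. f \<in> S \<Longrightarrow> f [] = 0" "\<And>f i. f \<in> S \<Longrightarrow> i < l \<Longrightarrow> act (LE i) f \<in> S"
    and f: "f \<in> S"
  shows "f = 0"
proof -
  interpret D: verma_pairing l N B "inverse tt" lam "\<lambda>x y. P y x" by (rule dual)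
  \<comment> \<open>The pairing lives on the free algebra, so the induction produces a
    representative y of g. In the case of F_i, this letter is moved to the first argument as E_i,
    under which S is stable.\<close>
  have "\<exists>y\<in>Aset l B. D.Phi y = g \<and> (\<forall>x\<in>Aset l B. Phi x \<in> S \<longrightarrow> P x y = 0)" if "g \<in> D.V0" for g
    using that
  proof (induction rule: D.V0.induct)
    case V0_zero
    have "D.Phi 0 = 0" using D.Phi_eq_0[of 0] D.Iv_zero by simp
    then show ?case using D.P_scale_left[of 0 _ 0] by (intro bexI[of _ 0]) auto
  next
    case V0_hv
    have "P x fone = 0" if "Phi x \<in> S" for x using S(2)[OF that] by (simp add: Phi_def fone_def)
    then show ?case by (intro bexI[of _ fone]) (auto simp: D.hv_def)
  next
    case (V0_F g i)
    then obtain y where y: "y \<in> Aset l B" "D.Phi y = g" "\<And>x. x \<in> Aset l B \<Longrightarrow> Phi x \<in> S \<Longrightarrow> P x y = 0" by auto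
    have "P x (fmul (mono [LF i]) y) = 0" if x: "x \<in> Aset l B" "Phi x \<in> S" for x
    proof -
      have "Phi (fmul (mono [LE i]) x) \<in> S" using S(3)[OF x(2) V0_F(2)] x V0_F(2) by (simp add: Phi_mul)
      then have "P (fmul (mono [LE i]) x) y = 0" using x V0_F(2) by (intro y(3)) auto
      then show ?thesis using P_letter[of "LE i" x y] x y V0_F(2) by simp
    qed
    then show ?case using y V0_F(2) by (intro bexI[of _ "fmul (mono [LF i]) y"]) (auto simp: D.Phi_mul)
  next
    case (V0_add g h)
    then obtain y z where "y \<in> Aset l B" "D.Phi y = g" "\<And>x. x \<in> Aset l B \<Longrightarrow> Phi x \<in> S \<Longrightarrow> P x y = 0"
      "z \<in> Aset l B" "D.Phi z = h" "\<And>x. x \<in> Aset l B \<Longrightarrow> Phi x \<in> S \<Longrightarrow> P x z = 0" by auto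
    then show ?case by (intro bexI[of _ "y + z"]) (auto simp: D.Phi_add P_add_right)
  next
    case (V0_scale g c)
    then obtain y where "y \<in> Aset l B" "D.Phi y = g" "\<And>x. x \<in> Aset l B \<Longrightarrow> Phi x \<in> S \<Longrightarrow> P x y = 0" by auto
    then show ?case by (intro bexI[of _ "fsc c y"]) (auto simp: D.Phi_fsc P_scale_right)
  qed
  note span = this
  obtain x where x: "x \<in> Aset l B" "f = Phi x" using S(1) f VV_cases by blast
  have "P x w = 0" if w: "w \<in> Aset l B" for w
  proof -
    obtain y where y: "y \<in> Aset l B" "D.Phi y = D.Phi w" "P x y = 0"
      using span[OF D.Phi_V0[OF w]] x f by blast
    then show ?thesis using D.Phi_eqD[OF y(1) w y(2) x(1)] by simp
  qed
  then have "x \<in> Iv l B N tt lam" by (rule P_nondeg_left[OF x(1)])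
  then show ?thesis using Phi_eq_0[OF x(1)] x(2) by simp
qed

section \<open>Weight spaces and the absence of singular vectors\<close>

definition wsp :: "wt \<Rightarrow> (letter list \<Rightarrow> K) set" where
  "wsp beta = {f \<in> VV. \<forall>mu. inP l B mu \<longrightarrow> act (LK mu) f = funscale (tt powi xp (form l B mu (lam - beta))) f}"

lemma in_comp_iff: "in_comp l B N tt lam beta x \<longleftrightarrow> x \<in> Aset l B \<and> Phi x \<in> wsp beta"
proof (cases "x \<in> Aset l B")
  case True
  have "fmul (mono [LK mu]) x - fsc (vpow tt N (form l B mu (lam - beta))) x \<in> Iv l B N tt lam \<longleftrightarrow>
     act (LK mu) (Phi x) = funscale (tt powi xp (form l B mu (lam - beta))) (Phi x)" if "inP l B mu" for mu
    using True that by (simp add: Phi_eq[symmetric] Phi_mul Phi_fsc vpow_xp)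
  then show ?thesis using True by (auto simp: in_comp_def wsp_def VV_def)
qed (simp add: in_comp_def)

lemma wsp_VV: "f \<in> wsp beta \<Longrightarrow> f \<in> VV"
  by (simp add: wsp_def)

lemma wsp_K: "f \<in> wsp beta \<Longrightarrow> inP l B mu \<Longrightarrow> act (LK mu) f = funscale (tt powi xp (form l B mu (lam - beta))) f"
  by (simp add: wsp_def)

lemma wsp_E:
  assumes "f \<in> wsp beta" "i < l" "inP l B beta"
  shows "act (LE i) f \<in> wsp (beta - alpha i)"
proof -
  have "act (LK mu) (act (LE i) f) = funscale (tt powi xp (form l B mu (lam - (beta - alpha i)))) (act (LE i) f)" if mu: "inP l B mu" for mu
  proof -
    have "form l B mu (lam - (beta - alpha i)) = form l B mu (alpha i) + form l B mu (lam - beta)"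
      by (simp add: form_diff_right)
    moreover have "admr (form l B mu (lam - beta))" by (intro admr_form mu inP_diff lam assms)
    ultimately have "xp (form l B mu (lam - (beta - alpha i))) = xp (form l B mu (alpha i)) + xp (form l B mu (lam - beta))"
      using admr_form_alpha[OF mu] by (simp add: xp_add)
    then show ?thesis
      using act_K_E[OF wsp_VV[OF assms(1)] mu assms(2)] wsp_K[OF assms(1) mu] by (simp add: act_lin powi_add)
  qed
  then show ?thesis using assms by (simp add: wsp_def VV_act)
qed

lemma wsp_F:
  assumes "f \<in> wsp beta" "i < l" "inP l B beta"
  shows "act (LF i) f \<in> wsp (beta + alpha i)"
proof -
  have "act (LK mu) (act (LF i) f) = funscale (tt powi xp (form l B mu (lam - (beta + alpha i)))) (act (LF i) f)" if mu: "inP l B mu" for mu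
  proof -
    have "form l B mu (lam - (beta + alpha i)) = form l B mu (lam - beta) - form l B mu (alpha i)"
      by (simp add: form_diff_right form_add_right)
    moreover have "admr (form l B mu (lam - beta))" by (intro admr_form mu inP_diff lam assms)
    ultimately have eq: "xp (form l B mu (lam - (beta + alpha i))) = - xp (form l B mu (alpha i)) + xp (form l B mu (lam - beta))"
      using admr_form_alpha[OF mu] by (simp add: xp_diff)
    then show ?thesis
      using act_K_F[OF wsp_VV[OF assms(1)] mu assms(2)] wsp_K[OF assms(1) mu] by (simp only: eq act_lin powi_add funspace.scale_scale)
  qed
  then show ?thesis using assms by (simp add: wsp_def VV_act)
qed

lemma powi_eqD: "tt powi m = tt powi n \<Longrightarrow> m = n"
proof -
  assume "tt powi m = tt powi n"
  then have "tt powi (m - n) = 1" using tt0 by (simp add: power_int_diff)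
  then show ?thesis using tt by (auto simp: generic_q_def)
qed

text \<open>The value at the empty word is the pairing with the dual highest weight vector. Letting
  K_beta act on either argument gives two scalars, with exponents (beta, lam - beta) and (beta,
  lam); if the value were nonzero, they would agree and (beta, beta) would be 0.\<close>

lemma wsp_Nil:
  assumes "f \<in> wsp beta" "inP l B beta" "beta \<noteq> 0"
  shows "f [] = 0"
proof (rule ccontr)
  assume f0: "f [] \<noteq> 0"
  interpret D: verma_pairing l N B "inverse tt" lam "\<lambda>x y. P y x" by (rule dual)
  obtain x where x: "x \<in> Aset l B" "f = Phi x" using wsp_VV[OF assms(1)] VV_cases by blast
  have f1: "Phi x [] = P x fone" by (simp add: x Phi_def fone_def)
  have nb: "inP l B (- beta)" by (rule inP_uminus[OF assms(2)])
  have "D.act (LK (- beta)) D.hv = funscale (inverse tt powi xp (form l B (- beta) lam)) D.hv" by (rule D.act_K_hv[OF nb])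
  then have "D.Phi (fmul (mono [LK (- beta)]) fone) = D.Phi (fsc (inverse tt powi xp (form l B (- beta) lam)) fone)"
    using nb by (simp add: D.Phi_mul D.Phi_fsc D.hv_def)
  then have "P x (fmul (mono [LK (- beta)]) fone) = P x (fsc (inverse tt powi xp (form l B (- beta) lam)) fone)"
    using nb x by (intro D.Phi_eqD) auto
  then have 1: "P (fmul (mono [LK beta]) x) fone = tt powi xp (form l B beta lam) * f []"
    using x assms(2) nb xp_minus[OF admr_form[OF assms(2) lam]]
    by (simp add: P_letter P_scale_right f1 form_uminus_left power_int_inverse power_int_minus)
  have "Phi (fmul (mono [LK beta]) x) [] = tt powi xp (form l B beta (lam - beta)) * f []"
    using wsp_K[OF assms(1,2)] x assms(2) by (simp add: Phi_mul funscale_def)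
  then have "tt powi xp (form l B beta (lam - beta)) = tt powi xp (form l B beta lam)"
    using 1 f0 by (simp add: Phi_def fone_def)
  then have "xp (form l B beta (lam - beta)) = xp (form l B beta lam)" by (rule powi_eqD)
  then have "form l B beta beta = 0"
    using assms(2) lam xp_eq_0[of "form l B beta beta"] by (simp add: form_diff_right xp_diff admr_form)
  then have "beta i = 0" if "i < l" for i using form_pos[OF that, of beta] by force
  then have "beta = 0" using assms(2) unfolding inP_def by (metis (no_types, lifting) ext linorder_not_less zero_fun_apply)
  then show False using assms(3) by simp
qed

text \<open>Subtracting a simple root from an index outside Q_+ never leads into Q_+, so the union
  of these weight spaces is stable under the E_i, and it avoids the index 0.\<close>

lemma wsp_not_Qplus:
  assumes "f \<in> wsp beta" "inP l B beta" "\<not> inQplus l beta"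
  shows "f = 0"
proof (rule E_stable_zero)
  let ?S = "\<Union>beta\<in>{beta. inP l B beta \<and> \<not> inQplus l beta}. wsp beta"
  show "?S \<subseteq> VV" by (auto simp: wsp_def)
  show "f \<in> ?S" using assms by blast
  fix g assume "g \<in> ?S"
  then obtain b where b: "g \<in> wsp b" "inP l B b" "\<not> inQplus l b" by blast
  have "inQplus l 0" by (auto simp: inQplus_def fun_ops intro: exI[of _ 0])
  then show "g [] = 0" using b by (intro wsp_Nil[of g b]) auto
  fix i assume i: "i < l"
  have "\<not> inQplus l (b - alpha i)"
  proof
    assume "inQplus l (b - alpha i)"
    then obtain c where "b - alpha i = wt_of l c" by (rule inQplus_wt_of)
    then have "b = wt_of l (c(i := c i + 1))" using wt_of_Suc[OF i, of c] by (metis diff_add_cancel)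
    then show False using b(3) wt_of_inQplus by simp
  qed
  then show "act (LE i) g \<in> ?S" using wsp_E[OF b(1) i b(2)] inP_diff[OF b(2) inP_alpha[OF i]] by blast
qed

text \<open>A vector killed by all E_i forms an E-stable set together with 0, and its value at the
  empty word vanishes as its index is not 0.\<close>

lemma wsp_singular:
  assumes "f \<in> wsp beta" "inP l B beta" "beta \<noteq> 0" "\<And>i. i < l \<Longrightarrow> act (LE i) f = 0"
  shows "f = 0"
proof (rule E_stable_zero)
  show "{f, 0} \<subseteq> VV" using assms(1) VV_zero by (auto simp: wsp_def)
  show "f \<in> {f, 0}" by simp
  fix g i assume g: "g \<in> {f, 0}"
  then show "g [] = 0" using wsp_Nil[OF assms(1-3)] by (auto simp: fun_ops)
  show "i < l \<Longrightarrow> act (LE i) g \<in> {f, 0}" using g assms(4) by (auto simp: act_lin)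
qed

definition lm :: "nat \<Rightarrow> int" where "lm i = xp (form l B lam (alpha i))"

lemma lin_Bm: "i < l \<Longrightarrow> lin l 0 (Bm i) b = xp (form l B (alpha i) (wt_of l b))"
proof -
  assume i: "i < l"
  have "form l B (alpha i) (wt_of l b) = of_int (\<Sum>r<l. int (b r) * B i r)"
    unfolding form_expand[of l B "alpha i" "wt_of l b"] by (simp add: form_alpha_alpha[OF i] wt_of_def)
  then have "xp (form l B (alpha i) (wt_of l b)) = int N * (\<Sum>r<l. int (b r) * B i r)" by (simp only: xp_int)
  then show ?thesis by (simp add: lin_def Bm_def sum_distrib_left mult_ac)
qed

lemma xp_alpha_weight: "i < l \<Longrightarrow> xp (form l B (alpha i) (lam - wt_of l b)) = lm i - lin l 0 (Bm i) b"
  using xp_diff[OF admr_form[OF inP_alpha lam] admr_form[OF inP_alpha inP_wt_of], of i i b]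
  by (simp add: form_diff_right lin_Bm lm_def form_sym[of lam])

lemma funspace_subspace_wsp: "funspace.subspace (wsp beta)"
proof (rule funspace.subspaceI)
  show "0 \<in> wsp beta" by (auto simp: wsp_def VV_zero act_lin)
  show "x + y \<in> wsp beta" if "x \<in> wsp beta" "y \<in> wsp beta" for x y
    using that by (auto simp: wsp_def VV_add act_lin funspace.scale_right_distrib)
  show "funscale c x \<in> wsp beta" if "x \<in> wsp beta" for c x
    using that by (auto simp: wsp_def VV_scale act_lin mult.commute)
qed

sublocale hw: hw_module funscale l tt Bm dm lm "\<lambda>i. act (LE i)" "\<lambda>i. act (LF i)" "\<lambda>b. wsp (wt_of l b)" hv
proof (unfold_locales, goal_cases)
  case 1 show ?case by (rule tt0)
next
  case 2 then show ?case using tt by (auto simp: generic_q_def)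
next
  case 3 then show ?case by (rule Bm_sym)
next
  case 4 then show ?case by (rule Bm_diag)
next
  case 5 then show ?case using dd_pos N_pos by (simp add: dm_def)
next
  case 10 show ?case by (rule funspace_subspace_wsp)
next
  case (11 i x b)
  have "\<not> inQplus l (wt_of l b - alpha i)"
    using 11 by (auto simp: inQplus_def wt_of_def alpha_def fun_ops)
  then show ?case
    by (rule wsp_not_Qplus[OF wsp_E[OF 11(2,1) inP_wt_of] inP_diff[OF inP_wt_of inP_alpha[OF 11(1)]]])
next
  case (12 i x b)
  then show ?case using wsp_F[OF 12(2,1) inP_wt_of] wt_of_Suc[of i l b] by simp
next
  case (13 i j x b)
  then show ?case using act_E_F[OF wsp_VV[OF 13(4)] 13(1,2)] by simp
next
  case (14 i x b)
  have m: "xp (form l B (- alpha i) (lam - wt_of l b)) = - (lm i - lin l 0 (Bm i) b)"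
    using xp_minus[OF admr_form[OF inP_alpha[OF 14(1)] inP_diff[OF lam inP_wt_of]], of b] xp_alpha_weight[OF 14(1)]
    by (simp add: form_uminus_left)
  have "act (LK (alpha i)) x = funscale (tt powi (lm i - lin l 0 (Bm i) b)) x"
    "act (LK (- alpha i)) x = funscale (tt powi (- (lm i - lin l 0 (Bm i) b))) x"
    using wsp_K[OF 14(2) inP_alpha[OF 14(1)]] wsp_K[OF 14(2) inP_uminus[OF inP_alpha[OF 14(1)]]]
    by (simp_all only: m xp_alpha_weight[OF 14(1)])
  then show ?case
    using act_E_F[OF wsp_VV[OF 14(2)] 14(1,1)]
    by (simp add: funspace.scale_left_diff_distrib[symmetric] qd_def divide_inverse mult.commute power_int_minus[of _ "dm i"] del: minus_diff_eq)
next
  case (15 b)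
  then have "wt_of l b = 0" by (intro wt_of_0)
  then show ?case using hv_VV act_K_hv by (simp add: wsp_def)
next
  case (16 x b i)
  have "wt_of l b i \<noteq> 0" using 16(2,3) by (simp add: wt_of_def)
  then have "wt_of l b \<noteq> 0" by (auto simp: fun_ops)
  then show ?case by (rule wsp_singular[OF 16(1) inP_wt_of]) (use 16(4) in auto)
qed (simp_all add: act_lin)

theorem lam_antidominant:
  assumes i: "i < l"
  shows "form l B lam (alpha i) \<le> - of_int (dd B i)"
proof -
  obtain k where k: "form l B lam (alpha i) = of_int (k * dd B i)"
    using lam i unfolding inP_def by blast
  have "k < 0"
  proof (rule ccontr)
    assume "\<not> k < 0"
    define n where "n = nat k"
    have n: "k = int n" using \<open>\<not> k < 0\<close> by (simp add: n_def)
    \<comment> \<open>With (lam, alpha_i) = n d_i the weight bracket of \<open>E_Fp_eq\<close> is 0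
      at the power n+1 of F_i. The index is written \<open>0 + Suc n\<close> to match
      \<open>Fp_W\<close>.\<close>
    let ?b = "(\<lambda>_. 0)(i := 0 + Suc n)"
    let ?f = "(act (LF i) ^^ Suc n) hv"
    have lmi: "lm i = int n * dm i" using k n by (simp add: lm_def xp_int dm_def del: of_int_mult)
    have hvW: "hv \<in> wsp (wt_of l (\<lambda>_. 0))" by (rule hw.hwv_W) simp
    have W: "?f \<in> wsp (wt_of l ?b)" by (rule hw.Fp_W[OF i hvW])
    have "act (LE j) ?f = 0" if j: "j < l" for j
    proof (cases "j = i")
      case True
      show ?thesis unfolding True hw.E_Fp_eq[OF i hvW] lmi
        by (simp add: act_E_hv[OF i] funspace.linear_opD[OF funspace.linear_op_funpow[OF act_linear]] lin_def hw.bra_def act_lin)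
    next
      case False
      then show ?thesis unfolding hw.E_Fp_neq[OF j i False hvW] act_E_hv[OF j]
        by (simp only: funspace.linear_opD[OF funspace.linear_op_funpow[OF act_linear]])
    qed
    then have "?f = 0" using hw.singular_zero[OF W i] by simp
    moreover have "?f = Phi (mono (replicate (Suc n) (LF i)))"
    proof -
      have "(act (LF i) ^^ m) hv = Phi (mono (replicate m (LF i))) \<and> valid_word l B (replicate m (LF i))" for m
      proof (induction m)
        case (Suc m)
        then show ?case using Phi_mul[of "LF i" "mono (replicate m (LF i))"] i by simp
      qed (simp add: hv_def fone_def)
      then show ?thesis by blast
    qed
    moreover have "mono (replicate (Suc n) (LF i)) \<in> Aset l B" using i by (auto simp: valid_word_def)
    ultimately have "mono (replicate (Suc n) (LF i)) \<in> Iv l B N tt lam" using Phi_eq_0 by metis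
    then show False using power_not_in_Iv by blast
  qed
  \<comment> \<open>Integrality sharpens k < 0 to k <= -1; the resulting bound -d_i is what
    compensates rho in \<open>fe_nonzero\<close>.\<close>
  then have "k * dd B i \<le> - dd B i" using mult_right_mono[of k "-1" "dd B i"] dd_pos[OF i] by simp
  then have "(of_int (k * dd B i) :: rat) \<le> of_int (- dd B i)" by (simp only: of_int_le_iff)
  then show ?thesis using k by simp
qed

end

section \<open>The recursion\<close>

lemma tvar_power: "tvar ^ n = Fract ([:0, 1:] ^ n) 1"
  by (induction n) (simp_all add: tvar_def One_fract_def)

lemma generic_q_tvar: "generic_q tvar"
proof -
  have nz: "tvar \<noteq> 0" by (simp add: tvar_def Zero_fract_def eq_fract)
  have pow: "m = 0" if "tvar ^ m = 1" for m
  proof -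
    have "[:0, 1:] ^ m = (1 :: complex poly)"
      using that by (simp add: tvar_power One_fract_def eq_fract)
    then have "degree ([:0, 1:] ^ m :: complex poly) = 0" by simp
    then show "m = 0" by (simp add: degree_power_eq)
  qed
  have "n = 0" if "tvar powi n = 1" for n
  proof (cases "n \<ge> 0")
    case True
    then show ?thesis using that pow[of "nat n"] by (simp add: power_int_def)
  next
    case False
    then have "tvar ^ nat (- n) = 1" using that nz by (simp add: power_int_def power_inverse)
    then show ?thesis using pow[of "nat (- n)"] False by simp
  qed
  then show ?thesis using nz by (simp add: generic_q_def)
qed

lemma funscale_eq_iff: "k \<noteq> 0 \<Longrightarrow> funscale k f = g \<longleftrightarrow> f = funscale (inverse k) g"
proof -
  assume "k \<noteq> 0"
  then have "k * u = v \<longleftrightarrow> u = inverse k * v" for u v by (auto simp: field_simps)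
  then show ?thesis by (simp add: funscale_def fun_eq_iff)
qed

lemma wt_of_floor:
  assumes "inQplus l beta"
  shows "wt_of l (\<lambda>i. nat \<lfloor>beta i\<rfloor>) = beta"
  using assms by (force simp: wt_of_def inQplus_def fun_eq_iff)

section \<open>The exponents of the recursion\<close>

context root_datum
begin

text \<open>All exponents refer to the generator of the ground field. The power of q in
  \<open>Jrec\<close> has exponent -fe, and \<open>he\<close> below is the exponent in front of the
  pairing in \<open>Jfun\<close>.\<close>

definition fe :: "wt \<Rightarrow> (nat \<Rightarrow> nat) \<Rightarrow> int" where
  "fe lam b = xp (2 * form l B (lam + rho l B) (wt_of l b) - form l B (wt_of l b) (wt_of l b))"

definition he :: "wt \<Rightarrow> (nat \<Rightarrow> nat) \<Rightarrow> int" where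
  "he lam b = xp (- form l B (wt_of l b) (wt_of l b) / 2 + form l B lam (wt_of l b))"

definition ge :: "wt \<Rightarrow> (nat \<Rightarrow> nat) \<Rightarrow> int" where
  "ge lam b = fe lam b - he lam b"

lemma admr_rho: "admr (form l B (rho l B) (wt_of l b))"
  by (simp only: rho_wt_of admr_int)

lemma admr_fe: "inP l B lam \<Longrightarrow> admr (2 * form l B (lam + rho l B) (wt_of l b) - form l B (wt_of l b) (wt_of l b))"
  using admr_mult_int[OF admr_add[OF admr_form admr_rho], of lam "wt_of l b" 2 b]
  by (intro admr_diff admr_form inP_wt_of) (simp add: form_add_left inP_wt_of)

lemma admr_he: "inP l B lam \<Longrightarrow> admr (- form l B (wt_of l b) (wt_of l b) / 2 + form l B lam (wt_of l b))"
  using admr_minus[OF admr_half[of b]] by (intro admr_add admr_form inP_wt_of) simp_all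

lemma form_low:
  assumes "i < l" "b i > 0"
  shows "form l B (wt_of l (b(i := b i - 1))) (wt_of l (b(i := b i - 1))) =
      form l B (wt_of l b) (wt_of l b) - 2 * form l B (alpha i) (wt_of l b) + of_int (2 * dd B i)"
  unfolding wt_of_low[where l = l and b = b and i = i, OF assms] form_diff_left form_diff_right form_alpha_alpha[OF assms(1,1)] B_even[OF assms(1)]
  by (simp add: form_sym[of "wt_of l b" "alpha i"])

lemma fe_he_low:
  assumes lam: "inP l B lam" and i: "i < l" "b i > 0"
  shows "fe lam b = fe lam (b(i := b i - 1)) + 2 * (xp (form l B lam (alpha i)) - xp (form l B (alpha i) (wt_of l b))) + 4 * dm i"
    and "he lam b = he lam (b(i := b i - 1)) + (xp (form l B lam (alpha i)) - xp (form l B (alpha i) (wt_of l b))) + dm i"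
proof -
  let ?b = "b(i := b i - 1)"
  note low = wt_of_low[where l = l and b = b and i = i, OF i]
  have of: "(of_int (xp r) :: rat) = of_nat N * r" if "admr r" for r using xp_of[OF that] .
  have a1: "admr (form l B lam (alpha i))" "admr (form l B (alpha i) (wt_of l b))"
    using i lam by (auto intro: admr_form inP_alpha inP_wt_of)
  have "(of_int (fe lam b) :: rat) = of_int (fe lam ?b + 2 * (xp (form l B lam (alpha i)) - xp (form l B (alpha i) (wt_of l b))) + 4 * dm i)"
    unfolding fe_def of_int_add of_int_diff of_int_mult of[OF admr_fe[OF lam]] of[OF a1(1)] of[OF a1(2)]
    unfolding form_low[where b = b and i = i, OF i]
    unfolding low form_diff_right form_add_left rho_form[OF i(1)] dm_def
    by (simp add: algebra_simps)
  then show "fe lam b = fe lam ?b + 2 * (xp (form l B lam (alpha i)) - xp (form l B (alpha i) (wt_of l b))) + 4 * dm i"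
    by (simp only: of_int_eq_iff)
  have "(of_int (he lam b) :: rat) = of_int (he lam ?b + (xp (form l B lam (alpha i)) - xp (form l B (alpha i) (wt_of l b))) + dm i)"
    unfolding he_def of_int_add of_int_diff of_int_mult of[OF admr_he[OF lam]] of[OF a1(1)] of[OF a1(2)]
    unfolding form_low[where b = b and i = i, OF i]
    unfolding low form_diff_right dm_def
    by (simp add: field_simps)
  then show "he lam b = he lam ?b + (xp (form l B lam (alpha i)) - xp (form l B (alpha i) (wt_of l b))) + dm i"
    by (simp only: of_int_eq_iff)
qed

lemma fe_0: "height l b = 0 \<Longrightarrow> fe lam b = 0" and he_0: "height l b = 0 \<Longrightarrow> he lam b = 0"
  using wt_of_0[of l b] by (simp_all add: fe_def he_def height_eq_0)

text \<open>The bound on lam gives (lam+rho, beta) <= 0, while (beta, beta) > 0, so the exponent is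
  strictly negative. Both the construction of the Whittaker vectors and the uniqueness of the
  recursion divide by an expression that is nonzero for this reason.\<close>

lemma fe_nonzero:
  assumes "inP l B lam" "\<And>i. i < l \<Longrightarrow> form l B lam (alpha i) \<le> - of_int (dd B i)" "height l b > 0"
  shows "fe lam b \<noteq> 0"
proof -
  obtain i where i: "i < l" "b i > 0" using assms(3) height_eq_0[of l b] by auto
  then have "form l B (wt_of l b) (wt_of l b) > 0" by (intro form_pos[of i]) (simp_all add: wt_of_def)
  moreover have "form l B (lam + rho l B) (wt_of l b) \<le> 0"
    unfolding form_expand[of l B "lam + rho l B" "wt_of l b"]
  proof (rule sum_nonpos)
    fix j assume "j \<in> {..<l}"
    then have "form l B (lam + rho l B) (alpha j) \<le> 0" "wt_of l b j \<ge> 0"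
      using assms(2)[of j] by (simp_all add: form_add_left rho_form wt_of_def)
    then show "wt_of l b j * form l B (lam + rho l B) (alpha j) \<le> 0" by (simp add: mult_nonneg_nonpos)
  qed
  ultimately have "2 * form l B (lam + rho l B) (wt_of l b) - form l B (wt_of l b) (wt_of l b) \<noteq> 0" by linarith
  then show ?thesis unfolding fe_def using xp_eq_0[OF admr_fe[OF assms(1)]] by blast
qed

end

section \<open>Whittaker vectors in the free algebra and among the functionals\<close>

locale whittaker_pair = verma_pairing +
  fixes eps :: "nat \<Rightarrow> nat \<Rightarrow> int" and nu :: "nat \<Rightarrow> wt" and c :: "nat \<Rightarrow> K"
  assumes wd: "whittaker_data l B eps nu c"
begin

lemma wd_unfold:
  "\<forall>i<l. \<forall>j<l. eps i j = - eps j i" "\<forall>i<l. \<forall>j<l. adjacent B i j \<longrightarrow> eps i j = 1 \<or> eps i j = -1"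
  "\<forall>i<l. inP l B (nu i)"
  "\<forall>i<l. \<forall>j<l. form l B (nu i) (alpha j) - form l B (nu j) (alpha i) = of_int (eps i j * B i j)"
  "\<forall>i<l. c i \<noteq> 0"
  using wd unfolding whittaker_data_def by - (elim conjE, assumption)+

lemma nu_P: "i < l \<Longrightarrow> inP l B (nu i)" and c_nonzero: "i < l \<Longrightarrow> c i \<noteq> 0"
  and nu_diff: "i < l \<Longrightarrow> j < l \<Longrightarrow> form l B (nu i) (alpha j) - form l B (nu j) (alpha i) = of_int (eps i j * B i j)"
  using wd_unfold(3,4,5) by simp_all

definition nm :: "nat \<Rightarrow> nat \<Rightarrow> int" where "nm i j = xp (form l B (nu i) (alpha j))"
definition nl :: "nat \<Rightarrow> int" where "nl i = xp (form l B (nu i) lam)"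
definition wc :: "nat \<Rightarrow> K" where "wc i = c i / (1 - (tt powi dm i)^2)"
definition rs0 :: "nat list" where "rs0 = (SOME rs. arrow_sorted l Bm nm rs \<and> set rs = {..<l})"

lemma rs0: "arrow_sorted l Bm nm rs0 \<and> set rs0 = {..<l}"
proof -
  have "nm i j - nm j i = eps i j * Bm i j" if ij: "i < l" "j < l" for i j
  proof -
    have "nm i j - nm j i = xp (form l B (nu i) (alpha j) - form l B (nu j) (alpha i))"
      unfolding nm_def by (rule xp_diff[symmetric]) (auto intro: admr_form nu_P inP_alpha ij)
    also have "\<dots> = int N * (eps i j * B i j)" unfolding nu_diff[OF ij] by (rule xp_int)
    finally show ?thesis by (simp add: Bm_def)
  qed
  then have "\<exists>rs. arrow_sorted l Bm nm rs \<and> set rs = {..<l}"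
    by (rule arrow_sorted_exists[OF wd_unfold(1,2)]) (simp_all add: Bm_def)
  then show ?thesis unfolding rs0_def by (rule someI_ex)
qed

sublocale wm: whittaker_module funscale l tt Bm dm lm "\<lambda>i. act (LE i)" "\<lambda>i. act (LF i)" "\<lambda>b. wsp (wt_of l b)" hv nm nl wc rs0 "fe lam"
proof (unfold_locales, goal_cases)
  case 1 show ?case using rs0 by blast
next
  case 2 show ?case using rs0 by blast
next
  case (3 i b)
  then show ?case using fe_he_low(1)[where b = b and i = i, OF lam] by (simp add: lm_def lin_Bm)
next
  case 4 then show ?case by (rule fe_0)
next
  case 5 then show ?case by (intro fe_nonzero lam lam_antidominant)
qed

lemma llin_xp: "i < l \<Longrightarrow> wm.llin i b = - xp (form l B (nu i) (lam - wt_of l b))"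
proof -
  assume i: "i < l"
  have "form l B (nu i) (wt_of l b) = (\<Sum>r<l. of_int (int (b r)) * form l B (nu i) (alpha r))"
    unfolding form_expand[of l B "nu i" "wt_of l b"] by (intro sum.cong refl) (simp add: wt_of_def)
  moreover have "xp (\<Sum>r<l. of_int (int (b r)) * form l B (nu i) (alpha r)) = (\<Sum>r<l. xp (of_int (int (b r)) * form l B (nu i) (alpha r)))"
    using xp_sum[of "{..<l}" "\<lambda>r. of_int (int (b r)) * form l B (nu i) (alpha r)"] admr_mult_int[OF admr_form_alpha[OF nu_P[OF i]]] by blast
  moreover have "xp (of_int (int (b r)) * form l B (nu i) (alpha r)) = int (b r) * nm i r" for r
    unfolding nm_def by (rule xp_mult_int[OF admr_form_alpha[OF nu_P[OF i]]])
  ultimately have "xp (form l B (nu i) (wt_of l b)) = (\<Sum>r<l. int (b r) * nm i r)" by simp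
  then show ?thesis
    using xp_diff[OF admr_form[OF nu_P[OF i] lam] admr_form[OF nu_P[OF i] inP_wt_of], of b]
    by (simp add: wm.llin_def lin_def nl_def form_diff_right)
qed

abbreviation wdiff :: "nat \<Rightarrow> fa \<Rightarrow> fa \<Rightarrow> fa" where
  "wdiff i x y \<equiv> fmul (mono [LE i, LK (nu i)]) x - fsc (c i / (1 - vpow tt N (of_int (dd B i)) ^ 2)) y"

lemma whittaker_relation:
  assumes "i < l" "x \<in> Aset l B" "y \<in> Aset l B" "Phi x \<in> wsp (wt_of l b)"
  shows "wdiff i x y \<in> Iv l B N tt lam \<longleftrightarrow>
     act (LE i) (Phi x) = funscale (wc i * tt powi wm.llin i b) (Phi y)"
proof -
  have nu: "inP l B (nu i)" using nu_P assms(1) by simp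
  let ?m = "xp (form l B (nu i) (lam - wt_of l b))"
  have "wdiff i x y \<in> Iv l B N tt lam \<longleftrightarrow>
      act (LE i) (act (LK (nu i)) (Phi x)) = funscale (wc i) (Phi y)"
    using assms nu by (simp add: Phi_eq[symmetric] Phi_mul2 Phi_fsc vpow_dd wc_def)
  also have "\<dots> \<longleftrightarrow> funscale (tt powi ?m) (act (LE i) (Phi x)) = funscale (wc i) (Phi y)"
    using wsp_K[OF assms(4) nu] by (simp add: act_lin)
  also have "\<dots> \<longleftrightarrow> act (LE i) (Phi x) = funscale (inverse (tt powi ?m)) (funscale (wc i) (Phi y))"
    by (rule funscale_eq_iff) (use tt0 in simp)
  finally show ?thesis unfolding llin_xp[OF assms(1)] by (simp add: power_int_minus mult.commute)
qed

lemma is_whittaker_whittaker: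
  assumes "is_whittaker l B N tt lam nu c theta"
  shows "wm.whittaker (\<lambda>b. Phi (theta (wt_of l b)))" "theta (wt_of l b) \<in> Aset l B"
proof -
  have comp: "theta (wt_of l b) \<in> Aset l B \<and> Phi (theta (wt_of l b)) \<in> wsp (wt_of l b)" for b
    using assms wt_of_inQplus[of l b] unfolding is_whittaker_def in_comp_iff by blast
  then show "theta (wt_of l b) \<in> Aset l B" by blast
  have 0: "Phi (theta (wt_of l b)) = hv" if "height l b = 0" for b
  proof -
    have w0: "wt_of l b = 0" using that by (intro wt_of_0) (simp add: height_eq_0)
    have "theta 0 - fone \<in> Iv l B N tt lam" using assms by (simp add: is_whittaker_def)
    then show ?thesis using comp[of b] by (simp add: w0 Phi_eq[symmetric] hv_def)
  qed
  have "act (LE i) (Phi (theta (wt_of l b))) = funscale (wc i * tt powi wm.llin i b) (Phi (theta (wt_of l (b(i := b i - 1)))))"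
    if i: "i < l" "b i > 0" for i b
  proof -
    let ?b = "b(i := b i - 1)"
    have e: "wt_of l ?b + alpha i = wt_of l b" using wt_of_low[where l = l and b = b and i = i, OF i] by simp
    have "wdiff i (theta (wt_of l ?b + alpha i)) (theta (wt_of l ?b)) \<in> Iv l B N tt lam"
      using assms i wt_of_inQplus[of l ?b] unfolding is_whittaker_def by blast
    then show ?thesis unfolding e using whittaker_relation[OF i(1)] comp by blast
  qed
  then show "wm.whittaker (\<lambda>b. Phi (theta (wt_of l b)))"
    unfolding wm.whittaker_def using comp 0 by blast
qed

lemma is_whittaker_exists: "\<exists>theta. is_whittaker l B N tt lam nu c theta"
proof -
  obtain xi where xi: "wm.whittaker xi" using wm.whittaker_exists by blast
  have "\<exists>x. x \<in> Aset l B \<and> Phi x = xi b" for b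
    using xi unfolding wm.whittaker_def by (metis VV_cases wsp_VV)
  then obtain rep where rep: "\<And>b. rep b \<in> Aset l B" "\<And>b. Phi (rep b) = xi b" by metis
  define theta where "theta beta = rep (\<lambda>i. nat \<lfloor>beta i\<rfloor>)" for beta :: wt
  have xW: "xi b \<in> wsp (wt_of l b)" and x0: "height l b = 0 \<Longrightarrow> xi b = hv"
    and xE: "i < l \<Longrightarrow> b i > 0 \<Longrightarrow> act (LE i) (xi b) = funscale (wc i * tt powi wm.llin i b) (xi (b(i := b i - 1)))" for b i
    using xi unfolding wm.whittaker_def by blast+
  have comp: "theta beta \<in> Aset l B \<and> Phi (theta beta) \<in> wsp beta" if "inQplus l beta" for beta
    using xW[of "\<lambda>i. nat \<lfloor>beta i\<rfloor>"] rep wt_of_floor[OF that] by (simp add: theta_def)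
  have "theta 0 - fone \<in> Iv l B N tt lam"
  proof -
    have "Phi (theta 0) = hv" unfolding theta_def rep(2) by (rule x0) (simp add: height_def fun_ops)
    then show ?thesis using rep(1) by (simp add: Phi_eq[symmetric] hv_def theta_def)
  qed
  moreover have "wdiff i (theta (beta + alpha i)) (theta beta) \<in> Iv l B N tt lam"
    if i: "i < l" and beta: "inQplus l beta" for i beta
  proof -
    let ?b = "\<lambda>j. nat \<lfloor>beta j\<rfloor>"
    let ?b' = "?b(i := ?b i + 1)"
    have "beta i \<ge> 0" using beta i by (metis inQplus_def of_nat_0_le_iff)
    then have f: "(\<lambda>j. nat \<lfloor>(beta + alpha i) j\<rfloor>) = ?b'"
      by (auto simp: fun_eq_iff fun_ops alpha_def nat_add_distrib)
    have b: "?b'(i := ?b' i - 1) = ?b" by (rule ext) simp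
    have "act (LE i) (xi ?b') = funscale (wc i * tt powi wm.llin i ?b') (xi (?b'(i := ?b' i - 1)))"
      by (rule xE[OF i]) simp
    then have "act (LE i) (Phi (theta (beta + alpha i))) = funscale (wc i * tt powi wm.llin i ?b') (Phi (theta beta))"
      unfolding theta_def f rep(2) b .
    moreover have "Phi (theta (beta + alpha i)) \<in> wsp (wt_of l ?b')"
      unfolding theta_def f rep(2) by (rule xW)
    ultimately show ?thesis using whittaker_relation[OF i, of "theta (beta + alpha i)" "theta beta" ?b'] rep(1) by (simp add: theta_def)
  qed
  ultimately have "is_whittaker l B N tt lam nu c theta"
    using comp unfolding is_whittaker_def in_comp_iff by blast
  then show ?thesis by blast
qed

text \<open>The dual condition is the original one over the inverse of \<open>tt\<close> with
  inverse scalars. Since nu is the same, both vectors involve the same exponents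
  \<open>llin\<close>, with opposite signs as powers of \<open>tt\<close>.\<close>

lemma dual_pair: "whittaker_pair l N B (inverse tt) lam (\<lambda>x y. P y x) eps nu (\<lambda>i. inverse (c i))"
proof -
  interpret D: verma_pairing l N B "inverse tt" lam "\<lambda>x y. P y x" by (rule dual)
  have "whittaker_data l B eps nu (\<lambda>i. inverse (c i))"
  proof -
    have "\<forall>i<l. inverse (c i) \<noteq> 0" using wd_unfold(5) by simp
    then show ?thesis using wd unfolding whittaker_data_def by (elim conjE) (intro conjI; assumption)
  qed
  then show ?thesis by unfold_locales
qed

lemma wsp_Phi:
  assumes "f \<in> wsp beta"
  obtains x where "x \<in> Aset l B" "f = Phi x"
  using wsp_VV[OF assms] VV_cases by blast

theorem pairing_recursion:
  assumes theta: "is_whittaker l B N tt lam nu c theta"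
    and thetab: "is_whittaker l B N (inverse tt) lam nu (\<lambda>i. inverse (c i)) thetab"
  defines "J \<equiv> \<lambda>b. tt powi he lam b * P (theta (wt_of l b)) (thetab (wt_of l b))"
  shows "J b = (\<Sum>g\<in>{g. g \<le> b \<and> (\<forall>i\<ge>l. g i = b i)}. (\<Prod>j<l. inverse (wm.qp j (b j - g j))) * (tt powi (- fe lam g) * J g))"
    and "height l b = 0 \<Longrightarrow> J b = 1"
proof -
  interpret D: whittaker_pair l N B "inverse tt" lam "\<lambda>x y. P y x" eps nu "\<lambda>i. inverse (c i)" by (rule dual_pair)
  note tA = is_whittaker_whittaker[OF theta]
  note tB = D.is_whittaker_whittaker[OF thetab]
  \<comment> \<open>The abstract recursion expects a map on the module, whereas P takes elements of
    the free algebra; \<open>Phi_eqD\<close> makes the value independent of the representative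
    chosen.\<close>
  define phi where "phi b f = P (SOME x. x \<in> Aset l B \<and> Phi x = f) (thetab (wt_of l b))" for b f
  have phi: "phi b (Phi x) = P x (thetab (wt_of l b))" if "x \<in> Aset l B" for b x
  proof -
    have "(SOME y. y \<in> Aset l B \<and> Phi y = Phi x) \<in> Aset l B \<and> Phi (SOME y. y \<in> Aset l B \<and> Phi y = Phi x) = Phi x"
      by (rule someI[of _ x]) (use that in simp)
    then show ?thesis unfolding phi_def by (intro Phi_eqD that tB(2)) (elim conjE, assumption)+
  qed
  define a' where "a' j = inverse (c j) / (1 - (inverse tt powi dm j)^2)" for j
  have a'D: "a' = D.wc" by (simp add: fun_eq_iff a'_def D.wc_def)
  have 1: "phi b (x + y) = phi b x + phi b y" if xy: "x \<in> wsp (wt_of l b)" "y \<in> wsp (wt_of l b)" for b x y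
  proof -
    obtain x' where "x' \<in> Aset l B" "x = Phi x'" by (rule wsp_Phi[OF xy(1)])
    moreover obtain y' where "y' \<in> Aset l B" "y = Phi y'" by (rule wsp_Phi[OF xy(2)])
    ultimately show ?thesis using tB(2) by (simp add: Phi_add[symmetric] phi P_add_left)
  qed
  have 2: "phi b (funscale k x) = k * phi b x" if x: "x \<in> wsp (wt_of l b)" for b x k
  proof -
    obtain x' where "x' \<in> Aset l B" "x = Phi x'" by (rule wsp_Phi[OF x])
    then show ?thesis using tB(2) by (simp add: Phi_fsc[symmetric] phi P_scale_left)
  qed
  have 3: "phi b (act (LF j) x) = a' j * tt powi (- wm.llin j b) * phi (b(j := b j - 1)) x"
    if j: "j < l" "b j > 0" and x: "x \<in> wsp (wt_of l (b(j := b j - 1)))" for j b x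
  proof -
    let ?b = "b(j := b j - 1)"
    obtain x' where x': "x' \<in> Aset l B" "x = Phi x'" by (rule wsp_Phi[OF x])
    have "D.act (LE j) (D.Phi (thetab (wt_of l b))) = funscale (D.wc j * inverse tt powi D.wm.llin j b) (D.Phi (thetab (wt_of l ?b)))"
      by (rule tB(1)[unfolded D.wm.whittaker_def, THEN conjunct2, THEN conjunct2, rule_format]) (rule j)+
    then have "D.Phi (fmul (mono [LE j]) (thetab (wt_of l b))) = D.Phi (fsc (D.wc j * inverse tt powi D.wm.llin j b) (thetab (wt_of l ?b)))"
      using j tB(2) by (simp add: D.Phi_mul D.Phi_fsc)
    then have "P x' (fmul (mono [LE j]) (thetab (wt_of l b))) = P x' (fsc (D.wc j * inverse tt powi D.wm.llin j b) (thetab (wt_of l ?b)))"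
      using j tB(2) x' by (intro D.Phi_eqD) auto
    then have "P (fmul (mono [LF j]) x') (thetab (wt_of l b)) = a' j * tt powi (- wm.llin j b) * P x' (thetab (wt_of l ?b))"
      using x' j tB(2) by (simp add: P_letter P_scale_right a'D power_int_inverse power_int_minus)
    then show ?thesis using x' j by (simp add: phi Phi_mul[symmetric] del: fun_upd_apply)
  qed
  \<comment> \<open>The scalars c_j cancel against their inverses, and (1 - z^2)(1 - z^(-2)) = -(z -
    z^(-1))^2 accounts for the sign.\<close>
  have 4: "wc j * a' j * (tt powi dm j - tt powi (- dm j))^2 = -1" if j: "j < l" for j
  proof -
    define z where "z = tt powi dm j"
    have z: "z \<noteq> 0" using tt0 by (simp add: z_def)
    have zz: "z - inverse z \<noteq> 0" using hw.qden_nonzero1[OF j] by (simp add: z_def power_int_minus)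
    have i: "inverse tt powi dm j = inverse z" "tt powi (- dm j) = inverse z"
      by (simp_all add: z_def power_int_inverse power_int_minus)
    have d: "1 - z^2 = - (z * (z - inverse z))" "1 - (inverse z)^2 = inverse z * (z - inverse z)"
      using z by (simp_all add: power2_eq_square right_diff_distrib)
    show ?thesis unfolding wc_def a'_def i z_def[symmetric] d using z zz c_nonzero[OF j]
      by (simp add: power2_eq_square)
  qed
  have 5: "ge lam b = ge lam (b(j := b j - 1)) + lm j - lin l 0 (Bm j) b + 3 * dm j" if "j < l" "b j > 0" for j b
    using fe_he_low[where b = b and i = j, OF lam that] lin_Bm[OF that(1), of b] by (simp add: ge_def lm_def)
  note rec = wm.whittaker_pairing_recursion[of phi a' "ge lam", OF 1 2 3 4 5 tA(1)]
  have u: "wm.uphi phi (ge lam) (\<lambda>b. Phi (theta (wt_of l b))) g = tt powi (- fe lam g) * J g" for g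
  proof -
    have "- fe lam g + he lam g = - ge lam g" by (simp add: ge_def)
    then have "tt powi (- fe lam g) * tt powi he lam g = tt powi (- ge lam g)" by (simp flip: powi_add)
    moreover have "wm.uphi phi (ge lam) (\<lambda>b. Phi (theta (wt_of l b))) g = tt powi (- ge lam g) * P (theta (wt_of l g)) (thetab (wt_of l g))"
      using tA(2) by (simp add: wm.uphi_def phi)
    ultimately show ?thesis unfolding J_def by (simp flip: mult.assoc)
  qed
  have J: "tt powi fe lam b * (tt powi (- fe lam b) * J b) = J b"
    using tt0 by (simp add: power_int_minus)
  show "J b = (\<Sum>g\<in>{g. g \<le> b \<and> (\<forall>i\<ge>l. g i = b i)}. (\<Prod>j<l. inverse (wm.qp j (b j - g j))) * (tt powi (- fe lam g) * J g))"
    using rec[of b] unfolding u J .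
  assume h: "height l b = 0"
  have "Phi (theta (wt_of l b)) = Phi fone" "D.Phi (thetab (wt_of l b)) = D.Phi fone"
    using tA(1) tB(1) h unfolding wm.whittaker_def D.wm.whittaker_def by (simp_all add: hv_def D.hv_def)
  note e = this
  have "P (theta (wt_of l b)) (thetab (wt_of l b)) = P fone (thetab (wt_of l b))"
    by (rule Phi_eqD[OF tA(2) Aset_closed(2) e(1) tB(2)])
  also have "\<dots> = P fone fone"
    by (rule D.Phi_eqD[OF tB(2) Aset_closed(2) e(2) Aset_closed(2)])
  finally show "J b = 1" using h by (simp add: J_def he_0 P_one)
qed

end

lemma inQplusD:
  assumes "inQplus l x" "i < l"
  obtains n :: nat where "x i = of_nat n"
  using assms unfolding inQplus_def by blast

lemma is_pairing_verma_pairing: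
  assumes "simple_root_datum l B" "admissible_N l B N" "inP l B lam" "is_pairing l B N lam P"
  shows "verma_pairing l N B tvar lam P"
proof -
  have p: "\<forall>x\<in>Aset l B. \<forall>y\<in>Aset l B. \<forall>z\<in>Aset l B. P (x + y) z = P x z + P y z \<and> P z (x + y) = P z x + P z y"
    "\<forall>a x y. x \<in> Aset l B \<longrightarrow> y \<in> Aset l B \<longrightarrow> P (fsc a x) y = a * P x y \<and> P x (fsc a y) = a * P x y"
    "\<forall>x\<in>Iv l B N tvar lam. \<forall>y\<in>Aset l B. P x y = 0"
    "\<forall>x\<in>Aset l B. \<forall>y\<in>Iv l B N (inverse tvar) lam. P x y = 0"
    "P fone fone = 1"
    "\<forall>x\<in>Aset l B. \<forall>w\<in>Aset l B. \<forall>w'\<in>Aset l B. P (fmul x w) w' = P w (fmul (sigma x) w')"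
    "\<forall>w\<in>Aset l B. (\<forall>w'\<in>Aset l B. P w w' = 0) \<longrightarrow> w \<in> Iv l B N tvar lam"
    "\<forall>w'\<in>Aset l B. (\<forall>w\<in>Aset l B. P w w' = 0) \<longrightarrow> w' \<in> Iv l B N (inverse tvar) lam"
    using assms(4) unfolding is_pairing_def by - (elim conjE, assumption)+
  show ?thesis
  proof (unfold_locales, goal_cases)
    case 1 show ?case by (rule assms(1))
  next
    case 2 show ?case by (rule assms(2))
  next
    case 3 show ?case by (rule generic_q_tvar)
  next
    case 4 show ?case by (rule assms(3))
  qed (use p in blast)+
qed

section \<open>The recursion over Q_+ and the uniqueness of its solution\<close>

context root_datum
begin

definition qpt :: "nat \<Rightarrow> nat \<Rightarrow> K" where
  "qpt j n = (\<Prod>k<n. 1 - tvar powi (2 * dm j * (int k + 1)))"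

lemma wt_of_diff_le: "g \<le> b \<Longrightarrow> wt_of l b - wt_of l g = wt_of l (\<lambda>i. b i - g i)"
  by (auto simp: fun_eq_iff wt_of_def fun_ops le_fun_def of_nat_diff)

lemma qpoch_wt_of: "qpoch l B N (wt_of l b) = (\<Prod>j<l. qpt j (b j))"
  unfolding qpoch_def
proof (intro prod.cong refl)
  fix j assume "j \<in> {..<l}"
  then have f: "nat \<lfloor>wt_of l b j\<rfloor> = b j" by (simp add: wt_of_def)
  have "vpow tvar N (of_int (2 * dd B j)) = tvar powi (2 * dm j)"
    unfolding vpow_xp xp_int dm_def by (simp add: mult.left_commute)
  then show "(\<Prod>k<nat \<lfloor>wt_of l b j\<rfloor>. 1 - vpow tvar N (of_int (2 * dd B j)) ^ (k + 1)) = qpt j (b j)"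
    unfolding f qpt_def by (simp add: powi_power add.commute del: power_Suc)
qed

text \<open>Indices that agree with b from l on, where b is 0, correspond bijectively to the weights
  in the sum of \<open>Jrec\<close>; taking floors is the inverse map.\<close>

lemma Jrec_wt_of:
  assumes lam: "inP l B lam" and b: "\<And>i. i \<ge> l \<Longrightarrow> b i = 0"
  shows "Jrec l B N lam f (wt_of l b) = (\<Sum>g\<in>{g. g \<le> b \<and> (\<forall>i\<ge>l. g i = b i)}.
    (\<Prod>j<l. inverse (qpt j (b j - g j))) * (tvar powi (- fe lam g) * f (wt_of l g)))"
  unfolding Jrec_def
proof (rule sum.reindex_bij_witness[where i = "wt_of l" and j = "\<lambda>gamma i. nat \<lfloor>gamma i\<rfloor>"], goal_cases)
  case (1 gamma)
  then show ?case by (simp add: wt_of_floor)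
next
  case (2 gamma)
  have "nat \<lfloor>gamma i\<rfloor> \<le> b i \<and> (i \<ge> l \<longrightarrow> nat \<lfloor>gamma i\<rfloor> = b i)" for i
  proof (cases "i < l")
    case True
    have Q: "inQplus l gamma" "inQplus l (wt_of l b - gamma)" using 2 by blast+
    obtain m where m: "gamma i = of_nat m" by (rule inQplusD[OF Q(1) True])
    obtain n where n: "(wt_of l b - gamma) i = of_nat n" by (rule inQplusD[OF Q(2) True])
    have "of_nat (b i) = (of_nat (m + n) :: rat)" using m n True by (simp add: wt_of_def minus_apply)
    then have "b i = m + n" by (simp only: of_nat_eq_iff)
    then show ?thesis using True m by simp
  next
    case False
    then show ?thesis using 2 b[of i] by (simp add: inQplus_def)
  qed
  then show ?case by (auto simp: le_fun_def)
next
  case (3 g)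
  then have "wt_of l g i = of_nat (g i)" for i using b by (auto simp: wt_of_def)
  then show ?case by simp
next
  case (4 g)
  then show ?case by (auto simp: wt_of_diff_le wt_of_inQplus)
next
  case (5 gamma)
  define g where "g i = nat \<lfloor>gamma i\<rfloor>" for i
  have gamma: "gamma = wt_of l g" using 5 unfolding g_def by (simp add: wt_of_floor)
  have le: "g \<le> b"
  proof (rule le_funI)
    fix i
    show "g i \<le> b i"
    proof (cases "i < l")
      case True
      have Q: "inQplus l (wt_of l b - wt_of l g)" using 5 unfolding gamma by blast
      obtain n where "(wt_of l b - wt_of l g) i = of_nat n" by (rule inQplusD[OF Q True])
      then have "of_nat (b i) = (of_nat (g i + n) :: rat)" using True by (simp add: wt_of_def minus_apply)
      then have "b i = g i + n" by (simp only: of_nat_eq_iff)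
      then show ?thesis by simp
    next
      case False
      then show ?thesis using 5 by (simp add: g_def inQplus_def)
    qed
  qed
  have e: "2 * (form l B gamma gamma / 2 - form l B (lam + rho l B) gamma) = - (2 * form l B (lam + rho l B) (wt_of l g) - form l B (wt_of l g) (wt_of l g))"
    by (simp add: gamma)
  have v: "vpow tvar N (2 * (form l B gamma gamma / 2 - form l B (lam + rho l B) gamma)) = tvar powi (- fe lam g)"
    unfolding vpow_xp e fe_def by (simp only: xp_minus[OF admr_fe[OF lam]])
  have "qpoch l B N (wt_of l b - gamma) = (\<Prod>j<l. qpt j (b j - g j))"
    unfolding gamma wt_of_diff_le[OF le] qpoch_wt_of ..
  then show ?case unfolding v g_def[symmetric] gamma[symmetric] by (simp add: prod_inversef[symmetric] o_def mult.assoc)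
qed

text \<open>The recursion contains its own left-hand side, with coefficient v^(-fe). If two
  solutions agree at smaller heights, their difference at b is therefore annihilated by 1 - v^(-fe),
  which is nonzero by \<open>fe_nonzero\<close>.\<close>

lemma Jrec_unique:
  assumes lam: "inP l B lam" "\<And>i. i < l \<Longrightarrow> form l B lam (alpha i) \<le> - of_int (dd B i)"
    and f: "f 0 = h 0" "\<And>beta. inQplus l beta \<Longrightarrow> f beta = Jrec l B N lam f beta"
      "\<And>beta. inQplus l beta \<Longrightarrow> h beta = Jrec l B N lam h beta"
    and beta: "inQplus l beta"
  shows "f beta = h beta"
proof -
  have "f (wt_of l b) = h (wt_of l b)" if "\<And>i. i \<ge> l \<Longrightarrow> b i = 0" for b
    using that
  proof (induction "height l b" arbitrary: b rule: less_induct)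
    case less
    show ?case
    proof (cases "height l b = 0")
      case True
      then have "wt_of l b = 0" by (intro wt_of_0) (simp add: height_eq_0)
      then show ?thesis using f(1) by simp
    next
      case False
      let ?S = "{g. g \<le> b \<and> (\<forall>i\<ge>l. g i = b i)}"
      let ?w = "\<lambda>g. (\<Prod>j<l. inverse (qpt j (b j - g j))) * tvar powi (- fe lam g)"
      have fin: "finite ?S" using finite_below[of b "[0..<l]"] by (simp add: not_less)
      have "g \<in> ?S - {b} \<Longrightarrow> f (wt_of l g) = h (wt_of l g)" for g
      proof (rule less.hyps)
        assume g: "g \<in> ?S - {b}"
        then obtain i where i: "g i \<noteq> b i" by auto
        have il: "i < l" using g i by (cases "i < l") auto
        have le: "g j \<le> b j" for j using g by (auto simp: le_fun_def)
        show "height l g < height l b"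
          unfolding height_def
        proof (rule sum_strict_mono_ex1)
          show "\<exists>j\<in>{..<l}. g j < b j" using il le[of i] i by (intro bexI[of _ i]) auto
        qed (use le in auto)
        show "\<And>i. i \<ge> l \<Longrightarrow> g i = 0" using g less.prems by auto
      qed
      then have rest: "(\<Sum>g\<in>?S - {b}. ?w g * f (wt_of l g)) = (\<Sum>g\<in>?S - {b}. ?w g * h (wt_of l g))"
        by (intro sum.cong) auto
      have wb: "?w b = tvar powi (- fe lam b)" by (simp add: qpt_def)
      have "u (wt_of l b) = tvar powi (- fe lam b) * u (wt_of l b) + (\<Sum>g\<in>?S - {b}. ?w g * u (wt_of l g))"
        if "\<And>beta. inQplus l beta \<Longrightarrow> u beta = Jrec l B N lam u beta" for u
      proof -
        have "u (wt_of l b) = (\<Sum>g\<in>?S. ?w g * u (wt_of l g))"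
          using that[OF wt_of_inQplus[of l b]] Jrec_wt_of[where b = b and f = u, OF lam(1) less.prems] by (simp add: mult.assoc)
        also have "\<dots> = ?w b * u (wt_of l b) + (\<Sum>g\<in>?S - {b}. ?w g * u (wt_of l g))"
          by (rule sum.remove[OF fin]) simp
        finally show ?thesis unfolding wb .
      qed
      note rec = this
      have diff: "x - y = p * (x - y)" if "x = p * x + s" "y = p * y + s" for x y p s :: K
        using that by (metis add_diff_cancel_right right_diff_distrib)
      have "f (wt_of l b) - h (wt_of l b) = tvar powi (- fe lam b) * (f (wt_of l b) - h (wt_of l b))"
        by (rule diff[OF rec[OF f(2), unfolded rest] rec[OF f(3)]])
      then have "(1 - tvar powi (- fe lam b)) * (f (wt_of l b) - h (wt_of l b)) = 0"
        by (simp add: left_diff_distrib)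
      moreover have "fe lam b \<noteq> 0" by (rule fe_nonzero) (use lam False in auto)
      then have "1 - tvar powi (- fe lam b) \<noteq> 0"
        using generic_q_tvar unfolding generic_q_def by force
      ultimately show ?thesis by simp
    qed
  qed
  moreover obtain b where "beta = wt_of l b" "\<And>i. i \<ge> l \<Longrightarrow> b i = 0"
    by (rule inQplus_wt_of[OF beta]) blast
  ultimately show ?thesis by blast
qed

end

lemma Jfun_recursion:
  assumes srd: "simple_root_datum l B" and adm: "admissible_N l B N" and lam: "inP l B lam"
    and P: "\<exists>P. is_pairing l B N lam P" and wd: "whittaker_data l B eps nu c"
  shows "Jfun l B N lam nu c 0 = 1"
    and "inQplus l beta \<Longrightarrow> Jfun l B N lam nu c beta = Jrec l B N lam (Jfun l B N lam nu c) beta"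
    and "inQplus l beta \<Longrightarrow> f 0 = 1 \<Longrightarrow> (\<And>beta. inQplus l beta \<Longrightarrow> f beta = Jrec l B N lam f beta) \<Longrightarrow>
      f beta = Jfun l B N lam nu c beta"
proof -
  have "is_pairing l B N lam (pairval l B N lam)" unfolding pairval_def by (rule someI_ex[OF P])
  then interpret verma_pairing l N B tvar lam "pairval l B N lam"
    by (rule is_pairing_verma_pairing[OF srd adm lam])
  interpret W: whittaker_pair l N B tvar lam "pairval l B N lam" eps nu c
    by unfold_locales (rule wd)
  interpret D: whittaker_pair l N B "inverse tvar" lam "\<lambda>x y. pairval l B N lam y x" eps nu "\<lambda>i. inverse (c i)"
    by (rule W.dual_pair)
  define theta where "theta = (SOME th. is_whittaker l B N tvar lam nu c th)"
  define thetab where "thetab = (SOME th. is_whittaker l B N (inverse tvar) lam nu (\<lambda>i. inverse (c i)) th)"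
  have th: "is_whittaker l B N tvar lam nu c theta" "is_whittaker l B N (inverse tvar) lam nu (\<lambda>i. inverse (c i)) thetab"
    unfolding theta_def thetab_def by (rule someI_ex[OF W.is_whittaker_exists], rule someI_ex[OF D.is_whittaker_exists])
  have J: "Jfun l B N lam nu c (wt_of l b) = tvar powi he lam b * pairval l B N lam (theta (wt_of l b)) (thetab (wt_of l b))" for b
    unfolding Jfun_def Let_def theta_def[symmetric] thetab_def[symmetric] using wt_of_inQplus[of l b]
    by (simp add: vpow_xp he_def)
  note rec = W.pairing_recursion[OF th, folded J]
  have qp: "W.wm.qp j n = qpt j n" for j n by (simp add: W.wm.qp_def qpt_def)
  have "wt_of l (\<lambda>_. 0) = 0" by (rule wt_of_0) simp
  then show J0: "Jfun l B N lam nu c 0 = 1" using rec(2)[of "\<lambda>_. 0"] by (simp add: height_def)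
  show Jr: "Jfun l B N lam nu c beta = Jrec l B N lam (Jfun l B N lam nu c) beta" if beta: "inQplus l beta" for beta
  proof -
    obtain b where b: "beta = wt_of l b" "\<And>i. i \<ge> l \<Longrightarrow> b i = 0" by (rule inQplus_wt_of[OF beta]) blast
    have "Jrec l B N lam (Jfun l B N lam nu c) (wt_of l b) = Jfun l B N lam nu c (wt_of l b)"
      unfolding rec(1)[of b] qp by (rule Jrec_wt_of[OF lam]) (rule b(2))
    then show ?thesis unfolding b(1) ..
  qed
  show "f beta = Jfun l B N lam nu c beta"
    if "inQplus l beta" "f 0 = 1" "\<And>beta. inQplus l beta \<Longrightarrow> f beta = Jrec l B N lam f beta"
  proof (rule Jrec_unique[OF lam lam_antidominant _ that(3) Jr that(1)])
    show "f 0 = Jfun l B N lam nu c 0" using that(2) J0 by simp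
  qed
qed

theorem theorem3p1:
  fixes l N :: nat and B eps :: "nat \<Rightarrow> nat \<Rightarrow> int" and lam :: wt
    and nu :: "nat \<Rightarrow> wt" and c :: "nat \<Rightarrow> K"
  assumes "simple_root_datum l B"
    and "admissible_N l B N"
    and "inP l B lam"
    and "\<exists>P. is_pairing l B N lam P"
    and "whittaker_data l B eps nu c"
  shows "Jfun l B N lam nu c 0 = 1
    \<and> (\<forall>beta. inQplus l beta \<longrightarrow> Jfun l B N lam nu c beta = Jrec l B N lam (Jfun l B N lam nu c) beta)
    \<and> (\<forall>f. f 0 = 1 \<and> (\<forall>beta. inQplus l beta \<longrightarrow> f beta = Jrec l B N lam f beta)
           \<longrightarrow> (\<forall>beta. inQplus l beta \<longrightarrow> f beta = Jfun l B N lam nu c beta))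
    \<and> (\<forall>eps' nu' c'. whittaker_data l B eps' nu' c' \<longrightarrow>
           (\<forall>beta. Jfun l B N lam nu' c' beta = Jfun l B N lam nu c beta))"
proof (intro conjI allI impI; (elim conjE)?)
  show "Jfun l B N lam nu c 0 = 1" by (rule Jfun_recursion[OF assms])
next
  fix beta assume "inQplus l beta"
  then show "Jfun l B N lam nu c beta = Jrec l B N lam (Jfun l B N lam nu c) beta" by (rule Jfun_recursion[OF assms])
next
  fix f beta assume "inQplus l beta" "f 0 = 1" "\<forall>beta. inQplus l beta \<longrightarrow> f beta = Jrec l B N lam f beta"
  then show "f beta = Jfun l B N lam nu c beta" by (intro Jfun_recursion(3)[OF assms]) blast+
next
  fix eps' nu' c' beta assume wd': "whittaker_data l B eps' nu' c'"
  note J' = Jfun_recursion[OF assms(1-4) wd']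
  show "Jfun l B N lam nu' c' beta = Jfun l B N lam nu c beta"
  proof (cases "inQplus l beta")
    case True
    \<comment> \<open>The recursion mentions none of eps, nu and c, so the family for the second set
      of Whittaker data solves the recursion of the first, and uniqueness identifies the
      two.\<close>
    then show ?thesis by (rule Jfun_recursion(3)[OF assms]) (rule J', assumption?)+
  next
    case False
    then show ?thesis by (simp add: Jfun_def)
  qed
qed

end
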